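(* There exists a universal constant $C>0$ such that for all integers $n\ge 2$ and $0\le g\le n/2$ the following holds. Let $\Gamma_{n,g}$ be the graph with vertex set $\mathcal{X}_{n,g}$ in which two distinct diagrams are adjacent if and only if one is a chord swap of the other. (i) If $g<n/2$, then $\Gamma_{n,g}$ has diameter at most $C(n+g^2)$. (ii) If $g=n/2$, then any two diagrams in $\mathcal{X}_{n,g}$ which are both different from the Bolza diagram are at distance at most $C(n+g^2)$ in $\Gamma_{n,g}$.
   Context: Chord diagrams. Let $P$ be a regular polygon with $2n$ vertices, labelled clockwise $1,\dots,2n$ (indices modulo $2n$), and hence $2n$ sides $\{x,x+1\}$. A chord is an unordered pair of distinct sides. A chord diagram $X$ is a set of $n$ chords forming a perfect matching of the $2n$ sides of $P$. The Bolza diagram is the chord diagram which matches together opposite sides of $P$; it has genus $\lfloor n/2\rfloor$. Genus. The genus of a chord diagram is the genus of the closed orientable surface obtained by gluing the sides of $P$ in pairs according to the chords, compatibly with orientation (a chord $\{\{x,x+1\},\{y,y+1\}\}$ identifies vertex $x$ with $y+1$ and vertex $y$ with $x+1$). Equivalently, if $V$ is the number of classes of vertices of $P$ after these identifications, the genus is $g=(n+1-V)/2$. $\mathcal{X}_{n,g}$ is the set of all chord diagrams with $n$ chords and genus $g$. Chord swap. $Y$ is a chord swap of $X$ if there are two distinct chords $\{A,B\},\{C,D\}\in X$ such that $Y=(X\setminus\{\{A,B\},\{C,D\}\})\cup\{\{A,C\},\{B,D\}\}$ or $Y=(X\setminus\{\{A,B\},\{C,D\}\})\cup\{\{A,D\},\{B,C\}\}$.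 *)

theory Defs
  imports Complex_Main "Graph_Theory.Graph_Theory"
begin

text \<open>
  The vertices of the \<open>2n\<close>-gon are labelled \<open>0, \<dots>, 2n - 1\<close> (residues modulo \<open>2n\<close>), and the
  number \<open>x\<close> also encodes the side from vertex \<open>x\<close> to vertex \<open>x + 1 mod 2n\<close>.  For \<open>n \<ge> 2\<close>
  this is a bijection between residues and sides.
\<close>

definition vertices :: "nat \<Rightarrow> nat set" where
  "vertices n = {..<2 * n}"

definition sides :: "nat \<Rightarrow> nat set" where
  "sides n = {..<2 * n}"

definition next_vertex :: "nat \<Rightarrow> nat \<Rightarrow> nat" where
  "next_vertex n x = Suc x mod (2 * n)"

definition chords :: "nat \<Rightarrow> nat set set" where
  "chords n = {{x, y} | x y. x \<in> sides n \<and> y \<in> sides n \<and> x \<noteq> y}"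

definition chord_diagram :: "nat \<Rightarrow> nat set set \<Rightarrow> bool" where
  "chord_diagram n X \<longleftrightarrow>
     X \<subseteq> chords n \<and> card X = n \<and> (\<forall>s \<in> sides n. \<exists>!c. c \<in> X \<and> s \<in> c)"

definition Bolza :: "nat \<Rightarrow> nat set set" where
  "Bolza n = {{x, x + n} | x. x < n}"

text \<open>
  Since \<open>{x, y}\<close> is unordered, each chord contributes both of its vertex identifications,
  \<open>x ~ y + 1\<close> and \<open>y ~ x + 1\<close>.
\<close>

definition glue :: "nat \<Rightarrow> nat set set \<Rightarrow> nat rel" where
  "glue n X = {(x, next_vertex n y) | x y. {x, y} \<in> X}"

definition vertex_classes :: "nat \<Rightarrow> nat set set \<Rightarrow> nat set set" where
  "vertex_classes n X = vertices n // (glue n X \<union> (glue n X)\<inverse>)\<^sup>*"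

text \<open>
  The glued surface has a cell structure with one face, \<open>n\<close> edges and one vertex for each vertex
  class, so its Euler characteristic \<open>2 - 2g\<close> equals \<open>V - n + 1\<close>.  The genus is taken in the
  reals to avoid truncated subtraction and division.
\<close>

definition genus :: "nat \<Rightarrow> nat set set \<Rightarrow> real" where
  "genus n X = (real n + 1 - real (card (vertex_classes n X))) / 2"

definition diagrams :: "nat \<Rightarrow> nat \<Rightarrow> nat set set set" where
  "diagrams n g = {X. chord_diagram n X \<and> genus n X = real g}"

definition chord_swap :: "nat set set \<Rightarrow> nat set set \<Rightarrow> bool" where
  "chord_swap X Y \<longleftrightarrow>
     (\<exists>A B C D. {A, B} \<in> X \<and> {C, D} \<in> X \<and> {A, B} \<noteq> {C, D} \<and>
        (Y = (X - {{A, B}, {C, D}}) \<union> {{A, C}, {B, D}} \<or>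
         Y = (X - {{A, B}, {C, D}}) \<union> {{A, D}, {B, C}}))"

text \<open>Undirected graphs are rendered as digraphs with a symmetric arc relation, the library's locale \<open>pair_graph\<close>.\<close>

definition swap_graph :: "nat \<Rightarrow> nat \<Rightarrow> nat set set pair_pre_digraph" where
  "swap_graph n g =
     \<lparr> pverts = diagrams n g,
       parcs = {(X, Y). X \<in> diagrams n g \<and> Y \<in> diagrams n g \<and> X \<noteq> Y \<and>
                        (chord_swap X Y \<or> chord_swap Y X)} \<rparr>"

lemma finite_diagrams: "finite (diagrams n g)"
proof (rule finite_subset)
  show "diagrams n g \<subseteq> Pow (Pow {..<2 * n})"
    unfolding diagrams_def chord_diagram_def chords_def sides_def by blast
qed simp

lemma pair_graph_swap_graph: "pair_graph (swap_graph n g)"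
proof
  show "finite (parcs (swap_graph n g))"
    by (rule finite_subset[of _ "diagrams n g \<times> diagrams n g"])
       (auto simp: swap_graph_def finite_diagrams)
  show "symmetric (with_proj (swap_graph n g))"
    by (auto simp: symmetric_def sym_def swap_graph_def)
qed (auto simp: swap_graph_def finite_diagrams)

text \<open>
  The distance is the least number of arcs of a walk; it is \<open>\<infinity>\<close> between vertices not joined by
  a walk.
\<close>

definition graph_dist :: "'a pair_pre_digraph \<Rightarrow> 'a \<Rightarrow> 'a \<Rightarrow> ereal" where
  "graph_dist G u v = wf_digraph.\<mu> (with_proj G) (\<lambda>_. 1) u v"

definition graph_diameter :: "'a pair_pre_digraph \<Rightarrow> ereal" where
  "graph_diameter G = (SUP u \<in> pverts G. SUP v \<in> pverts G. graph_dist G u v)"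

end

theory Submission
  imports Defs "HOL-Combinatorics.Permutations"
begin

text \<open>
  A diagram is encoded by a word in which every letter occurs twice; a chord swap exchanges two
  letters, and the genus is constant along the swap as long as the number \<open>V\<close> of vertex classes is.
  Two facts control \<open>V\<close>: its parity is that of \<open>n + 1\<close>, and merging two vertices lowers it by at
  most one.  They show that inserting a chord raises \<open>V\<close> by one if its two ends are put in the same
  vertex class and lowers it by one otherwise.

  While \<open>V \<ge> 3\<close>, some swap creates a chord joining two neighbouring sides.  Setting such chords
  aside one after the other leaves, after \<open>O(n)\<close> swaps, a core with \<open>V = 2\<close> and \<open>2g + 1\<close> chords, whose
  letters are separated by planar blocks; each block is passed in one swap.  In the core, a chord
  \<open>k\<close> that joins the two vertex classes can be moved anywhere, in particular to \<open>k h k\<close> around an end of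
  another chord \<open>h\<close>; then the other end of \<open>h\<close> moves freely, which gives \<open>k h k h\<close>.  Splitting off \<open>g\<close>
  such handles takes \<open>O(g)\<close> swaps each and leads to a normal form.

  If \<open>V = 1\<close> and the diagram is not the Bolza diagram, some exchange of neighbouring letters keeps
  \<open>V = 1\<close>: otherwise the lengths of the chords in the cyclic order of the vertex permutation would be
  monotone, hence constant.  From there one finds a first handle, and a handle serves as a
  catalyst for splitting off the next one.
\<close>

section \<open>Counting classes and orbits\<close>

text \<open>The target \<open>n + g^2\<close> decides where work may be spent. Since
  \<open>V = n + 1 - 2 * g\<close>, a core with two classes has exactly \<open>2 * g + 1\<close>
  chords, and work quadratic in its length is affordable, while the planar remainder must be handled
  at linear cost. Carrying the core letters past planar chords one chord at a time could cost of
  order \<open>n * g\<close>; this is why whole blocks are passed at once.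

  With one class every side is a loop: no chord joins two classes and none can be moved at will, so
  the argument for two classes has no starting point. Now \<open>n = 2 * g\<close>, and cost
  quadratic in \<open>n\<close> is allowed, but a first legal exchange has to be found, and the
  Bolza diagram is the only one in which the search among neighbours can fail.

  A swap may exchange letters at arbitrary positions, so a move needs no justification beyond
  equality of \<open>V\<close> before and after it. Nearly all of these equalities come from
  counting vertices when a chord is inserted or deleted.\<close>

definition eqcl :: "'a rel \<Rightarrow> 'a rel" where
  "eqcl R = (R \<union> R\<inverse>)\<^sup>*"

definition num_classes :: "'a set \<Rightarrow> 'a rel \<Rightarrow> nat" where
  "num_classes A R = card (A // eqcl R)"

lemma eqcl_refl [simp]: "(x, x) \<in> eqcl R"
  by (simp add: eqcl_def)

lemma eqcl_base: "(x, y) \<in> R \<Longrightarrow> (x, y) \<in> eqcl R"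
  by (auto simp: eqcl_def)

lemma eqcl_sym: "(x, y) \<in> eqcl R \<Longrightarrow> (y, x) \<in> eqcl R"
proof -
  have "sym (R \<union> R\<inverse>)" by (auto simp: sym_def)
  then have "sym (eqcl R)" unfolding eqcl_def by (rule sym_rtrancl)
  then show "(x, y) \<in> eqcl R \<Longrightarrow> (y, x) \<in> eqcl R" by (simp add: sym_def)
qed

lemma eqcl_trans [trans]: "(x, y) \<in> eqcl R \<Longrightarrow> (y, z) \<in> eqcl R \<Longrightarrow> (x, z) \<in> eqcl R"
  unfolding eqcl_def by (rule rtrancl_trans)

lemma equiv_eqcl: "equiv UNIV (eqcl R)"
  by (rule equivI) (auto simp: refl_on_def sym_def trans_def intro: eqcl_sym eqcl_trans)

lemma eqcl_image:
  assumes "\<And>x y. (x, y) \<in> R \<Longrightarrow> (f x, f y) \<in> eqcl S" and "(x, y) \<in> eqcl R"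
  shows "(f x, f y) \<in> eqcl S"
  using assms(2) unfolding eqcl_def[of R]
proof (induction rule: rtrancl_induct)
  case (step y z)
  then have "(f y, f z) \<in> eqcl S" by (auto intro: assms(1) eqcl_sym)
  with step.IH show ?case by (rule eqcl_trans)
qed simp

lemma eqcl_least:
  assumes "R \<subseteq> eqcl S" and "(x, y) \<in> eqcl R"
  shows "(x, y) \<in> eqcl S"
  using eqcl_image[of R "\<lambda>x. x" S x y] assms by auto

lemma eqcl_mono: "R \<subseteq> S \<Longrightarrow> (x, y) \<in> eqcl R \<Longrightarrow> (x, y) \<in> eqcl S"
  by (rule eqcl_least[of R]) (auto intro: eqcl_base)

lemma eqcl_eqI: "R \<subseteq> eqcl S \<Longrightarrow> S \<subseteq> eqcl R \<Longrightarrow> eqcl R = eqcl S"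
  using eqcl_least[of R S] eqcl_least[of S R] by auto

lemma eqcl_closed:
  assumes "(x, y) \<in> eqcl R" "P x" "\<And>x y. (x, y) \<in> R \<Longrightarrow> P x \<longleftrightarrow> P y"
  shows "P y"
  using assms(1) unfolding eqcl_def
  by (induction rule: rtrancl_induct) (use assms in blast)+

lemma eqcl_Image_eq: "eqcl R `` {x} = eqcl R `` {y} \<longleftrightarrow> (x, y) \<in> eqcl R"
  using eq_equiv_class_iff[OF equiv_eqcl, of x y R] by simp

lemma quotient_eqcl: "A // eqcl R = (\<lambda>x. eqcl R `` {x}) ` A"
  by (auto simp: quotient_def)

lemma finite_quotient_eqcl: "finite A \<Longrightarrow> finite (A // eqcl R)"
  by (simp add: quotient_eqcl)

text \<open>The maps need to be inverse to each other only up to equivalence. This is the form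
  required when vertices are collapsed: \<open>f\<close> may identify points and still induce a
  bijection of classes.\<close>

lemma num_classes_eq:
  assumes "f ` A \<subseteq> B" "g ` B \<subseteq> A"
    and R: "\<And>x y. (x, y) \<in> R \<Longrightarrow> (f x, f y) \<in> eqcl S"
    and S: "\<And>x y. (x, y) \<in> S \<Longrightarrow> (g x, g y) \<in> eqcl R"
    and gf: "\<And>x. x \<in> A \<Longrightarrow> (x, g (f x)) \<in> eqcl R"
    and fg: "\<And>x. x \<in> B \<Longrightarrow> (x, f (g x)) \<in> eqcl S"
  shows "num_classes A R = num_classes B S"
    and "\<And>x y. x \<in> A \<Longrightarrow> y \<in> A \<Longrightarrow> (f x, f y) \<in> eqcl S \<longleftrightarrow> (x, y) \<in> eqcl R"
proof -
  show iff: "(f x, f y) \<in> eqcl S \<longleftrightarrow> (x, y) \<in> eqcl R" if "x \<in> A" "y \<in> A" for x y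
  proof
    assume "(f x, f y) \<in> eqcl S"
    then have "(g (f x), g (f y)) \<in> eqcl R" using eqcl_image[where f = g and R = S and S = R, OF S] by simp
    from eqcl_trans[OF gf[OF that(1)] eqcl_trans[OF this eqcl_sym[OF gf[OF that(2)]]]]
    show "(x, y) \<in> eqcl R" .
  next
    assume "(x, y) \<in> eqcl R"
    then show "(f x, f y) \<in> eqcl S" using eqcl_image[where f = f and R = R and S = S, OF R] by simp
  qed
  \<comment> \<open>A class goes to the class of the image of an arbitrary representative;
    \<open>iff\<close> makes the choice irrelevant.\<close>
  define h where "h c = eqcl S `` {f (SOME x. x \<in> A \<and> c = eqcl R `` {x})}" for c
  have h: "h (eqcl R `` {x}) = eqcl S `` {f x}" if "x \<in> A" for x
  proof -
    let ?y = "SOME y. y \<in> A \<and> eqcl R `` {x} = eqcl R `` {y}"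
    have "?y \<in> A \<and> eqcl R `` {x} = eqcl R `` {?y}"
      by (rule someI[of "\<lambda>y. y \<in> A \<and> eqcl R `` {x} = eqcl R `` {y}" x]) (simp add: that)
    then have "(f x, f ?y) \<in> eqcl S" using iff[of x ?y] that by (simp add: eqcl_Image_eq)
    from eqcl_sym[OF this] show ?thesis unfolding h_def by (simp only: eqcl_Image_eq)
  qed
  have "inj_on h (A // eqcl R)"
  proof (rule inj_onI)
    fix c d assume "c \<in> A // eqcl R" "d \<in> A // eqcl R" and hcd: "h c = h d"
    then obtain x y where xy: "x \<in> A" "y \<in> A" and cd: "c = eqcl R `` {x}" "d = eqcl R `` {y}"
      unfolding quotient_eqcl by blast
    have "eqcl S `` {f x} = eqcl S `` {f y}" using hcd h[OF xy(1)] h[OF xy(2)] cd by simp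
    then show "c = d" using iff[OF xy] unfolding cd eqcl_Image_eq by simp
  qed
  moreover have "h ` (A // eqcl R) = B // eqcl S"
  proof
    show "h ` (A // eqcl R) \<subseteq> B // eqcl S"
    proof (rule image_subsetI)
      fix c assume "c \<in> A // eqcl R"
      then obtain x where x: "x \<in> A" "c = eqcl R `` {x}" unfolding quotient_eqcl by blast
      have "f x \<in> B" using x assms(1) by blast
      then show "h c \<in> B // eqcl S" unfolding x(2) h[OF x(1)] quotient_eqcl by blast
    qed
    show "B // eqcl S \<subseteq> h ` (A // eqcl R)"
    proof
      fix c assume "c \<in> B // eqcl S"
      then obtain y where y: "y \<in> B" "c = eqcl S `` {y}" unfolding quotient_eqcl by blast
      have gy: "g y \<in> A" using y assms(2) by blast
      have "c = h (eqcl R `` {g y})" unfolding y(2) h[OF gy] eqcl_Image_eq by (rule fg[OF y(1)])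
      moreover have "eqcl R `` {g y} \<in> A // eqcl R" unfolding quotient_eqcl using gy by blast
      ultimately show "c \<in> h ` (A // eqcl R)" by (rule image_eqI)
    qed
  qed
  ultimately have "bij_betw h (A // eqcl R) (B // eqcl S)" unfolding bij_betw_def ..
  then show "num_classes A R = num_classes B S"
    unfolding num_classes_def by (rule bij_betw_same_card)
qed

lemma num_classes_cong: "eqcl R = eqcl S \<Longrightarrow> num_classes A R = num_classes A S"
  by (simp add: num_classes_def)

lemma eqcl_insert_redundant:
  "(a, b) \<in> eqcl R \<Longrightarrow> eqcl (insert (a, b) R) = eqcl R"
  by (rule eqcl_eqI) (auto intro: eqcl_base)

text \<open>A path that uses the new edge several times can be shortened until it uses the edge at
  most once, in one of its two directions.\<close>

lemma eqcl_insert_iff: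
  "(x, y) \<in> eqcl (insert (a, b) R) \<longleftrightarrow>
     (x, y) \<in> eqcl R \<or> ((x, a) \<in> eqcl R \<and> (b, y) \<in> eqcl R) \<or> ((x, b) \<in> eqcl R \<and> (a, y) \<in> eqcl R)"
  (is "_ \<longleftrightarrow> ?Q x y")
proof
  assume "(x, y) \<in> eqcl (insert (a, b) R)"
  then show "?Q x y"
    unfolding eqcl_def[of "insert (a, b) R"]
  proof (induction rule: rtrancl_induct)
    case (step y z)
    from step.hyps(2) consider "(y, z) \<in> eqcl R" | "y = a" "z = b" | "y = b" "z = a"
      by (auto intro: eqcl_base eqcl_sym)
    then show ?case
    proof cases
      case 1
      then show ?thesis using step.IH by (auto intro: eqcl_trans[OF _ 1])
    next
      case 2
      then show ?thesis using step.IH by auto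
    next
      case 3
      then show ?thesis using step.IH by auto
    qed
  qed simp
next
  have R: "(x, y) \<in> eqcl R \<Longrightarrow> (x, y) \<in> eqcl (insert (a, b) R)" for x y
    by (rule eqcl_mono) auto
  have ab: "(a, b) \<in> eqcl (insert (a, b) R)" by (simp add: eqcl_base)
  assume "?Q x y"
  then show "(x, y) \<in> eqcl (insert (a, b) R)"
  proof (elim disjE conjE)
    assume "(x, a) \<in> eqcl R" "(b, y) \<in> eqcl R"
    then show ?thesis by (intro eqcl_trans[OF R eqcl_trans[OF ab R]])
  next
    assume "(x, b) \<in> eqcl R" "(a, y) \<in> eqcl R"
    then show ?thesis by (intro eqcl_trans[OF R eqcl_trans[OF eqcl_sym[OF ab] R]])
  qed (rule R)
qed

lemma num_classes_insert:
  assumes "finite A" "a \<in> A" "b \<in> A" "(a, b) \<notin> eqcl R"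
  shows "num_classes A R = Suc (num_classes A (insert (a, b) R))"
proof -
  let ?R = "eqcl R" and ?S = "eqcl (insert (a, b) R)"
  have cls: "?S `` {x} = (if (x, a) \<in> ?R \<or> (x, b) \<in> ?R then ?R `` {a} \<union> ?R `` {b} else ?R `` {x})" for x
  proof -
    have "(x, y) \<in> ?S \<longleftrightarrow> y \<in> (if (x, a) \<in> ?R \<or> (x, b) \<in> ?R then ?R `` {a} \<union> ?R `` {b} else ?R `` {x})" for y
      unfolding eqcl_insert_iff using eqcl_sym[of x a R] eqcl_sym[of x b R] eqcl_sym[of a x R] eqcl_sym[of b x R]
        eqcl_trans[of x a R y] eqcl_trans[of x b R y] eqcl_trans[of a x R y] eqcl_trans[of b x R y] by auto
    then show ?thesis by blast
  qed
  define c where "c x = ?R `` {x}" for x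
  have ceq: "c x = c y \<longleftrightarrow> (x, y) \<in> ?R" for x y by (simp add: c_def eqcl_Image_eq)
  have csub: "x \<in> c x" for x by (simp add: c_def)
  have cin: "x \<in> c y \<Longrightarrow> (x, y) \<in> ?R" for x y by (auto simp: c_def intro: eqcl_sym)
  define B where "B = {x \<in> A. (x, a) \<notin> ?R \<and> (x, b) \<notin> ?R}"
  have R: "A // ?R = insert (c a) (insert (c b) (c ` B))"
  proof -
    have "A // ?R = c ` A" by (simp add: quotient_eqcl c_def)
    moreover have "c ` A \<subseteq> insert (c a) (insert (c b) (c ` B))"
    proof (rule image_subsetI)
      fix x assume "x \<in> A"
      then have "c x = c a \<or> c x = c b \<or> x \<in> B" unfolding ceq B_def by blast
      then show "c x \<in> insert (c a) (insert (c b) (c ` B))" by (elim disjE) simp_all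
    qed
    moreover have "insert (c a) (insert (c b) (c ` B)) \<subseteq> c ` A"
      using assms(2,3) by (auto simp: B_def)
    ultimately show ?thesis by (simp only: subset_antisym)
  qed
  have S: "A // ?S = insert (c a \<union> c b) (c ` B)"
  proof -
    have "A // ?S = (\<lambda>x. if (x, a) \<in> ?R \<or> (x, b) \<in> ?R then c a \<union> c b else c x) ` A"
      unfolding quotient_eqcl cls c_def ..
    also have "\<dots> = insert (c a \<union> c b) (c ` B)"
    proof (intro subset_antisym subsetI)
      fix d assume "d \<in> insert (c a \<union> c b) (c ` B)"
      then show "d \<in> (\<lambda>x. if (x, a) \<in> ?R \<or> (x, b) \<in> ?R then c a \<union> c b else c x) ` A"
      proof
        assume "d = c a \<union> c b"
        then show ?thesis using assms(2) by (intro image_eqI[of _ _ a]) auto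
      next
        assume "d \<in> c ` B"
        then obtain x where "x \<in> B" "d = c x" by blast
        then show ?thesis by (intro image_eqI[of _ _ x]) (auto simp: B_def)
      qed
    next
      fix d assume "d \<in> (\<lambda>x. if (x, a) \<in> ?R \<or> (x, b) \<in> ?R then c a \<union> c b else c x) ` A"
      then obtain x where "x \<in> A" "d = (if (x, a) \<in> ?R \<or> (x, b) \<in> ?R then c a \<union> c b else c x)"
        by blast
      then show "d \<in> insert (c a \<union> c b) (c ` B)"
        by (cases "(x, a) \<in> ?R \<or> (x, b) \<in> ?R") (auto simp: B_def simp del: Un_iff)
    qed
    finally show ?thesis .
  qed
  have fin: "finite (c ` B)" using assms(1) by (simp add: B_def)
  have 1: "c a \<union> c b \<notin> c ` B"
  proof
    assume "c a \<union> c b \<in> c ` B"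
    then obtain x where x: "x \<in> B" "c a \<union> c b = c x" by blast
    have "x \<in> c a \<union> c b" using csub[of x] x(2) by simp
    then show False using x(1) cin by (auto simp: B_def)
  qed
  have 2: "c a \<notin> insert (c b) (c ` B)" "c b \<notin> c ` B"
    using assms(4) by (auto simp: ceq B_def dest: eqcl_sym)
  show ?thesis unfolding num_classes_def R S using fin 1 2 by simp
qed

lemma num_classes_insert_cases:
  assumes "finite A" "a \<in> A" "b \<in> A"
  shows "num_classes A R = num_classes A (insert (a, b) R) + (if (a, b) \<in> eqcl R then 0 else 1)"
  using num_classes_insert[OF assms] eqcl_insert_redundant[of a b R] by (auto simp: num_classes_def)

lemma num_classes_pos: "finite A \<Longrightarrow> A \<noteq> {} \<Longrightarrow> num_classes A R > 0"
  by (simp add: num_classes_def card_gt_0_iff finite_quotient_eqcl quotient_eqcl)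

lemma num_classes_1D:
  assumes "finite A" "num_classes A R = 1" "a \<in> A" "b \<in> A"
  shows "(a, b) \<in> eqcl R"
proof (rule ccontr)
  assume "(a, b) \<notin> eqcl R"
  from num_classes_insert[OF assms(1,3,4) this] have "num_classes A (insert (a, b) R) = 0"
    using assms(2) by simp
  with num_classes_pos[OF assms(1)] assms(3) show False by (metis empty_iff less_irrefl)
qed

lemma num_classes_1I:
  assumes "a \<in> A" "\<And>x. x \<in> A \<Longrightarrow> (a, x) \<in> eqcl R"
  shows "num_classes A R = 1"
proof -
  have "A // eqcl R = {eqcl R `` {a}}"
  proof -
    have "eqcl R `` {x} = eqcl R `` {a}" if "x \<in> A" for x
      using eqcl_sym[OF assms(2)[OF that]] by (simp only: eqcl_Image_eq)
    then show ?thesis using assms(1) unfolding quotient_eqcl by blast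
  qed
  then show ?thesis by (simp add: num_classes_def)
qed

lemma num_classes_le_2I:
  assumes "finite A" "\<And>x. x \<in> A \<Longrightarrow> (a, x) \<in> eqcl R \<or> (b, x) \<in> eqcl R"
  shows "num_classes A R \<le> 2"
proof -
  have "A // eqcl R \<subseteq> {eqcl R `` {a}, eqcl R `` {b}}"
  proof -
    have "eqcl R `` {x} = eqcl R `` {a} \<or> eqcl R `` {x} = eqcl R `` {b}" if "x \<in> A" for x
      using assms(2)[OF that] eqcl_sym[of _ x R] unfolding eqcl_Image_eq by blast
    then show ?thesis unfolding quotient_eqcl by blast
  qed
  then have "num_classes A R \<le> card {eqcl R `` {a}, eqcl R `` {b}}"
    unfolding num_classes_def by (rule card_mono[rotated]) simp
  also have "\<dots> \<le> 2" by (simp add: card_insert_if)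
  finally show ?thesis .
qed

section \<open>Orbits and the sign of a permutation\<close>

definition graph_of :: "'a set \<Rightarrow> ('a \<Rightarrow> 'a) \<Rightarrow> 'a rel" where
  "graph_of S p = {(x, p x) | x. x \<in> S}"

text \<open>Short-cutting \<open>p\<close> past \<open>x\<close> changes the sign and the number of orbits by the same amount.\<close>

lemma sign_num_orbits:
  assumes "finite S" "p permutes S"
  shows "sign p = (-1) ^ (card S + num_classes S (graph_of S p))"
  using assms
proof (induction S arbitrary: p rule: finite_induct)
  case empty
  then show ?case by (simp add: num_classes_def quotient_def)
next
  case (insert x S)
  define q where "q = transpose x (p x) \<circ> p"
  have q: "q permutes S" unfolding q_def by (rule permutes_insert_lemma[OF insert.prems])
  have p: "p = transpose x (p x) \<circ> q" by (simp add: q_def fun_eq_iff)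
  have pin: "p y \<in> insert x S \<longleftrightarrow> y \<in> insert x S" for y
    using permutes_in_image[OF insert.prems] .
  have qy: "q y = (if p y = x then p x else if y = x then x else p y)" for y
    using permutes_inj[OF insert.prems] by (auto simp: q_def transpose_def inj_eq)
  have px: "permutation (transpose x (p x))" "permutation q"
    using q insert.hyps(1) permutation_permutes[of q] by (auto simp: permutation_swap_id)
  have sgn: "sign p = (if x = p x then 1 else -1) * sign q"
    by (subst p, subst sign_compose[OF px]) (simp add: sign_swap_id)
  show ?case
  proof (cases "p x = x")
    case True
    let ?R = "graph_of (insert x S) p"
    have g: "?R = insert (x, x) (graph_of S q)"
    proof -
      have "q y = p y" if "y \<in> S" for y
        using that True insert.hyps(2) permutes_inj[OF insert.prems] qy[of y] by (auto simp: inj_eq)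
      then show ?thesis using True by (auto simp: graph_of_def)
    qed
    have e: "eqcl ?R = eqcl (graph_of S q)" unfolding g by (rule eqcl_insert_redundant) simp
    have gS: "(u, v) \<in> graph_of S q \<Longrightarrow> u \<in> S \<and> v \<in> S" for u v
      using permutes_in_image[OF q] by (auto simp: graph_of_def)
    have "(x, y) \<notin> eqcl (graph_of S q)" if "y \<in> S" for y
      using eqcl_closed[of x y "graph_of S q" "\<lambda>z. z \<notin> S"] gS that insert.hyps(2) by blast
    then have "eqcl (graph_of S q) `` {x} \<notin> S // eqcl (graph_of S q)"
      by (auto simp: quotient_eqcl eqcl_Image_eq)
    then have "num_classes (insert x S) ?R = Suc (num_classes S (graph_of S q))"
      using insert.hyps(1) by (simp add: num_classes_def e quotient_eqcl)
    then show ?thesis using True sgn insert.IH[OF q] insert.hyps by simp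
  next
    case False
    let ?R = "graph_of (insert x S) p" and ?Q = "graph_of S q"
    have pxS: "p x \<in> S" using pin[of x] False by auto
    have xpx: "(x, p x) \<in> ?R" by (auto simp: graph_of_def)
    have "num_classes S ?Q = num_classes (insert x S) ?R"
    proof (rule num_classes_eq(1)[where f = "\<lambda>y. y" and g = "\<lambda>y. if y = x then p x else y"])
      show "(u, v) \<in> eqcl ?R" if "(u, v) \<in> ?Q" for u v
      proof -
        from that have u: "u \<in> S" "v = q u" by (auto simp: graph_of_def)
        have up: "(u, p u) \<in> eqcl ?R" using u by (auto simp: graph_of_def intro!: eqcl_base)
        show ?thesis
        proof (cases "p u = x")
          case True
          then have "(u, x) \<in> eqcl ?R" using up by simp
          also have "(x, p x) \<in> eqcl ?R" using xpx by (rule eqcl_base)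
          finally show ?thesis using True u qy by simp
        next
          case False
          then show ?thesis using up u qy[of u] insert.hyps(2) by auto
        qed
      qed
      show "(if u = x then p x else u, if v = x then p x else v) \<in> eqcl ?Q" if "(u, v) \<in> ?R" for u v
      proof -
        from that have u: "u = x \<or> u \<in> S" "v = p u" by (auto simp: graph_of_def)
        show ?thesis
        proof (cases "u = x")
          case True
          then show ?thesis using u False by simp
        next
          case ux: False
          then have "(u, q u) \<in> ?Q" using u by (auto simp: graph_of_def)
          then show ?thesis using u ux qy[of u] by (auto intro: eqcl_base)
        qed
      qed
      show "(u, if u = x then p x else u) \<in> eqcl ?R" for u
        using xpx by (auto intro: eqcl_base)
      show "(u, if u = x then p x else u) \<in> eqcl ?Q" if "u \<in> S" for u
        using that insert.hyps(2) by auto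
    qed (use pxS in auto)
    then show ?thesis using False sgn insert.IH[OF q] insert.hyps by simp
  qed
qed

section \<open>Words and their vertex classes\<close>

text \<open>
  The polygon is cut open at vertex \<open>0\<close>, which is identified with the last vertex; this avoids modular
  indices and makes the empty word a sphere with one vertex.
\<close>

definition gen :: "'a list \<Rightarrow> nat rel" where
  "gen w = insert (0, length w)
     {(i, Suc j) | i j. i < length w \<and> j < length w \<and> i \<noteq> j \<and> w ! i = w ! j}"

abbreviation veq :: "'a list \<Rightarrow> nat rel" where
  "veq w \<equiv> eqcl (gen w)"

definition num_vertices :: "'a list \<Rightarrow> nat" where
  "num_vertices w = num_classes {..length w} (gen w)"

definition double_word :: "'a list \<Rightarrow> bool" where
  "double_word w \<longleftrightarrow> (\<forall>a \<in> set w. count_list w a = 2)"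

lemma veq_genI:
  "i < length w \<Longrightarrow> j < length w \<Longrightarrow> i \<noteq> j \<Longrightarrow> w ! i = w ! j \<Longrightarrow> (i, Suc j) \<in> veq w"
  by (rule eqcl_base) (auto simp: gen_def)

lemma veq_ends: "(0, length w) \<in> veq w"
  by (rule eqcl_base) (simp add: gen_def)

lemma num_vertices_pos: "num_vertices w > 0"
  unfolding num_vertices_def by (rule num_classes_pos) auto

lemma num_vertices_Nil [simp]: "num_vertices [] = 1"
  unfolding num_vertices_def by (rule num_classes_1I[of 0]) auto

lemma card_positions: "card {j. j < length w \<and> w ! j = a} = count_list w a"
  unfolding count_list_eq_length_filter length_filter_conv_card by (rule arg_cong[of _ _ card]) auto

lemma double_word_partner:
  assumes "double_word w" "i < length w"
  obtains j where "j < length w" "j \<noteq> i" "w ! j = w ! i"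
    "\<And>k. k < length w \<Longrightarrow> w ! k = w ! i \<Longrightarrow> k = i \<or> k = j"
proof -
  have "card {j. j < length w \<and> w ! j = w ! i} = 2"
    using assms by (simp add: card_positions double_word_def)
  then obtain x y where xy: "{j. j < length w \<and> w ! j = w ! i} = {x, y}" "x \<noteq> y"
    by (auto simp: card_2_iff)
  then have "i = x \<or> i = y" using assms(2) by blast
  moreover have "x < length w" "y < length w" "w ! x = w ! i" "w ! y = w ! i" using xy by blast+
  moreover have "k = x \<or> k = y" if "k < length w" "w ! k = w ! i" for k using xy that by blast
  ultimately show ?thesis using that[of x] that[of y] xy(2) by metis
qed

section \<open>The matching of sides as an involution, and the vertex permutation\<close>

definition partner :: "'a list \<Rightarrow> nat \<Rightarrow> nat" where
  "partner w i = (if i < length w then SOME j. j < length w \<and> j \<noteq> i \<and> w ! j = w ! i else i)"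

lemma partner:
  assumes "double_word w" "i < length w"
  shows "partner w i < length w" "partner w i \<noteq> i" "w ! partner w i = w ! i"
proof -
  have "\<exists>j. j < length w \<and> j \<noteq> i \<and> w ! j = w ! i"
    using double_word_partner[OF assms] by metis
  from someI_ex[OF this] show "partner w i < length w" "partner w i \<noteq> i" "w ! partner w i = w ! i"
    using assms(2) by (auto simp: partner_def)
qed

lemma partner_unique:
  assumes "double_word w" "i < length w" "j < length w" "w ! j = w ! i" "j \<noteq> i"
  shows "partner w i = j"
  using double_word_partner[OF assms(1,2)] partner[OF assms(1,2)] assms(3-5) by metis

lemma partner_invol: "double_word w \<Longrightarrow> partner w (partner w i) = i"
proof (cases "i < length w")
  case True
  assume w: "double_word w"
  show ?thesis using partner_unique[OF w partner(1)[OF w True] True] partner[OF w True] by simp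
qed (simp add: partner_def)

lemma partner_permutes: "double_word w \<Longrightarrow> partner w permutes {..<length w}"
  unfolding permutes_def
proof (intro conjI allI impI)
  fix j assume w: "double_word w"
  show "\<exists>!i. partner w i = j"
  proof (rule ex1I[of _ "partner w j"])
    show "i = partner w j" if "partner w i = j" for i
      using partner_invol[OF w, of i] that by simp
  qed (rule partner_invol[OF w])
qed (simp add: partner_def)

text \<open>Arguments out of range are fixed so that the map is a permutation in the sense of
  \<open>permutes\<close>; \<open>partner\<close> has the same default.\<close>

definition next_side :: "nat \<Rightarrow> nat \<Rightarrow> nat" where
  "next_side N i = (if i < N then Suc i mod N else i)"

lemma next_side_eq: "i < N \<Longrightarrow> next_side N i = (if Suc i = N then 0 else Suc i)"
  by (auto simp: next_side_def)

lemma next_side_permutes: "next_side N permutes {..<N}"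
proof (rule bij_imp_permutes)
  have "inj_on (next_side N) {..<N}"
    by (rule inj_onI) (auto simp: next_side_eq split: if_splits)
  moreover have "next_side N ` {..<N} \<subseteq> {..<N}" by (auto simp: next_side_eq)
  ultimately show "bij_betw (next_side N) {..<N} {..<N}"
    by (simp add: bij_betw_def endo_inj_surj)
qed (simp add: next_side_def)

lemma num_orbits_next_side:
  assumes "N > 0"
  shows "num_classes {..<N} (graph_of {..<N} (next_side N)) = 1"
proof (rule num_classes_1I[of 0])
  have "(0, x) \<in> eqcl (graph_of {..<N} (next_side N))" if "x < N" for x
    using that
  proof (induction x)
    case (Suc x)
    then have "(x, Suc x) \<in> graph_of {..<N} (next_side N)"
      by (auto simp: graph_of_def next_side_eq)
    with Suc show ?case by (blast intro: eqcl_trans eqcl_base Suc_lessD)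
  qed simp
  then show "\<And>x. x \<in> {..<N} \<Longrightarrow> (0, x) \<in> eqcl (graph_of {..<N} (next_side N))" by simp
qed (use assms in simp)

lemma card_partner_pairs:
  assumes w: "double_word w"
  shows "2 * card ((\<lambda>x. {x, partner w x}) ` {..<length w}) = length w"
proof -
  let ?C = "(\<lambda>x. {x, partner w x}) ` {..<length w}"
  have "2 * card ?C = card (\<Union>?C)"
  proof (rule card_partition)
    fix c assume "c \<in> ?C"
    then obtain x where "x < length w" "c = {x, partner w x}" by blast
    then show "card c = 2" using partner(2)[OF w, of x] by (metis card_2_iff)
  next
    fix c d assume "c \<in> ?C" "d \<in> ?C" "c \<noteq> d"
    then obtain x y where xy: "c = {x, partner w x}" "d = {y, partner w y}" by blast
    have pair: "{x, partner w x} = {z, partner w z}" if "z = x \<or> z = partner w x" for x z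
      using that partner_invol[OF w, of x] by (elim disjE) (simp_all add: insert_commute)
    have "c = d" if "z \<in> c" "z \<in> d" for z
      using pair[of z x] pair[of z y] that unfolding xy by simp
    then show "c \<inter> d = {}" using \<open>c \<noteq> d\<close> by blast
  qed auto
  moreover have "\<Union>?C = {..<length w}" using partner(1)[OF w] by auto
  ultimately show ?thesis by simp
qed

lemma num_orbits_partner:
  assumes w: "double_word w"
  shows "2 * num_classes {..<length w} (graph_of {..<length w} (partner w)) = length w"
proof -
  let ?R = "eqcl (graph_of {..<length w} (partner w))"
  have cls: "?R `` {x} = {x, partner w x}" if "x < length w" for x
  proof -
    have "(x, partner w x) \<in> ?R" using that by (auto intro!: eqcl_base simp: graph_of_def)
    moreover have "y \<in> {x, partner w x}" if "(x, y) \<in> ?R" for y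
    proof (rule eqcl_closed[OF that])
      fix u v assume "(u, v) \<in> graph_of {..<length w} (partner w)"
      then have "v = partner w u" by (auto simp: graph_of_def)
      then show "u \<in> {x, partner w x} \<longleftrightarrow> v \<in> {x, partner w x}"
        using partner_invol[OF w] by (metis insertE insertI1 insertI2 singletonD)
    qed simp
    ultimately show ?thesis by auto
  qed
  have "{..<length w} // ?R = (\<lambda>x. {x, partner w x}) ` {..<length w}"
    unfolding quotient_eqcl by (rule image_cong) (simp_all add: cls)
  then show ?thesis using card_partner_pairs[OF w] by (simp add: num_classes_def)
qed

lemma double_word_even_length: "double_word w \<Longrightarrow> even (length w)"
  using num_orbits_partner by (metis dvd_triv_left)

text \<open>Its cycles are the vertex classes: from a vertex, cross the side that starts there to
  the side glued to it, and continue at the far endpoint of that side.\<close>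

definition vertex_perm :: "'a list \<Rightarrow> nat \<Rightarrow> nat" where
  "vertex_perm w = next_side (length w) \<circ> partner w"

lemma vertex_perm_permutes: "double_word w \<Longrightarrow> vertex_perm w permutes {..<length w}"
  unfolding vertex_perm_def by (intro permutes_compose partner_permutes next_side_permutes)

text \<open>The polygon cut open has one vertex more than the closed one; folding position
  \<open>length w\<close> onto \<open>0\<close> identifies the two descriptions.\<close>

lemma num_vertices_orbits:
  assumes w: "double_word w" and "w \<noteq> []"
  shows "num_vertices w = num_classes {..<length w} (graph_of {..<length w} (vertex_perm w))"
proof -
  let ?N = "length w" and ?G = "graph_of {..<length w} (vertex_perm w)"
  have N: "?N > 0" using assms by simp
  let ?f = "\<lambda>i. if i = ?N then 0 else i"
  show ?thesis
    unfolding num_vertices_def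
  proof (rule num_classes_eq(1)[where f = ?f and g = "\<lambda>i. i"])
    fix x y assume "(x, y) \<in> gen w"
    then consider "x = 0" "y = ?N" | j where "x < ?N" "j < ?N" "x \<noteq> j" "w ! x = w ! j" "y = Suc j"
      by (auto simp: gen_def)
    then show "(?f x, ?f y) \<in> eqcl ?G"
    proof cases
      case 2
      then have "partner w x = j" using partner_unique[OF w] by simp
      then have "vertex_perm w x = ?f y" using 2 by (simp add: vertex_perm_def next_side_eq)
      then show ?thesis using 2 by (auto simp: graph_of_def intro!: eqcl_base)
    qed (use N in simp)
  next
    fix x y assume "(x, y) \<in> ?G"
    then have x: "x < ?N" "y = vertex_perm w x" by (auto simp: graph_of_def)
    have "(x, Suc (partner w x)) \<in> veq w" using partner[OF w x(1)] x by (intro veq_genI) auto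
    moreover have "(Suc (partner w x), y) \<in> veq w"
      using partner(1)[OF w x(1)] veq_ends[of w] x by (auto simp: vertex_perm_def next_side_eq intro: eqcl_sym)
    ultimately show "(x, y) \<in> veq w" by (rule eqcl_trans)
  next
    fix x assume "x \<in> {..length w}"
    then show "(x, ?f x) \<in> veq w" using eqcl_sym[OF veq_ends[of w]] by auto
  qed (use N in auto)
qed

text \<open>The vertex permutation is the product of a cycle through all sides and of the involution
  that matches them, which consists of \<open>length w div 2\<close> transpositions. Comparing signs
  fixes the parity of its number of cycles.\<close>

lemma num_vertices_parity:
  assumes w: "double_word w"
  shows "odd (num_vertices w + length w div 2)"
proof (cases "w = []")
  case False
  let ?N = "length w"
  let ?c = "num_classes {..<?N} (graph_of {..<?N} (partner w))"
  have N: "?N > 0" using False by simp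
  have perm: "permutation (next_side ?N)" "permutation (partner w)"
    using next_side_permutes[of ?N] partner_permutes[OF w] permutation_permutes by blast+
  have "sign (vertex_perm w) = sign (next_side ?N) * sign (partner w)"
    unfolding vertex_perm_def by (rule sign_compose[OF perm])
  moreover have "sign (vertex_perm w) = (-1) ^ (?N + num_vertices w)"
    using sign_num_orbits[OF _ vertex_perm_permutes[OF w]] num_vertices_orbits[OF w False] by simp
  moreover have "sign (next_side ?N) = (-1) ^ (?N + 1)"
    using sign_num_orbits[OF _ next_side_permutes[of ?N]] num_orbits_next_side[OF N] by simp
  moreover have "sign (partner w) = (-1) ^ (?N + ?c)"
    using sign_num_orbits[OF _ partner_permutes[OF w]] by simp
  ultimately have "(-1 :: int) ^ (?N + num_vertices w) = (-1) ^ (?N + 1 + (?N + ?c))"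
    by (simp add: power_add)
  then have "even (?N + num_vertices w) \<longleftrightarrow> even (?N + 1 + (?N + ?c))"
    by (metis minus_one_power_iff one_neq_neg_one)
  moreover have "?c = ?N div 2" "even ?N"
    using num_orbits_partner[OF w] double_word_even_length[OF w] by linarith+
  ultimately show ?thesis by simp
qed simp

section \<open>Exchanging letters and deleting chords\<close>

definition exchange :: "'a list \<Rightarrow> nat \<Rightarrow> nat \<Rightarrow> 'a list" where
  "exchange w i j = w[i := w ! j, j := w ! i]"

lemma length_exchange [simp]: "length (exchange w i j) = length w"
  by (simp add: exchange_def)

lemma exchange_nth:
  "i < length w \<Longrightarrow> j < length w \<Longrightarrow> k < length w \<Longrightarrow> exchange w i j ! k = w ! transpose i j k"
  by (auto simp: exchange_def transpose_def nth_list_update)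

lemma mset_exchange: "i < length w \<Longrightarrow> j < length w \<Longrightarrow> mset (exchange w i j) = mset w"
  unfolding exchange_def by (rule mset_swap)

lemma double_word_mset: "mset w = mset w' \<Longrightarrow> double_word w \<longleftrightarrow> double_word w'"
  unfolding double_word_def by (metis count_mset mset_eq_setD)

lemma double_word_exchange [simp]:
  "i < length w \<Longrightarrow> j < length w \<Longrightarrow> double_word (exchange w i j) \<longleftrightarrow> double_word w"
  using double_word_mset mset_exchange by blast

lemma exchange_exchange: "i < length w \<Longrightarrow> j < length w \<Longrightarrow> exchange (exchange w i j) i j = w"
  by (rule nth_equalityI) (auto simp: exchange_nth transpose_def)

text \<open>Each gluing of the exchanged word is a gluing of the original word with its ends moved
  by \<open>transpose i j\<close>. The two extra generators supply these moves, one for the initial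
  and one for the final vertices of sides.\<close>

lemma exchange_gen:
  assumes "i < length w" "j < length w"
  shows "gen (exchange w i j) \<subseteq> eqcl (insert (Suc i, Suc j) (insert (i, j) (gen w)))" (is "_ \<subseteq> eqcl ?E")
proof
  fix z assume "z \<in> gen (exchange w i j)"
  then consider "z = (0, length w)"
    | x y where "z = (x, Suc y)" "x < length w" "y < length w" "x \<noteq> y" "exchange w i j ! x = exchange w i j ! y"
    by (auto simp: gen_def)
  then show "z \<in> eqcl ?E"
  proof cases
    case 1
    then show ?thesis by (auto simp: gen_def intro: eqcl_base)
  next
    case (2 x y)
    let ?t = "transpose i j"
    have ij: "(i, j) \<in> eqcl ?E" "(Suc i, Suc j) \<in> eqcl ?E" by (auto intro: eqcl_base)
    have "(x, ?t x) \<in> eqcl ?E" "(Suc (?t y), Suc y) \<in> eqcl ?E"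
      using ij ij[THEN eqcl_sym] by (auto simp: transpose_def)
    moreover have "(?t x, Suc (?t y)) \<in> gen w"
      using 2 assms by (auto simp: gen_def exchange_nth transpose_def)
    then have "(?t x, Suc (?t y)) \<in> eqcl ?E" by (auto intro: eqcl_base)
    ultimately show ?thesis unfolding 2(1) by (blast intro: eqcl_trans)
  qed
qed

text \<open>
  Merging \<open>i\<close> with \<open>j\<close> and \<open>i + 1\<close> with \<open>j + 1\<close> makes the words before and after the exchange
  indistinguishable; parity then leaves a single possibility for the new number of vertices.
\<close>

lemma num_vertices_exchange:
  assumes w: "double_word w" and ij: "i < length w" "j < length w"
    and eq: "(i, j) \<in> veq w" and neq: "(Suc i, Suc j) \<notin> veq w"
  shows "num_vertices (exchange w i j) = num_vertices w"
proof -
  let ?E = "\<lambda>R. insert (Suc i, Suc j) (insert (i, j) R)"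
  let ?w = "exchange w i j" and ?A = "{..length w}"
  have "gen w \<subseteq> eqcl (?E (gen ?w))"
    using exchange_gen[of i ?w j] ij by (simp add: exchange_exchange)
  then have "eqcl (?E (gen w)) = eqcl (?E (gen ?w))"
    using exchange_gen[OF ij] by (intro eqcl_eqI) (auto intro: eqcl_base)
  then have E: "num_classes ?A (?E (gen w)) = num_classes ?A (?E (gen ?w))"
    by (rule num_classes_cong)
  have A: "finite ?A" "i \<in> ?A" "j \<in> ?A" "Suc i \<in> ?A" "Suc j \<in> ?A" using ij by auto
  have red: "eqcl (insert (i, j) (gen w)) = veq w" by (rule eqcl_insert_redundant[OF eq])
  then have "num_classes ?A (insert (i, j) (gen w)) = num_vertices w"
    unfolding num_vertices_def by (rule num_classes_cong)
  then have 1: "num_vertices w = Suc (num_classes ?A (?E (gen w)))"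
    using num_classes_insert[OF A(1,4,5), of "insert (i, j) (gen w)"] neq red by simp
  have "num_vertices ?w \<ge> num_classes ?A (?E (gen ?w))" "num_vertices ?w \<le> num_classes ?A (?E (gen ?w)) + 2"
    using num_classes_insert_cases[OF A(1-3), of "gen ?w"]
      num_classes_insert_cases[OF A(1,4,5), of "insert (i, j) (gen ?w)"]
    by (auto simp: num_vertices_def split: if_splits)
  then show ?thesis
    using 1 E num_vertices_parity[OF w] num_vertices_parity[of ?w] w ij by simp presburger
qed

lemma double_word_removal:
  assumes "double_word (p @ [a] @ q @ [a] @ r)"
  shows "a \<notin> set (p @ q @ r)" "double_word (p @ q @ r)"
proof -
  have "count_list (p @ [a] @ q @ [a] @ r) a = 2" using assms by (simp add: double_word_def)
  then show a: "a \<notin> set (p @ q @ r)" by (auto simp: count_list_0_iff)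
  show "double_word (p @ q @ r)"
    unfolding double_word_def
  proof
    fix x assume x: "x \<in> set (p @ q @ r)"
    then have "count_list (p @ [a] @ q @ [a] @ r) x = 2" using assms by (auto simp: double_word_def)
    then show "count_list (p @ q @ r) x = 2" using a x by (auto split: if_splits)
  qed
qed

text \<open>Identifying \<open>m\<close> with \<open>Suc m\<close> contracts the deleted side and,
  through the gluing, its partner. What remains of the polygon of \<open>w\<close> is the polygon of
  \<open>z\<close> in which the two gaps \<open>m\<close> and \<open>k\<close> have become one
  vertex.\<close>

lemma num_classes_removal:
  assumes a: "a \<notin> set (p @ q @ r)"
  defines "w \<equiv> p @ [a] @ q @ [a] @ r" and "z \<equiv> p @ q @ r" and "m \<equiv> length p" and "k \<equiv> length p + length q"
  shows "num_classes {..length w} (insert (m, Suc m) (gen w)) = num_classes {..length z} (insert (m, k) (gen z))"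
proof -
  let ?R = "insert (m, Suc m) (gen w)" and ?S = "insert (m, k) (gen z)"
  let ?N = "length z"
  \<comment> \<open>\<open>f\<close> collapses the endpoints of each deleted side, \<open>g\<close>
    chooses the leftmost of the vertices collapsed to one, and \<open>s\<close> gives the position
    in \<open>w\<close> of a letter of \<open>z\<close>. Hence \<open>g\<close>, acting on vertices,
    compares with \<open>\<le>\<close>, and \<open>s\<close>, acting on sides, with
    \<open><\<close>.\<close>
  define f where "f i = (if i \<le> m then i else if i \<le> Suc k then i - 1 else i - 2)" for i :: nat
  define g where "g i = (if i \<le> m then i else if i \<le> k then Suc i else i + 2)" for i :: nat
  define s where "s i = (if i < m then i else if i < k then Suc i else i + 2)" for i :: nat
  have mk: "m \<le> k" "k \<le> ?N" "length w = ?N + 2" by (auto simp: m_def k_def z_def w_def)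
  have ws: "w ! s i = z ! i" if "i < ?N" for i
  proof -
    consider "i < m" | j where "i = m + j" "j < length q" | j where "i = k + j"
      by (metis add_less_cancel_left k_def le_Suc_ex m_def not_le)
    then show ?thesis
      by cases (simp_all add: w_def z_def s_def m_def k_def nth_append)
  qed
  have wm: "w ! m = a" "w ! Suc k = a" unfolding w_def m_def k_def by (auto simp: nth_append)
  have za: "z ! i \<noteq> a" if "i < ?N" for i using a that nth_mem[OF that] by (auto simp: z_def)
  have s_cases: "x = m \<or> x = Suc k \<or> (\<exists>i < ?N. x = s i)" if "x < length w" for x
  proof -
    consider "x < m" | "x = m" | "m < x" "x < Suc k" | "x = Suc k" | "x > Suc k" by linarith
    then show ?thesis
    proof cases
      case 1
      then show ?thesis using mk by (intro disjI2 exI[of _ x]) (auto simp: s_def)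
    next
      case 3
      then show ?thesis using mk by (intro disjI2 exI[of _ "x - 1"]) (auto simp: s_def)
    next
      case 5
      then show ?thesis using mk that by (intro disjI2 exI[of _ "x - 2"]) (auto simp: s_def)
    qed auto
  qed
  have fs: "f (s i) = i" "f (Suc (s i)) = Suc i" for i
    using mk by (auto simp: f_def s_def)
  have inj: "s i = s j \<longleftrightarrow> i = j" for i j by (metis fs(1))
  have base: "(m, Suc m) \<in> eqcl ?R" by (auto intro: eqcl_base)
  have "(m, Suc (Suc k)) \<in> gen w" "(Suc k, Suc m) \<in> gen w"
    using wm mk by (auto simp: gen_def)
  then have e: "(m, Suc (Suc k)) \<in> eqcl ?R" "(Suc k, Suc m) \<in> eqcl ?R" by (auto intro: eqcl_base)
  have km: "(m, Suc k) \<in> eqcl ?R" by (rule eqcl_trans[OF base eqcl_sym[OF e(2)]])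
  have kk: "(Suc k, Suc (Suc k)) \<in> eqcl ?R" by (rule eqcl_trans[OF eqcl_sym[OF km] e(1)])
  have sg: "(g i, s i) \<in> eqcl ?R" "(Suc (s i), g (Suc i)) \<in> eqcl ?R" for i
    using mk base kk e(1) by (auto simp: g_def s_def not_less_eq_eq le_Suc_eq)
  have mS: "(m, k) \<in> eqcl ?S" by (auto intro: eqcl_base)
  show ?thesis
  proof (rule num_classes_eq(1)[where f = f and g = g])
    fix x y assume "(x, y) \<in> ?R"
    then consider "x = m" "y = Suc m" | "x = 0" "y = ?N + 2"
      | y' where "y = Suc y'" "x < length w" "y' < length w" "x \<noteq> y'" "w ! x = w ! y'"
      using mk(3) by (auto simp: gen_def)
    then show "(f x, f y) \<in> eqcl ?S"
    proof cases
      case 1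
      then show ?thesis using mk by (auto simp: f_def)
    next
      case 2
      then show ?thesis using mk veq_ends[of z] by (auto simp: f_def intro: eqcl_mono[of "gen z"])
    next
      case (3 y')
      show ?thesis
      proof (cases "w ! x = a")
        case True
        then have "x = m \<or> x = Suc k" "y' = m \<or> y' = Suc k"
          using s_cases[OF 3(2)] s_cases[OF 3(3)] ws za 3 by metis+
        then have "(x = m \<and> y = Suc (Suc k)) \<or> (x = Suc k \<and> y = Suc m)" using 3 by auto
        then show ?thesis using mk mS eqcl_sym[OF mS] by (auto simp: f_def)
      next
        case False
        then obtain i j where ij: "i < ?N" "j < ?N" "x = s i" "y' = s j"
          using s_cases[OF 3(2)] s_cases[OF 3(3)] wm 3 by metis
        then have "(i, Suc j) \<in> gen z" using 3 ws by (auto simp: gen_def)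
        then show ?thesis using ij 3(1) by (auto simp: fs intro: eqcl_base)
      qed
    qed
  next
    fix x y assume "(x, y) \<in> ?S"
    then consider "x = m" "y = k" | "x = 0" "y = ?N"
      | y' where "y = Suc y'" "x < ?N" "y' < ?N" "x \<noteq> y'" "z ! x = z ! y'"
      by (auto simp: gen_def)
    then show "(g x, g y) \<in> eqcl ?R"
    proof cases
      case 1
      then show ?thesis using mk km by (auto simp: g_def)
    next
      case 2
      have "(0, ?N + 2) \<in> eqcl ?R" using mk(3) by (auto simp: gen_def intro: eqcl_base)
      moreover have "(?N + 2, g ?N) \<in> eqcl ?R"
        using mk eqcl_sym[OF e(1)] eqcl_sym[OF kk] by (auto simp: g_def)
      ultimately show ?thesis using 2 by (auto simp: g_def intro: eqcl_trans)
    next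
      case (3 y')
      have "(s x, Suc (s y')) \<in> gen w" using 3 ws mk inj by (auto simp: gen_def s_def)
      then have "(s x, Suc (s y')) \<in> eqcl ?R" by (auto intro: eqcl_base)
      from eqcl_trans[OF sg(1) eqcl_trans[OF this sg(2)]] show ?thesis by (simp add: 3(1))
    qed
  next
    fix x assume x: "x \<in> {..length w}"
    consider "x \<le> m" | "x = Suc m" "Suc m \<le> Suc k" | "Suc m < x" "x \<le> Suc k" | "x = Suc (Suc k)" | "x > Suc (Suc k)"
      using mk by linarith
    moreover have "Suc (Suc (x - 2)) = x" if "x > Suc (Suc k)" using that by simp
    ultimately show "(x, g (f x)) \<in> eqcl ?R"
      by cases (use mk eqcl_sym[OF base] eqcl_sym[OF e(1)] eqcl_sym[OF kk] in \<open>auto simp: f_def g_def\<close>)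
  next
    fix x assume x: "x \<in> {..?N}"
    then show "(x, f (g x)) \<in> eqcl ?S" using mk by (auto simp: f_def g_def)
  qed (use mk in \<open>auto simp: f_def g_def\<close>)
qed

text \<open>After a suitable merging of two vertices in each word both counts equal
  \<open>?M\<close>, so each count is \<open>?M\<close> or \<open>?M + 1\<close>. By parity they
  differ, hence exactly one of the two pairs was already equivalent.\<close>

lemma num_vertices_removal:
  assumes w: "double_word (p @ [a] @ q @ [a] @ r)"
  shows "(length p, length p + length q) \<in> veq (p @ q @ r) \<Longrightarrow>
      num_vertices (p @ [a] @ q @ [a] @ r) = Suc (num_vertices (p @ q @ r)) \<and>
      (length p, Suc (length p)) \<notin> veq (p @ [a] @ q @ [a] @ r)"
    and "(length p, length p + length q) \<notin> veq (p @ q @ r) \<Longrightarrow>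
      num_vertices (p @ q @ r) = Suc (num_vertices (p @ [a] @ q @ [a] @ r)) \<and>
      (length p, Suc (length p)) \<in> veq (p @ [a] @ q @ [a] @ r)"
proof -
  let ?w = "p @ [a] @ q @ [a] @ r"
  let ?m = "length p" and ?k = "length p + length q" and ?z = "p @ q @ r"
  note z = double_word_removal[OF w]
  let ?M = "num_classes {..length ?w} (insert (?m, Suc ?m) (gen ?w))"
  have "num_vertices ?w = ?M + (if (?m, Suc ?m) \<in> veq ?w then 0 else 1)"
    unfolding num_vertices_def by (rule num_classes_insert_cases) auto
  moreover have "num_vertices ?z = ?M + (if (?m, ?k) \<in> veq ?z then 0 else 1)"
    unfolding num_vertices_def num_classes_removal[OF z(1)] by (rule num_classes_insert_cases) auto
  moreover have "odd (num_vertices ?w + Suc (length ?z div 2))" "odd (num_vertices ?z + length ?z div 2)"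
    using num_vertices_parity[OF w] num_vertices_parity[OF z(2)] by simp_all
  ultimately show "(?m, ?k) \<in> veq ?z \<Longrightarrow> num_vertices ?w = Suc (num_vertices ?z) \<and> (?m, Suc ?m) \<notin> veq ?w"
    "(?m, ?k) \<notin> veq ?z \<Longrightarrow> num_vertices ?z = Suc (num_vertices ?w) \<and> (?m, Suc ?m) \<in> veq ?w"
    by (auto split: if_splits)
qed

lemma exchange_append:
  "exchange (A @ [a] @ B @ [b] @ C) (length A) (Suc (length A + length B)) = A @ [b] @ B @ [a] @ C"
  by (rule nth_equalityI) (auto simp: exchange_nth transpose_def nth_append nth_Cons split: nat.split)

section \<open>Swaps, collars and handles\<close>

definition step :: "'a list \<Rightarrow> 'a list \<Rightarrow> bool" where
  "step w w' \<longleftrightarrow> w' = w \<or> (\<exists>i < length w. \<exists>j < length w. w' = exchange w i j \<and> num_vertices w' = num_vertices w)"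

abbreviation reach :: "nat \<Rightarrow> 'a list \<Rightarrow> 'a list \<Rightarrow> bool" where
  "reach k \<equiv> step ^^ k"

lemma step_refl [simp]: "step w w"
  by (simp add: step_def)

lemma step_swap:
  assumes "num_vertices (A @ [b] @ B @ [a] @ C) = num_vertices (A @ [a] @ B @ [b] @ C)"
  shows "step (A @ [a] @ B @ [b] @ C) (A @ [b] @ B @ [a] @ C)"
  unfolding step_def
  by (rule disjI2, rule exI[of _ "length A"], rule conjI[rotated], rule exI[of _ "Suc (length A + length B)"])
    (use assms exchange_append[of A a B b C] in simp_all)

lemma step_invariants:
  assumes "step w w'"
  shows "mset w' = mset w" "length w' = length w" "num_vertices w' = num_vertices w"
    "set w' = set w" "double_word w' \<longleftrightarrow> double_word w"
proof -
  show m: "mset w' = mset w" using assms by (auto simp: step_def mset_exchange)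
  show "length w' = length w" "num_vertices w' = num_vertices w" using assms by (auto simp: step_def)
  show "set w' = set w" "double_word w' \<longleftrightarrow> double_word w"
    using m mset_eq_setD double_word_mset by blast+
qed

lemma reach_invariants:
  assumes "reach k w w'"
  shows "mset w' = mset w" "length w' = length w" "num_vertices w' = num_vertices w"
    "set w' = set w" "double_word w' \<longleftrightarrow> double_word w"
proof -
  have "mset w' = mset w \<and> length w' = length w \<and> num_vertices w' = num_vertices w \<and>
      set w' = set w \<and> (double_word w' \<longleftrightarrow> double_word w)"
    using assms
  proof (induction k arbitrary: w')
    case (Suc k)
    then obtain v where "reach k w v" "step v w'" by auto
    then show ?case using Suc.IH[of v] step_invariants[of v w'] by simp
  qed simp
  then show "mset w' = mset w" "length w' = length w" "num_vertices w' = num_vertices w"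
    "set w' = set w" "double_word w' \<longleftrightarrow> double_word w" by simp_all
qed

lemma reach_trans: "reach k u v \<Longrightarrow> reach l v w \<Longrightarrow> reach (k + l) u w"
  unfolding relpowp_add by blast

lemma reach_refl [simp]: "reach k w w"
  by (induction k) auto

lemma reach_mono: "reach k u v \<Longrightarrow> k \<le> l \<Longrightarrow> reach l u v"
  using reach_trans[of k u v "l - k" v] by simp

lemma reach_step: "step u v \<Longrightarrow> reach 1 u v"
  by (simp only: relpowp_1)

lemma reach_Suc: "step u v \<Longrightarrow> reach k v w \<Longrightarrow> reach (Suc k) u w"
  by (rule relpowp_Suc_I2)

lemma exchange_append_right:
  "i < length w \<Longrightarrow> j < length w \<Longrightarrow> exchange (w @ z) i j = exchange w i j @ z"
  by (simp add: exchange_def nth_append list_update_append)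

text \<open>The constant \<open>c\<close> is what the suffix contributes to the count. It is the
  same for all rearrangements of the prefix, so a swap that is legal in the prefix stays legal in
  the whole word.\<close>

lemma reach_append:
  assumes "reach k u v" "double_word u"
    and "\<And>u'. double_word u' \<Longrightarrow> set u' = set u \<Longrightarrow> num_vertices (u' @ z) = num_vertices u' + c"
  shows "reach k (u @ z) (v @ z)"
  using assms(1)
proof (induction k arbitrary: v)
  case (Suc k)
  then obtain v' where v': "reach k u v'" "step v' v" by auto
  then have eq: "double_word v'" "double_word v" "set v' = set u" "set v = set u"
    using reach_invariants[OF v'(1)] step_invariants[OF v'(2)] assms(2) by simp_all
  have "step (v' @ z) (v @ z)"
    using v'(2) assms(3)[OF eq(1,3)] assms(3)[OF eq(2,4)]
    unfolding step_def by (auto simp: exchange_append_right) (metis exchange_append_right trans_less_add1)+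
  with Suc.IH[OF v'(1)] show ?case by auto
qed simp

lemma double_word_split:
  assumes "double_word w" "i < j" "j < length w" "w ! i = w ! j"
  obtains p q r where "w = p @ [w ! i] @ q @ [w ! i] @ r" "length p = i" "length p + length q + 1 = j"
proof
  show "w = take i w @ [w ! i] @ drop (Suc i) (take j w) @ [w ! i] @ drop (Suc j) w"
  proof -
    have "w = take j w @ w ! j # drop (Suc j) w" by (rule id_take_nth_drop[OF assms(3)])
    moreover have "take j w = take i w @ w ! i # drop (Suc i) (take j w)"
      using assms id_take_nth_drop[of i "take j w"] by simp
    ultimately show ?thesis using assms(4) by (metis append.assoc append_Cons append_Nil)
  qed
qed (use assms in auto)

text \<open>Deleting a chord contracts an edge of the graph on the glued surface: endpoints that are
  distinct merge, while the vertex of a loop splits. The additions on both sides avoid truncated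
  subtraction.\<close>

lemma num_vertices_removeAll:
  assumes w: "double_word w" and i: "i < length w"
  shows "num_vertices (removeAll (w ! i) w) + (if (i, Suc i) \<in> veq w then 0 else 1)
    = num_vertices w + (if (i, Suc i) \<in> veq w then 1 else 0)"
proof -
  define j where "j = partner w i"
  have j: "j < length w" "j \<noteq> i" "w ! j = w ! i" using partner[OF w i] by (simp_all add: j_def)
  have ij: "(i, Suc j) \<in> veq w" "(j, Suc i) \<in> veq w" using i j by (auto intro!: veq_genI)
  then have loop: "(j, Suc j) \<in> veq w \<longleftrightarrow> (i, Suc i) \<in> veq w"
    by (meson eqcl_sym eqcl_trans)
  \<comment> \<open>Whether the chord is a loop can be read off at either of its sides, so the
    earlier occurrence may be used in place of \<open>i\<close>.\<close>
  obtain a b where ab: "a < b" "b < length w" "w ! a = w ! i" "w ! b = w ! i" "(a, Suc a) \<in> veq w \<longleftrightarrow> (i, Suc i) \<in> veq w"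
    using i j loop by (metis nat_neq_iff)
  obtain p q r where pqr: "w = p @ [w ! i] @ q @ [w ! i] @ r" "length p = a"
    using double_word_split[OF w ab(1,2)] ab(3,4) by metis
  define x where "x = w ! i"
  have W: "w = p @ [x] @ q @ [x] @ r" using pqr by (simp add: x_def)
  have "x \<notin> set (p @ q @ r)" using double_word_removal(1) w W by metis
  then have z: "removeAll x w = p @ q @ r" unfolding W by simp
  have "double_word (p @ [x] @ q @ [x] @ r)" using w W by simp
  note rem = num_vertices_removal[OF this, folded W, unfolded pqr(2)]
  show ?thesis
    unfolding x_def[symmetric] z ab(5)[symmetric]
    using rem by (cases "(a, a + length q) \<in> veq (p @ q @ r)") simp_all
qed

lemma double_word_removeAll: "double_word w \<Longrightarrow> double_word (removeAll a w)"
  by (auto simp: double_word_def count_list_eq_length_filter removeAll_filter_not_eq filter_filter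
      intro!: arg_cong[of _ _ length] filter_cong) (metis (mono_tags, lifting) filter_cong)

text \<open>The vertex between the two adjacent sides is glued to no other vertex; deleting the pair
  loses just this class.\<close>

lemma num_vertices_short:
  assumes "double_word (p @ [a, a] @ q)"
  shows "num_vertices (p @ [a, a] @ q) = Suc (num_vertices (p @ q))"
  using num_vertices_removal(1)[of p a "[]" q] assms by simp

lemma double_word_notin:
  assumes "double_word (p @ [a] @ q @ [a] @ r)"
  shows "a \<notin> set p" "a \<notin> set q" "a \<notin> set r"
  using double_word_removal(1)[OF assms] by auto

text \<open>Gluing the two letters \<open>k\<close> makes the enclosed side of \<open>h\<close> a
  loop, so deleting \<open>h\<close> raises the count by one, and deleting the short chord
  \<open>k\<close> that is left lowers it again. The position of the other end of \<open>h\<close>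
  does not enter, which is what makes that end free to move.\<close>

lemma num_vertices_collar:
  assumes w: "double_word (p @ [k, h, k] @ q)" and "h \<noteq> k"
  shows "num_vertices (p @ [k, h, k] @ q) = num_vertices (removeAll h (p @ q))"
proof -
  let ?w = "p @ [k, h, k] @ q" and ?i = "Suc (length p)"
  have k: "k \<notin> set p" "k \<notin> set q" using double_word_notin[of p k "[h]" q] w by auto
  have "(Suc ?i, Suc (length p)) \<in> veq ?w"
    by (rule veq_genI) (auto simp: nth_append)
  then have loop: "(?i, Suc ?i) \<in> veq ?w" by (rule eqcl_sym)
  have h: "?w ! ?i = h" by (simp add: nth_append)
  have "removeAll h ?w = removeAll h p @ [k, k] @ removeAll h q" using assms(2) by simp
  moreover have "double_word (removeAll h ?w)" by (rule double_word_removeAll[OF w])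
  ultimately have "num_vertices (removeAll h ?w) = Suc (num_vertices (removeAll h (p @ q)))"
    using num_vertices_short[of "removeAll h p" k "removeAll h q"] by simp
  then show ?thesis using num_vertices_removeAll[OF w, of ?i] loop unfolding h by simp
qed

lemma num_vertices_handle:
  assumes w: "double_word (p @ [h, k, h, k] @ q)" and "h \<noteq> k"
  shows "num_vertices (p @ [h, k, h, k] @ q) = num_vertices (p @ q)"
proof -
  have "k \<notin> set p" "k \<notin> set q" using double_word_notin[of "p @ [h]" k "[h]" q] w by auto
  then show ?thesis using num_vertices_collar[of p h k "[k] @ q"] assms by simp
qed

text \<open>Exchanging the first letter of \<open>h k h k c\<close> with \<open>c\<close> gives
  \<open>c k h k h\<close>: a handle passes a letter in one swap, with the roles of its chords
  interchanged. Hence only the unordered pair of letters is tracked.\<close>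

lemma move_handle_right:
  assumes "double_word (p @ [h, k, h, k] @ q)" "h \<noteq> k"
  obtains x y where "x \<noteq> y" "{x, y} = {h, k}" "reach (length q) (p @ [h, k, h, k] @ q) (p @ q @ [x, y, x, y])"
proof -
  have "\<exists>x y. x \<noteq> y \<and> {x, y} = {h, k} \<and> reach (length q) (p @ [h, k, h, k] @ q) (p @ q @ [x, y, x, y])"
    using assms
  proof (induction q arbitrary: p h k)
    case (Cons c q)
    let ?w = "p @ [h, k, h, k] @ c # q" and ?w' = "(p @ [c]) @ [k, h, k, h] @ q"
    have "mset ?w' = mset ?w" by simp
    then have w': "double_word ?w'" using Cons.prems(1) double_word_mset by blast
    have "num_vertices ?w' = num_vertices ?w"
      using num_vertices_handle[OF w'] num_vertices_handle[OF Cons.prems] Cons.prems(2) by simp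
    then have "step ?w ?w'" using step_swap[of p c "[k, h, k]" h q] by simp
    moreover obtain x y where xy: "x \<noteq> y" "{x, y} = {k, h}" "reach (length q) ?w' ((p @ [c]) @ q @ [x, y, x, y])"
      using Cons.IH[OF w'] Cons.prems(2) by auto
    ultimately have "reach (length (c # q)) ?w (p @ (c # q) @ [x, y, x, y])"
      using reach_Suc[of ?w ?w'] by simp
    then show ?case using xy(1,2) by blast
  qed auto
  then show ?thesis using that by blast
qed

lemma move_handle_left:
  assumes "double_word (p @ q @ [h, k, h, k] @ r)" "h \<noteq> k"
  obtains x y where "x \<noteq> y" "{x, y} = {h, k}" "reach (length q) (p @ q @ [h, k, h, k] @ r) (p @ [x, y, x, y] @ q @ r)"
proof -
  have "\<exists>x y. x \<noteq> y \<and> {x, y} = {h, k} \<and> reach (length q) (p @ q @ [h, k, h, k] @ r) (p @ [x, y, x, y] @ q @ r)"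
    using assms
  proof (induction q arbitrary: r h k rule: rev_induct)
    case (snoc c q)
    let ?w = "(p @ q @ [c]) @ [h, k, h, k] @ r" and ?w' = "(p @ q) @ [k, h, k, h] @ c # r"
    have w: "double_word ?w" using snoc.prems(1) by simp
    have "mset ?w' = mset ?w" by simp
    then have w': "double_word ?w'" using w double_word_mset by blast
    have "num_vertices ?w' = num_vertices ?w"
      using num_vertices_handle[OF w'] num_vertices_handle[OF w] snoc.prems(2) by simp
    then have "step ?w ?w'" using step_swap[of "p @ q" k "[h, k, h]" c r] by simp
    moreover obtain x y where xy: "x \<noteq> y" "{x, y} = {k, h}" "reach (length q) ?w' (p @ [x, y, x, y] @ q @ c # r)"
      using snoc.IH[of k h "c # r"] w' snoc.prems(2) by auto
    ultimately have "reach (length (q @ [c])) ?w (p @ [x, y, x, y] @ (q @ [c]) @ r)"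
      using reach_Suc[of ?w ?w'] by simp
    moreover have "{x, y} = {h, k}" using xy(2) by auto
    ultimately show ?case using xy(1) by (intro exI[of _ x] exI[of _ y] conjI) simp_all
  qed auto
  then show ?thesis using that by blast
qed

text \<open>The far end of a collared chord is free, so it can be brought next to the collar.\<close>

lemma move_far_end_left:
  assumes "double_word (p @ [k, h, k] @ q @ [h] @ r)" "h \<noteq> k"
  shows "reach (length q) (p @ [k, h, k] @ q @ [h] @ r) (p @ [k, h, k, h] @ q @ r)"
  using assms
proof (induction q arbitrary: r rule: rev_induct)
  case (snoc c q)
  let ?w = "p @ [k, h, k] @ (q @ [c]) @ [h] @ r" and ?w' = "p @ [k, h, k] @ q @ [h] @ c # r"
  have "mset ?w' = mset ?w" by simp
  then have w': "double_word ?w'" using snoc.prems(1) double_word_mset by blast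
  have "num_vertices ?w' = num_vertices ?w"
    using num_vertices_collar[of p k h "(q @ [c]) @ [h] @ r"] num_vertices_collar[of p k h "q @ [h] @ c # r"]
      w' snoc.prems by simp
  then have "step ?w ?w'" using step_swap[of "p @ [k, h, k] @ q" h "[]" c r] by simp
  with snoc.IH[OF w' snoc.prems(2)] show ?case using reach_Suc[of ?w ?w'] by simp
qed simp

lemma move_far_end_right:
  assumes "double_word (p @ [h] @ q @ [k, h, k] @ r)" "h \<noteq> k"
  shows "reach (length q) (p @ [h] @ q @ [k, h, k] @ r) (p @ q @ [h, k, h, k] @ r)"
  using assms
proof (induction q arbitrary: p)
  case (Cons c q)
  let ?w = "p @ [h] @ (c # q) @ [k, h, k] @ r" and ?w' = "(p @ [c]) @ [h] @ q @ [k, h, k] @ r"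
  have "mset ?w' = mset ?w" by simp
  then have w': "double_word ?w'" using Cons.prems(1) double_word_mset by blast
  have "num_vertices ?w' = num_vertices ?w"
    using num_vertices_collar[of "p @ [h] @ c # q" k h r] num_vertices_collar[of "(p @ [c]) @ [h] @ q" k h r]
      w' Cons.prems by simp
  then have "step ?w ?w'" using step_swap[of p c "[]" h "q @ [k, h, k] @ r"] by simp
  with Cons.IH[OF w' Cons.prems(2)] show ?case using reach_Suc[of ?w ?w'] by simp
qed simp

text \<open>The free end of \<open>h\<close> is brought to the collar from whichever side it lies
  on, and the resulting handle is moved to the end. If it lies in \<open>q\<close>, the letters
  between it and the collar are crossed twice, hence the factor 2.\<close>

lemma collar_to_handle:
  assumes w: "double_word (p @ [k, h, k] @ q)" and "h \<noteq> k"
  obtains x y where "x \<noteq> y" "{x, y} = {h, k}"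
    "reach (length p + 2 * length q) (p @ [k, h, k] @ q) (removeAll h (p @ q) @ [x, y, x, y])"
proof -
  have "count_list (p @ [k, h, k] @ q) h = 2" using w by (simp add: double_word_def)
  then have "count_list p h + count_list q h = 1" using assms(2) by simp
  then have "h \<in> set p \<or> h \<in> set q" by (metis add_is_0 count_notin one_neq_zero)
  then show ?thesis
  proof
    assume "h \<in> set p"
    then obtain p1 p2 where p: "p = p1 @ [h] @ p2" by (metis append_Cons append_Nil split_list)
    have W: "double_word (p1 @ [h] @ p2 @ [k, h, k] @ q)" using w p by simp
    have h: "h \<notin> set p1" "h \<notin> set p2" "h \<notin> set q" using double_word_notin[of p1 h "p2 @ [k]" "k # q"] W by auto
    have 1: "reach (length p2) (p1 @ [h] @ p2 @ [k, h, k] @ q) ((p1 @ p2) @ [h, k, h, k] @ q)"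
      using move_far_end_right[OF W assms(2)] by simp
    have "double_word ((p1 @ p2) @ [h, k, h, k] @ q)" using reach_invariants(5)[OF 1] W by simp
    from move_handle_right[OF this assms(2)] obtain x y where xy: "x \<noteq> y" "{x, y} = {h, k}"
      "reach (length q) ((p1 @ p2) @ [h, k, h, k] @ q) ((p1 @ p2) @ q @ [x, y, x, y])" .
    have "removeAll h (p @ q) = p1 @ p2 @ q" using h p by simp
    then have "reach (length p2 + length q) (p @ [k, h, k] @ q) (removeAll h (p @ q) @ [x, y, x, y])"
      using reach_trans[OF 1 xy(3)] p by simp
    from that[OF xy(1,2) reach_mono[OF this]] show ?thesis using p by simp
  next
    assume "h \<in> set q"
    then obtain q1 q2 where q: "q = q1 @ [h] @ q2" by (metis append_Cons append_Nil split_list)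
    have W: "double_word (p @ [k, h, k] @ q1 @ [h] @ q2)" using w q by simp
    have h: "h \<notin> set q1" "h \<notin> set q2" "h \<notin> set p" using double_word_notin[of "p @ [k]" h "k # q1" q2] W by auto
    have k: "k \<notin> set q1" using double_word_notin[of p k "[h]" "q1 @ [h] @ q2"] W by auto
    have 1: "reach (length q1) (p @ [k, h, k] @ q1 @ [h] @ q2) (p @ [k, h, k, h] @ q1 @ q2)"
      using move_far_end_left[OF W assms(2)] by simp
    have "double_word (p @ [k, h, k, h] @ q1 @ q2)" using reach_invariants(5)[OF 1] W by simp
    from move_handle_right[OF this assms(2)[symmetric]] obtain x y where xy: "x \<noteq> y" "{x, y} = {k, h}"
      "reach (length (q1 @ q2)) (p @ [k, h, k, h] @ q1 @ q2) (p @ (q1 @ q2) @ [x, y, x, y])" .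
    have "removeAll h (p @ q) = p @ q1 @ q2" using h q by simp
    then have "reach (length q1 + length (q1 @ q2)) (p @ [k, h, k] @ q) (removeAll h (p @ q) @ [x, y, x, y])"
      using reach_trans[OF 1 xy(3)] q by simp
    moreover have "{x, y} = {h, k}" using xy(2) by auto
    ultimately show ?thesis using that[OF xy(1) _ reach_mono] q by simp
  qed
qed

lemma step_sym: "step u v \<Longrightarrow> step v u"
  unfolding step_def by (metis exchange_exchange length_exchange)

lemma reach_sym: "reach k u v \<Longrightarrow> reach k v u"
proof (induction k arbitrary: v)
  case (Suc k)
  then obtain v' where "reach k u v'" "step v' v" by auto
  with Suc.IH show ?case using reach_Suc step_sym by metis
qed simp

lemma num_classes_2D:
  assumes "finite A" "num_classes A R = 2" "a \<in> A" "b \<in> A" "t \<in> A" "(a, t) \<notin> eqcl R" "(b, t) \<notin> eqcl R"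
  shows "(a, b) \<in> eqcl R"
proof -
  have "num_classes A (insert (a, t) R) = 1"
    using num_classes_insert[OF assms(1,3,5,6)] assms(2) by simp
  from num_classes_1D[OF assms(1) this assms(3,4)] show ?thesis
    using assms(6,7) eqcl_sym[of t b R] eqcl_sym[of b a R] unfolding eqcl_insert_iff by auto
qed

lemma first_change:
  assumes "(a, b) \<notin> veq w" "a < b"
  obtains j where "a \<le> j" "j < b" "(j, Suc j) \<notin> veq w" "\<And>i. a \<le> i \<Longrightarrow> i \<le> j \<Longrightarrow> (a, i) \<in> veq w"
proof -
  define k where "k = (LEAST n. a \<le> n \<and> (a, n) \<notin> veq w)"
  have k: "a \<le> k" "(a, k) \<notin> veq w"
    using LeastI[of "\<lambda>n. a \<le> n \<and> (a, n) \<notin> veq w" b] assms unfolding k_def by auto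
  have kb: "k \<le> b" unfolding k_def by (rule Least_le) (use assms in auto)
  have min: "(a, i) \<in> veq w" if "a \<le> i" "i < k" for i
    using not_less_Least[of i "\<lambda>n. a \<le> n \<and> (a, n) \<notin> veq w"] that unfolding k_def by auto
  have "k \<noteq> a" using k(2) by auto
  then obtain j where j: "k = Suc j" "a \<le> j" using k(1) by (cases k) auto
  have "(j, Suc j) \<notin> veq w" using min[of j] k(2) j eqcl_trans[of a j "gen w" k] by auto
  then show ?thesis using that[of j] j kb min by auto
qed

lemma last_change:
  assumes "(a, b) \<notin> veq w" "a < b"
  obtains j where "a \<le> j" "j < b" "(j, Suc j) \<notin> veq w" "\<And>i. j < i \<Longrightarrow> i \<le> b \<Longrightarrow> (i, b) \<in> veq w"
proof -
  define j where "j = Max {n. n \<le> b \<and> (n, b) \<notin> veq w}"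
  have fin: "finite {n. n \<le> b \<and> (n, b) \<notin> veq w}" by simp
  have "j \<in> {n. n \<le> b \<and> (n, b) \<notin> veq w}"
    unfolding j_def by (rule Max_in) (use assms in \<open>auto intro: exI[of _ a]\<close>)
  then have j: "j \<le> b" "(j, b) \<notin> veq w" by auto
  have max: "(i, b) \<in> veq w" if "j < i" "i \<le> b" for i
  proof (rule ccontr)
    assume "(i, b) \<notin> veq w"
    then have "i \<le> j" unfolding j_def by (intro Max_ge[OF fin]) (use that in simp)
    with that show False by simp
  qed
  have aj: "a \<le> j" unfolding j_def by (rule Max_ge) (use assms in auto)
  have "j \<noteq> b" using j(2) by auto
  then have "j < b" using j(1) by simp
  moreover have "(j, Suc j) \<notin> veq w" using max[of "Suc j"] j(2) \<open>j < b\<close> eqcl_trans[of j "Suc j" "gen w" b] by auto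
  ultimately show ?thesis using that aj max by blast
qed

section \<open>Inserting a chord into a word\<close>

text \<open>The arguments \<open>s\<close> and \<open>t\<close> are gaps between letters, that is,
  vertices of the polygon of \<open>z\<close>, so that \<open>veq z\<close> decides how the count
  changes. For \<open>s \<le> t \<le> length z\<close> the new letters stand at positions
  \<open>s\<close> and \<open>Suc t\<close>.\<close>

definition insert_pair :: "'a list \<Rightarrow> 'a \<Rightarrow> nat \<Rightarrow> nat \<Rightarrow> 'a list" where
  "insert_pair z x s t = take s z @ [x] @ drop s (take t z) @ [x] @ drop t z"

lemma take_drop_take:
  assumes "s \<le> t"
  shows "take s z @ drop s (take t z) @ drop t z = z"
proof -
  have "take s z @ drop s (take t z) = take t z"
    using append_take_drop_id[of s "take t z"] assms by (simp add: min_def)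
  then have "(take s z @ drop s (take t z)) @ drop t z = z" by simp
  then show ?thesis by simp
qed

lemma mset_insert_pair: "s \<le> t \<Longrightarrow> mset (insert_pair z x s t) = mset z + {#x, x#}"
  using arg_cong[OF take_drop_take[of s t z], of mset] by (simp add: insert_pair_def)

lemma length_insert_pair [simp]: "s \<le> t \<Longrightarrow> length (insert_pair z x s t) = length z + 2"
  using arg_cong[OF mset_insert_pair[of s t z x], of size] by simp

lemma double_word_insert_pair:
  "s \<le> t \<Longrightarrow> s' \<le> t' \<Longrightarrow> double_word (insert_pair z x s t) \<longleftrightarrow> double_word (insert_pair z x s' t')"
  by (rule double_word_mset) (simp add: mset_insert_pair)

lemma num_vertices_insert_pair:
  assumes "double_word (insert_pair z x s t)" "s \<le> t" "t \<le> length z"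
  shows "num_vertices (insert_pair z x s t) =
    (if (s, t) \<in> veq z then Suc (num_vertices z) else num_vertices z - 1)"
proof -
  have len: "length (take s z) = s" "s + length (drop s (take t z)) = t" using assms(2,3) by auto
  note rem = num_vertices_removal[OF assms(1)[unfolded insert_pair_def], unfolded take_drop_take[OF assms(2)] len]
  show ?thesis
    unfolding insert_pair_def using rem by (cases "(s, t) \<in> veq z") simp_all
qed

lemma removeAll_insert_pair:
  assumes "double_word (insert_pair z x s t)" "s \<le> t"
  shows "removeAll x (insert_pair z x s t) = z"
proof -
  have "x \<notin> set (take s z @ drop s (take t z) @ drop t z)"
    using double_word_removal(1) assms(1) unfolding insert_pair_def .
  then have "removeAll x (insert_pair z x s t) = take s z @ drop s (take t z) @ drop t z"
    unfolding insert_pair_def by simp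
  then show ?thesis by (simp only: take_drop_take[OF assms(2)])
qed

lemma obtain_insert_pair:
  assumes "double_word w" "i < length w"
  obtains s t where "s \<le> t" "t \<le> length w - 2" "w = insert_pair (removeAll (w ! i) w) (w ! i) s t"
    "i = s \<or> i = Suc t"
proof -
  define j where "j = partner w i"
  define x where "x = w ! i"
  have j: "j < length w" "j \<noteq> i" "w ! j = w ! i" using partner[OF assms] by (simp_all add: j_def)
  obtain a b where ab: "a < b" "b < length w" "w ! a = x" "w ! b = x" "i = a \<or> i = b"
    using assms(2) j unfolding x_def by (metis nat_neq_iff)
  obtain p q r where pqr: "w = p @ [x] @ q @ [x] @ r" "length p = a" "length p + length q + 1 = b"
    using double_word_split[OF assms(1) ab(1,2)] ab(3,4) by metis
  have "x \<notin> set (p @ q @ r)" using double_word_removal(1) assms(1) pqr(1) by metis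
  then have rem: "removeAll x w = p @ q @ r" using pqr(1) by simp
  have "w = insert_pair (p @ q @ r) x (length p) (length p + length q)"
    unfolding insert_pair_def pqr(1) by simp
  moreover have "length p + length q \<le> length w - 2" using pqr(1) by simp
  moreover have "i = length p \<or> i = Suc (length p + length q)" using ab(5) pqr by auto
  ultimately show ?thesis using that[of "length p" "length p + length q"] rem unfolding x_def by simp
qed

lemma insert_pair_Suc_left:
  assumes "s < t" "t \<le> length z"
  shows "insert_pair z x s t = take s z @ [x] @ [] @ [z ! s] @ drop (Suc s) (take t z) @ [x] @ drop t z"
    and "insert_pair z x (Suc s) t = take s z @ [z ! s] @ [] @ [x] @ drop (Suc s) (take t z) @ [x] @ drop t z"
proof -
  have "drop s (take t z) = take t z ! s # drop (Suc s) (take t z)"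
    by (rule Cons_nth_drop_Suc[symmetric]) (use assms in auto)
  then show "insert_pair z x s t = take s z @ [x] @ [] @ [z ! s] @ drop (Suc s) (take t z) @ [x] @ drop t z"
    using assms by (simp add: insert_pair_def)
  show "insert_pair z x (Suc s) t = take s z @ [z ! s] @ [] @ [x] @ drop (Suc s) (take t z) @ [x] @ drop t z"
    using assms by (simp add: insert_pair_def take_Suc_conv_app_nth)
qed

lemma insert_pair_Suc_right:
  assumes "s \<le> t" "t < length z"
  shows "insert_pair z x s t = (take s z @ [x] @ drop s (take t z)) @ [x] @ [] @ [z ! t] @ drop (Suc t) z"
    and "insert_pair z x s (Suc t) = (take s z @ [x] @ drop s (take t z)) @ [z ! t] @ [] @ [x] @ drop (Suc t) z"
proof -
  have "drop t z = z ! t # drop (Suc t) z"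
    by (rule Cons_nth_drop_Suc[symmetric]) (use assms in auto)
  then show "insert_pair z x s t = (take s z @ [x] @ drop s (take t z)) @ [x] @ [] @ [z ! t] @ drop (Suc t) z"
    by (simp add: insert_pair_def)
  show "insert_pair z x s (Suc t) = (take s z @ [x] @ drop s (take t z)) @ [z ! t] @ [] @ [x] @ drop (Suc t) z"
    using assms by (simp add: insert_pair_def take_Suc_conv_app_nth)
qed

lemma step_insert_pair_left:
  assumes "s < t" "t \<le> length z" "num_vertices (insert_pair z x (Suc s) t) = num_vertices (insert_pair z x s t)"
  shows "step (insert_pair z x s t) (insert_pair z x (Suc s) t)"
  using assms(3) unfolding insert_pair_Suc_left[OF assms(1,2)] by (rule step_swap)

lemma step_insert_pair_right:
  assumes "s \<le> t" "t < length z" "num_vertices (insert_pair z x s (Suc t)) = num_vertices (insert_pair z x s t)"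
  shows "step (insert_pair z x s t) (insert_pair z x s (Suc t))"
  using step_swap[of "take s z @ [x] @ drop s (take t z)" "z ! t" "[]" x "drop (Suc t) z"] assms(3)
  by (simp only: insert_pair_Suc_right[OF assms(1,2)])

text \<open>The count after an insertion depends only on whether the two gaps are equivalent, so an
  end slides by one letter per swap as long as this does not change.\<close>

lemma move_left_end:
  assumes "double_word (insert_pair z x s t)" "s \<le> s'" "s' \<le> t" "t \<le> length z"
    and "\<And>i. s \<le> i \<Longrightarrow> i \<le> s' \<Longrightarrow> (i, t) \<in> veq z \<longleftrightarrow> (s, t) \<in> veq z"
  shows "reach (s' - s) (insert_pair z x s t) (insert_pair z x s' t)"
proof -
  have st: "s \<le> t" using assms(2,3) by simp
  have dbl: "double_word (insert_pair z x a b)" if "a \<le> b" for a b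
    using double_word_insert_pair[OF st that, of z x] assms(1) by (rule iffD1)
  have "reach (i - s) (insert_pair z x s t) (insert_pair z x i t)" if "s \<le> i" "i \<le> s'" for i
    using that
  proof (induction i rule: dec_induct)
    case (step i)
    have it: "i < t" using step.prems assms(3) by simp
    have "(i, t) \<in> veq z \<longleftrightarrow> (Suc i, t) \<in> veq z"
      using assms(5)[of i] assms(5)[of "Suc i"] step.hyps step.prems by simp
    then have "num_vertices (insert_pair z x (Suc i) t) = num_vertices (insert_pair z x i t)"
      using num_vertices_insert_pair[OF dbl, of i t] num_vertices_insert_pair[OF dbl, of "Suc i" t] it assms(4)
      by simp
    then have 1: "step (insert_pair z x i t) (insert_pair z x (Suc i) t)"
      by (rule step_insert_pair_left[OF it assms(4)])
    have "reach (i - s) (insert_pair z x s t) (insert_pair z x i t)"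
      by (rule step.IH) (use step.prems in simp)
    from reach_trans[OF this reach_step[OF 1]]
    have "reach ((i - s) + 1) (insert_pair z x s t) (insert_pair z x (Suc i) t)" .
    then show ?case by (rule reach_mono) (use step.hyps in simp)
  qed (rule reach_refl)
  then show ?thesis using assms(2) by blast
qed

lemma move_right_end:
  assumes "double_word (insert_pair z x s t)" "s \<le> t" "t \<le> t'" "t' \<le> length z"
    and "\<And>i. t \<le> i \<Longrightarrow> i \<le> t' \<Longrightarrow> (s, i) \<in> veq z \<longleftrightarrow> (s, t) \<in> veq z"
  shows "reach (t' - t) (insert_pair z x s t) (insert_pair z x s t')"
proof -
  have dbl: "double_word (insert_pair z x a b)" if "a \<le> b" for a b
    using double_word_insert_pair[OF assms(2) that, of z x] assms(1) by (rule iffD1)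
  have "reach (i - t) (insert_pair z x s t) (insert_pair z x s i)" if "t \<le> i" "i \<le> t'" for i
    using that
  proof (induction i rule: dec_induct)
    case (step i)
    have it: "s \<le> i" "i < length z" using step.hyps step.prems assms(2,4) by simp_all
    have "(s, i) \<in> veq z \<longleftrightarrow> (s, Suc i) \<in> veq z"
      using assms(5)[of i] assms(5)[of "Suc i"] step.hyps step.prems by simp
    then have "num_vertices (insert_pair z x s (Suc i)) = num_vertices (insert_pair z x s i)"
      using num_vertices_insert_pair[OF dbl, of s i] num_vertices_insert_pair[OF dbl, of s "Suc i"] it
      by simp
    then have 1: "step (insert_pair z x s i) (insert_pair z x s (Suc i))"
      by (rule step_insert_pair_right[OF it])
    have "reach (i - t) (insert_pair z x s t) (insert_pair z x s i)"
      by (rule step.IH) (use step.prems in simp)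
    from reach_trans[OF this reach_step[OF 1]]
    have "reach ((i - t) + 1) (insert_pair z x s t) (insert_pair z x s (Suc i))" .
    then show ?case by (rule reach_mono) (use step.hyps in simp)
  qed (rule reach_refl)
  then show ?thesis using assms(3) by blast
qed

lemma num_vertices_1D: "num_vertices w = 1 \<Longrightarrow> i \<le> length w \<Longrightarrow> j \<le> length w \<Longrightarrow> (i, j) \<in> veq w"
  unfolding num_vertices_def by (rule num_classes_1D) auto

lemma num_vertices_2D:
  "num_vertices w = 2 \<Longrightarrow> i \<le> length w \<Longrightarrow> j \<le> length w \<Longrightarrow> k \<le> length w \<Longrightarrow>
    (i, k) \<notin> veq w \<Longrightarrow> (j, k) \<notin> veq w \<Longrightarrow> (i, j) \<in> veq w"
  unfolding num_vertices_def by (rule num_classes_2D[of "{..length w}" _ i j k]) auto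

lemma exists_nonloop:
  assumes "num_vertices w \<noteq> 1"
  obtains i where "i < length w" "(i, Suc i) \<notin> veq w"
proof -
  have "\<exists>i < length w. (i, Suc i) \<notin> veq w"
  proof (rule ccontr)
    assume "\<not> (\<exists>i < length w. (i, Suc i) \<notin> veq w)"
    then have all: "(i, Suc i) \<in> veq w" if "i < length w" for i using that by blast
    have "(0, i) \<in> veq w" if "i \<le> length w" for i
      using that
    proof (induction i)
      case (Suc i)
      then show ?case using eqcl_trans[OF Suc.IH all[of i]] by simp
    qed simp
    then have "num_vertices w = 1" unfolding num_vertices_def by (intro num_classes_1I[of 0]) auto
    with assms show False ..
  qed
  then show ?thesis using that by blast
qed

text \<open>
  Deleting a chord whose sides join two different vertex classes leaves a single class, so that such
  a chord can be reinserted anywhere without changing the number of classes.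
\<close>

lemma extract_handle_two_vertices:
  assumes w: "double_word w" and V: "num_vertices w = 2" and len: "length w \<ge> 4"
  obtains u x y where "x \<noteq> y" "reach (4 * length w) w (u @ [x, y, x, y])"
proof -
  obtain i where i: "i < length w" "(i, Suc i) \<notin> veq w" using exists_nonloop[of w] V by auto
  define e where "e = w ! i"
  define z where "z = removeAll e w"
  obtain s t where st: "s \<le> t" "t \<le> length w - 2" and w_eq: "w = insert_pair z e s t"
    using obtain_insert_pair[OF w i(1)] unfolding z_def e_def by metis
  have lz: "length w = length z + 2" using w_eq st(1) by simp
  have "num_vertices z = 1"
    using num_vertices_removeAll[OF w i(1)] i(2) V by (simp add: z_def e_def)
  then have z1: "(a, b) \<in> veq z" if "a \<le> length z" "b \<le> length z" for a b
    using that num_vertices_1D by blast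
  have dbl: "double_word (insert_pair z e a b)" if "a \<le> b" for a b
    using double_word_insert_pair[OF st(1) that, of z e] w unfolding w_eq[symmetric] by (rule iffD1)
  \<comment> \<open>Every placement of \<open>e\<close> is legal here. The gaps \<open>0\<close> and
    \<open>1\<close> are aimed at because they make \<open>e\<close> a collar of the first letter of
    \<open>z\<close>.\<close>
  have "reach (s - 0) (insert_pair z e 0 t) (insert_pair z e s t)"
    by (rule move_left_end) (use st lz z1 dbl in auto)
  from reach_sym[OF this] have 1: "reach s w (insert_pair z e 0 t)" unfolding w_eq[symmetric] by simp
  \<comment> \<open>The bound \<open>Suc t\<close> also covers \<open>t = 0\<close>, where the end
    has to move forward to gap \<open>1\<close>.\<close>
  have 2: "reach (Suc t) (insert_pair z e 0 t) (insert_pair z e 0 1)"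
  proof (cases "t \<ge> 1")
    case True
    have "reach (t - 1) (insert_pair z e 0 1) (insert_pair z e 0 t)"
      by (rule move_right_end) (use st lz z1 dbl True in auto)
    from reach_sym[OF this] show ?thesis by (rule reach_mono) simp
  next
    case False
    then have "t = 0" by simp
    moreover have "reach (1 - 0) (insert_pair z e 0 0) (insert_pair z e 0 1)"
      by (rule move_right_end) (use len lz z1 dbl in auto)
    ultimately show ?thesis by simp
  qed
  obtain a z' where z': "z = a # z'" using len lz by (cases z) auto
  have eq: "insert_pair z e 0 1 = [] @ [e, a, e] @ z'" by (simp add: insert_pair_def z')
  then have d: "double_word ([] @ [e, a, e] @ z')" using dbl[of 0 1] by simp
  have "a \<noteq> e" using double_word_notin(2)[of "[]" e "[a]" z'] d by auto
  from collar_to_handle[OF d this] obtain x y where xy: "x \<noteq> y"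
    "reach (length ([] :: 'a list) + 2 * length z') ([] @ [e, a, e] @ z') (removeAll a ([] @ z') @ [x, y, x, y])" .
  have "reach (s + Suc t + (length ([] :: 'a list) + 2 * length z')) w (removeAll a ([] @ z') @ [x, y, x, y])"
    using reach_trans[OF reach_trans[OF 1 2]] xy(2) eq by simp
  then have "reach (4 * length w) w (removeAll a ([] @ z') @ [x, y, x, y])"
    by (rule reach_mono) (use st lz z' in auto)
  with that xy(1) show ?thesis by blast
qed

section \<open>Pinching\<close>

text \<open>Gluing along \<open>b\<close> identifies the vertex before the first \<open>b\<close>
  with the vertex before \<open>c\<close>, so these two letters qualify for an exchange. The
  vertices after them are, up to gluing, the two ends of the stretch \<open>b c\<close>, which
  differ by assumption.\<close>

lemma num_vertices_pinch_left:
  assumes w: "double_word (A @ [b] @ B @ [b, c] @ C)"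
    and neq: "(Suc (length A + length B), Suc (length A + length B) + 2) \<notin> veq (A @ [b] @ B @ [b, c] @ C)"
  shows "num_vertices (A @ [c] @ B @ [b, b] @ C) = num_vertices (A @ [b] @ B @ [b, c] @ C)"
proof -
  let ?w = "A @ [b] @ B @ [b, c] @ C" and ?i = "length A" and ?m = "Suc (length A + length B)"
  have nth: "?w ! ?i = b" "?w ! ?m = b"
    using nth_append_length[of "A @ [b] @ B" b "c # C"] by simp_all
  have 1: "(?i, Suc ?m) \<in> veq ?w" by (rule veq_genI) (use nth in simp_all)
  have 2: "(?m, Suc ?i) \<in> veq ?w" by (rule veq_genI) (use nth in simp_all)
  have "exchange ?w ?i (Suc ?m) = A @ [c] @ B @ [b, b] @ C"
    using exchange_append[of A b "B @ [b]" c C] by simp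
  moreover have "(Suc ?i, Suc (Suc ?m)) \<notin> veq ?w"
    using neq eqcl_trans[OF 2] by auto
  then have "num_vertices (exchange ?w ?i (Suc ?m)) = num_vertices ?w"
    by (intro num_vertices_exchange[OF w _ _ 1]) simp_all
  ultimately show ?thesis by simp
qed

lemma num_vertices_pinch_right:
  assumes w: "double_word (A @ [b, c] @ B @ [b] @ C)"
    and neq: "(length A, length A + 2) \<notin> veq (A @ [b, c] @ B @ [b] @ C)"
  shows "num_vertices (A @ [b, b] @ B @ [c] @ C) = num_vertices (A @ [b, c] @ B @ [b] @ C)"
proof -
  let ?w = "A @ [b, c] @ B @ [b] @ C" and ?m = "length A" and ?j = "length A + length B + 2"
  have nth: "?w ! ?j = b" "?w ! ?m = b"
    using nth_append_length[of "A @ [b, c] @ B" b C] by simp_all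
  have 1: "(?j, Suc ?m) \<in> veq ?w" by (rule veq_genI) (use nth in simp_all)
  have 2: "(?m, Suc ?j) \<in> veq ?w" by (rule veq_genI) (use nth in simp_all)
  have "exchange ?w (Suc ?m) ?j = A @ [b, b] @ B @ [c] @ C"
    using exchange_append[of "A @ [b]" c B b C] by simp
  moreover have "(Suc (Suc ?m), Suc ?j) \<notin> veq ?w"
    using neq eqcl_trans[OF 2 eqcl_sym, of "Suc (Suc ?m)"] by auto
  then have "num_vertices (exchange ?w (Suc ?m) ?j) = num_vertices ?w"
    by (intro num_vertices_exchange[OF w _ _ eqcl_sym[OF 1]]) simp_all
  ultimately show ?thesis by simp
qed

lemma other_occurrence:
  assumes "double_word (P @ [b, c] @ Q)" "b \<noteq> c"
  shows "b \<in> set P \<or> b \<in> set Q"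
proof -
  have "count_list (P @ [b, c] @ Q) b = 2" using assms(1) by (simp add: double_word_def)
  then have "count_list P b + count_list Q b = 1" using assms(2) by simp
  then show ?thesis by (metis add_is_0 count_notin one_neq_zero)
qed

lemma pinch:
  assumes w: "double_word (P @ [b, c] @ Q)" and neq: "(length P, length P + 2) \<notin> veq (P @ [b, c] @ Q)"
  obtains P' Q' a where "step (P @ [b, c] @ Q) (P' @ [a, a] @ Q')"
proof (cases "b = c")
  case True
  then show ?thesis using that[of P b Q] by simp
next
  case False
  from other_occurrence[OF w False] show ?thesis
  proof
    assume "b \<in> set P"
    then obtain A B where P: "P = A @ [b] @ B" by (metis append_Cons append_Nil split_list)
    have "num_vertices (A @ [c] @ (B @ [b]) @ [b] @ Q) = num_vertices (A @ [b] @ (B @ [b]) @ [c] @ Q)"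
      using num_vertices_pinch_left[of A b B c Q] w neq by (simp add: P)
    from step_swap[OF this] show ?thesis using that[of "A @ [c] @ B" b Q] by (simp add: P)
  next
    assume "b \<in> set Q"
    then obtain B C where Q: "Q = B @ [b] @ C" by (metis append_Cons append_Nil split_list)
    have "num_vertices ((P @ [b]) @ [b] @ B @ [c] @ C) = num_vertices ((P @ [b]) @ [c] @ B @ [b] @ C)"
      using num_vertices_pinch_right[of P b c B C] w neq by (simp add: Q)
    from step_swap[OF this] show ?thesis using that[of P b "B @ [c] @ C"] by (simp add: Q)
  qed
qed

text \<open>
  Exchanging \<open>c\<close> with the other end of \<open>b\<close> turns the chord \<open>b\<close> into a collar of \<open>x\<close>; after deleting
  \<open>x\<close> this is a pinching move.
\<close>

lemma pinch_to_collar: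
  assumes w: "double_word (P @ [b, x, c] @ Q)" and V: "num_vertices (P @ [b, x, c] @ Q) = 1"
    and xbc: "x \<noteq> b" "x \<noteq> c" "b \<noteq> c"
    and V2: "num_vertices (removeAll x (P @ [b, x, c] @ Q)) = 2"
    and neq: "(length (removeAll x P), length (removeAll x P) + 2) \<notin> veq (removeAll x (P @ [b, x, c] @ Q))"
  obtains P' Q' where "step (P @ [b, x, c] @ Q) (P' @ [b, x, b] @ Q')" "length P' = length P" "length Q' = length Q"
proof -
  let ?r = "removeAll x"
  have z: "double_word (?r P @ [b, c] @ ?r Q)"
    using double_word_removeAll[OF w, of x] xbc by simp
  have "b \<in> set (?r P) \<or> b \<in> set (?r Q)" using other_occurrence[OF z xbc(3)] .
  then show ?thesis
  proof
    assume "b \<in> set (?r P)"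
    then have "b \<in> set P" by simp
    then obtain A B where P: "P = A @ [b] @ B" by (metis append_Cons append_Nil split_list)
    let ?w' = "A @ [c] @ B @ [b, x, b] @ Q"
    have zP: "double_word (?r A @ [b] @ ?r B @ [b, c] @ ?r Q)" using z xbc by (simp add: P)
    have "(Suc (length (?r A) + length (?r B)), Suc (length (?r A) + length (?r B)) + 2)
        \<notin> veq (?r A @ [b] @ ?r B @ [b, c] @ ?r Q)"
      using neq xbc by (simp add: P)
    \<comment> \<open>Without \<open>x\<close> the move is a pinch and keeps two classes, one of
      which is due to the short chord \<open>b b\<close>. With \<open>x\<close> put back,
      \<open>b\<close> is a collar and adds nothing, so a single class is left, as before the
      move.\<close>
    from num_vertices_pinch_left[OF zP this]
    have 1: "num_vertices (?r A @ [c] @ ?r B @ [b, b] @ ?r Q) = 2" using V2 xbc by (simp add: P)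
    have "mset ?w' = mset (P @ [b, x, c] @ Q)" by (simp add: P)
    then have w': "double_word ?w'" using w double_word_mset by blast
    have "double_word (?r A @ [c] @ ?r B @ [b, b] @ ?r Q)"
      using double_word_removeAll[OF w', of x] xbc by simp
    with 1 have "num_vertices (?r A @ [c] @ ?r B @ ?r Q) = 1"
      using num_vertices_short[of "?r A @ [c] @ ?r B" b "?r Q"] by simp
    then have "num_vertices ?w' = 1"
      using num_vertices_collar[of "A @ [c] @ B" b x Q] w' xbc by simp
    then have "num_vertices (A @ [c] @ (B @ [b, x]) @ [b] @ Q) = num_vertices (A @ [b] @ (B @ [b, x]) @ [c] @ Q)"
      using V by (simp add: P)
    from step_swap[OF this] show ?thesis using that[of "A @ [c] @ B" Q] by (simp add: P)
  next
    assume "b \<in> set (?r Q)"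
    then have "b \<in> set Q" by simp
    then obtain B C where Q: "Q = B @ [b] @ C" by (metis append_Cons append_Nil split_list)
    let ?w' = "P @ [b, x, b] @ B @ [c] @ C"
    have zP: "double_word (?r P @ [b, c] @ ?r B @ [b] @ ?r C)" using z xbc by (simp add: Q)
    have "(length (?r P), length (?r P) + 2) \<notin> veq (?r P @ [b, c] @ ?r B @ [b] @ ?r C)"
      using neq xbc by (simp add: Q)
    from num_vertices_pinch_right[OF zP this]
    have 1: "num_vertices (?r P @ [b, b] @ ?r B @ [c] @ ?r C) = 2" using V2 xbc by (simp add: Q)
    have "mset ?w' = mset (P @ [b, x, c] @ Q)" by (simp add: Q)
    then have w': "double_word ?w'" using w double_word_mset by blast
    have "double_word (?r P @ [b, b] @ ?r B @ [c] @ ?r C)"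
      using double_word_removeAll[OF w', of x] xbc by simp
    with 1 have "num_vertices (?r P @ ?r B @ [c] @ ?r C) = 1"
      using num_vertices_short[of "?r P" b "?r B @ [c] @ ?r C"] by simp
    then have "num_vertices ?w' = 1"
      using num_vertices_collar[of P b x "B @ [c] @ C"] w' xbc by simp
    then have "num_vertices ((P @ [b, x]) @ [b] @ B @ [c] @ C) = num_vertices ((P @ [b, x]) @ [c] @ B @ [b] @ C)"
      using V by (simp add: Q)
    from step_swap[OF this] show ?thesis using that[of P "B @ [c] @ C"] by (simp add: Q)
  qed
qed

lemma no_short:
  assumes "double_word w" "num_vertices w = 1" "Suc i < length w"
  shows "w ! i \<noteq> w ! Suc i"
proof
  assume eq: "w ! i = w ! Suc i"
  obtain p q r where pqr: "w = p @ [w ! i] @ q @ [w ! i] @ r" "length p = i" "length p + length q + 1 = Suc i"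
    using double_word_split[OF assms(1) lessI assms(3) eq] .
  have "q = []" using pqr(2,3) by simp
  then obtain a where a: "w = p @ [a, a] @ r" using pqr(1) by simp
  then have "num_vertices w = Suc (num_vertices (p @ r))" using num_vertices_short assms(1) by metis
  with num_vertices_pos[of "p @ r"] assms(2) show False by simp
qed

lemma exchange_insert_pair_left:
  assumes "s < t" "t \<le> length z"
  shows "exchange (insert_pair z x s t) s (Suc s) = insert_pair z x (Suc s) t"
  unfolding insert_pair_Suc_left[OF assms]
  using exchange_append[of "take s z" x "[]" "z ! s" "drop (Suc s) (take t z) @ [x] @ drop t z"] assms by simp

lemma exchange_insert_pair_right:
  assumes "s \<le> t" "t < length z"
  shows "exchange (insert_pair z x s t) (Suc t) (Suc (Suc t)) = insert_pair z x s (Suc t)"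
  unfolding insert_pair_Suc_right[OF assms]
  using exchange_append[of "take s z @ [x] @ drop s (take t z)" x "[]" "z ! t" "drop (Suc t) z"] assms by simp

text \<open>Either \<open>b = c\<close> and \<open>x\<close> has a collar already, or one pinch
  around \<open>x\<close> creates it.\<close>

lemma handle_from_collarable:
  assumes w: "double_word w" and V: "num_vertices w = 1" and weq: "w = P @ [b, x, c] @ Q"
    and z: "removeAll x w = z" "num_vertices z = 2"
    and m: "m + 2 \<le> length z" "m = length (removeAll x P)" "(m, m + 2) \<notin> veq z"
  obtains u y y' where "y \<noteq> y'" "reach (1 + 2 * length w) w (u @ [y, y', y, y'])"
proof -
  have x: "x \<noteq> b" "x \<noteq> c"
    using no_short[OF w V, of "length P"] no_short[OF w V, of "Suc (length P)"] weq
    by (auto simp: nth_append)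
  show ?thesis
  proof (cases "b = c")
    case True
    from collar_to_handle[of P b x Q] w weq x True obtain y y' where
      "y \<noteq> y'" "reach (length P + 2 * length Q) w (removeAll x (P @ Q) @ [y, y', y, y'])" by metis
    note yy = this
    have "length P + 2 * length Q \<le> 1 + 2 * length w" by (simp add: weq)
    from reach_mono[OF yy(2) this] that yy(1) show ?thesis by (metis append.assoc)
  next
    case False
    obtain P' Q' where PQ: "step w (P' @ [b, x, b] @ Q')" "length P' = length P" "length Q' = length Q"
      using pinch_to_collar[of P b x c Q] w V weq x False z m by metis
    have "double_word (P' @ [b, x, b] @ Q')" using step_invariants(5)[OF PQ(1)] w by simp
    from collar_to_handle[OF this x(1)] obtain y y' where yy: "y \<noteq> y'"
      "reach (length P' + 2 * length Q') (P' @ [b, x, b] @ Q') (removeAll x (P' @ Q') @ [y, y', y, y'])" .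
    from reach_Suc[OF PQ(1) yy(2)] have "reach (1 + 2 * length w) w (removeAll x (P' @ Q') @ [y, y', y, y'])"
      by (rule reach_mono) (use PQ weq in simp)
    with that yy(1) show ?thesis by blast
  qed
qed

text \<open>Deleting the chord \<open>x\<close> leaves a word \<open>z\<close> with two classes, and
  the legal exchange says that the side of \<open>z\<close> crossed by the end of \<open>x\<close>
  stays within one class. Sliding this end towards the other one, up to the first change of class,
  keeps the count and puts it between a loop of \<open>z\<close> and a side that is no loop. The
  outer endpoints of these two sides are then inequivalent, as a pinch requires.\<close>

lemma extract_first_handle:
  assumes w: "double_word w" and V: "num_vertices w = 1"
    and i: "Suc i < length w" "num_vertices (exchange w i (Suc i)) = 1"
  obtains u x y where "x \<noteq> y" "reach (1 + 3 * length w) w (u @ [x, y, x, y])"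
proof -
  note result = that
  define x where "x = w ! i"
  define z where "z = removeAll x w"
  from obtain_insert_pair[OF w Suc_lessD[OF i(1)], folded x_def, folded z_def]
  obtain s t where st: "s \<le> t" "t \<le> length w - 2" and w_eq: "w = insert_pair z x s t" and ist: "i = s \<or> i = Suc t" .
  have lz: "length w = length z + 2" using arg_cong[OF w_eq, of length] st(1) by simp
  have tz: "t \<le> length z" using st lz by simp
  have dbl: "double_word (insert_pair z x a b)" if "a \<le> b" for a b
    using double_word_insert_pair[OF st(1) that, of z x] w unfolding w_eq[symmetric] by (rule iffD1)
  have Vins: "num_vertices (insert_pair z x a b) =
      (if (a, b) \<in> veq z then Suc (num_vertices z) else num_vertices z - 1)" if "a \<le> b" "b \<le> length z" for a b
    using num_vertices_insert_pair[OF dbl] that by blast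
  have "num_vertices z > 0" by (rule num_vertices_pos)
  note z0 = this
  note Vw = Vins[OF st(1) tz, folded w_eq, unfolded V]
  \<comment> \<open>Ends in the same class would give \<open>w\<close> at least two vertices. So
    they lie in different classes, and \<open>z\<close> has one vertex more than
    \<open>w\<close>.\<close>
  have stn: "(s, t) \<notin> veq z"
  proof
    assume "(s, t) \<in> veq z"
    then have "Suc (num_vertices z) = 1" using Vw by (simp only: if_True)
    then show False using z0 by simp
  qed
  then have "1 = num_vertices z - 1" using Vw by (simp only: if_False)
  then have z2: "num_vertices z = 2" by simp
  have "s \<noteq> t" using stn eqcl_refl[of s "gen z"] by metis
  then have s_t: "s < t" using st(1) by simp
  have rem: "removeAll x (insert_pair z x a b) = z" if "a \<le> b" for a b
    using removeAll_insert_pair[OF dbl[OF that] that] .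
  have V1: "num_vertices (insert_pair z x a b) = 1" if "a \<le> b" "b \<le> length z" "(a, b) \<notin> veq z" for a b
    using Vins that z2 by simp
  have x_z: "x \<notin> set z" unfolding z_def by simp
  have finish: ?thesis if r: "reach (length w) w w'" and w': "w' = insert_pair z x a b" "a \<le> b" "b \<le> length z"
      "(a, b) \<notin> veq z" and eq: "w' = P @ [b', x, c'] @ Q" and m: "length (removeAll x P) + 2 \<le> length z"
      "(length (removeAll x P), length (removeAll x P) + 2) \<notin> veq z"
    for w' a b P b' c' Q
  proof -
    have "double_word w'" unfolding w'(1) by (rule dbl[OF w'(2)])
    moreover have "num_vertices w' = 1" unfolding w'(1) by (rule V1[OF w'(2-4)])
    moreover have "removeAll x w' = z" unfolding w'(1) by (rule rem[OF w'(2)])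
    ultimately have this: "double_word w'" "num_vertices w' = 1" "removeAll x w' = z" by blast+
    from handle_from_collarable[OF this(1,2) eq this(3) z2 m(1) refl m(2)]
    obtain u y y' where yy: "y \<noteq> y'" "reach (1 + 2 * length w') w' (u @ [y, y', y, y'])" .
    from reach_trans[OF r yy(2)] have "reach (1 + 3 * length w) w (u @ [y, y', y, y'])"
      by (rule reach_mono) (simp add: reach_invariants(2)[OF r])
    with result yy(1) show ?thesis by blast
  qed
  from ist show ?thesis
  proof
    assume "i = s"
    then have "num_vertices (insert_pair z x (Suc s) t) = 1"
      using i(2) exchange_insert_pair_left[OF s_t tz, of x] w_eq by simp
    then have Ssn: "(Suc s, t) \<notin> veq z" using Vins[of "Suc s" t] s_t tz z2 by (simp split: if_splits)
    then have "Suc s \<noteq> t" by auto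
    then have "Suc s < t" using s_t by simp
    have sS: "(s, Suc s) \<in> veq z" using num_vertices_2D[OF z2 _ _ _ stn Ssn] s_t tz by simp
    obtain j where j: "Suc s \<le> j" "j < t" "(j, Suc j) \<notin> veq z" "\<And>i. Suc s \<le> i \<Longrightarrow> i \<le> j \<Longrightarrow> (Suc s, i) \<in> veq z"
      using first_change[OF Ssn \<open>Suc s < t\<close>] by blast
    have sim: "(s, i) \<in> veq z" if "s \<le> i" "i \<le> j" for i
      using that sS j(4)[of i] eqcl_trans[OF sS] by (cases "i = s") auto
    have jt: "(i, t) \<notin> veq z" if "s \<le> i" "i \<le> j" for i
      using eqcl_trans[OF sim[OF that]] stn by blast
    have "reach (j - s) w (insert_pair z x j t)"
      unfolding w_eq by (rule move_left_end) (use st j jt stn tz dbl in auto)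
    then have r: "reach (length w) w (insert_pair z x j t)"
      by (rule reach_mono) (use j st lz in simp)
    \<comment> \<open>The search started at \<open>Suc s\<close>, so it ends beyond
      \<open>s\<close>: there is a letter of \<open>z\<close> just before the new place of
      \<open>x\<close>, and its side has both endpoints in the class of \<open>s\<close>.\<close>
    obtain j' where j': "j = Suc j'" "s \<le> j'" using j(1) by (cases j) auto
    have eq: "insert_pair z x j t = take j' z @ [z ! j', x, z ! j] @ drop (Suc j) (take t z) @ [x] @ drop t z"
      using insert_pair_Suc_left(1)[OF j(2) tz, of x] j' j(2) tz by (simp add: take_Suc_conv_app_nth)
    have rem': "removeAll x (take j' z) = take j' z" using x_z by (meson in_set_takeD removeAll_id)
    have "(j', j' + 2) \<notin> veq z"
      using j(3) sim[of j'] sim[of j] j' eqcl_trans[OF eqcl_sym[OF sim[of j]] eqcl_trans[OF sim[of j']], of "Suc j"] by auto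
    then show ?thesis
      by (intro finish[OF r refl _ _ _ eq]) (use j j' jt[of j] tz in \<open>simp_all add: rem' min_def\<close>)
  next
    assume it: "i = Suc t"
    then have t_lt: "t < length z" using i(1) lz by simp
    have "num_vertices (insert_pair z x s (Suc t)) = 1"
      using i(2) exchange_insert_pair_right[OF st(1) t_lt, of x] w_eq it by simp
    then have Stn: "(s, Suc t) \<notin> veq z" using Vins[of s "Suc t"] st t_lt z2 by (simp split: if_splits)
    have tS: "(t, Suc t) \<in> veq z"
      using num_vertices_2D[OF z2, of t "Suc t" s] stn Stn eqcl_sym[of t s] eqcl_sym[of "Suc t" s] st t_lt by auto
    obtain j where j: "s \<le> j" "j < t" "(j, Suc j) \<notin> veq z" "\<And>i. j < i \<Longrightarrow> i \<le> t \<Longrightarrow> (i, t) \<in> veq z"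
      using last_change[OF stn s_t] by blast
    have jt: "(s, i) \<notin> veq z" if "j < i" "i \<le> t" for i
      using eqcl_trans[OF _ j(4)[OF that]] stn by blast
    have "reach (t - Suc j) (insert_pair z x s (Suc j)) w"
      unfolding w_eq by (rule move_right_end) (use st j jt stn tz dbl in auto)
    from reach_sym[OF this] have r: "reach (length w) w (insert_pair z x s (Suc j))"
      by (rule reach_mono) (use j st lz in simp)
    have jl: "s \<le> Suc j" "Suc j < length z" using j t_lt by auto
    have "drop s (take (Suc j) z) = drop s (take j z) @ [z ! j]"
      using j jl by (simp add: take_Suc_conv_app_nth)
    then have eq: "insert_pair z x s (Suc j) = (take s z @ [x] @ drop s (take j z)) @ [z ! j, x, z ! Suc j] @ drop (Suc (Suc j)) z"
      using insert_pair_Suc_right(1)[OF jl, of x] by simp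
    have rem': "removeAll x (take s z @ [x] @ drop s (take j z)) = take j z"
    proof -
      have "removeAll x (take s z) = take s z" "removeAll x (drop s (take j z)) = drop s (take j z)"
        using x_z by (meson in_set_takeD in_set_dropD removeAll_id)+
      moreover have "take s z @ drop s (take j z) = take j z"
        using append_take_drop_id[of s "take j z"] j(1) by (simp add: min_def)
      ultimately show ?thesis by simp
    qed
    \<comment> \<open>If the end of \<open>x\<close> has not moved, this is what the legal exchange
      provides; otherwise the side was crossed while staying in the class of
      \<open>t\<close>.\<close>
    have "(Suc j, Suc (Suc j)) \<in> veq z"
    proof (cases "Suc j = t")
      case False
      then show ?thesis using j(2) j(4)[of "Suc j"] j(4)[of "Suc (Suc j)"] eqcl_trans[OF _ eqcl_sym] by (meson Suc_lessI lessI less_SucI Suc_leI order_less_imp_le)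
    qed (use tS in simp)
    then have "(j, j + 2) \<notin> veq z" using j(3) eqcl_trans[of j "Suc (Suc j)" "gen z" "Suc j"] eqcl_sym[of "Suc j" "Suc (Suc j)"] by auto
    then show ?thesis
      by (intro finish[OF r refl _ _ _ eq]) (use jl jt[of "Suc j"] j in \<open>unfold rem', simp_all add: min_def\<close>)
  qed
qed

lemma double_word_append:
  assumes "double_word u" "double_word v" "set u \<inter> set v = {}"
  shows "double_word (u @ v)"
proof -
  have "count_list u a = 0" if "a \<in> set v" for a using assms(3) that by (auto simp: count_list_0_iff)
  moreover have "count_list v a = 0" if "a \<in> set u" for a using assms(3) that by (auto simp: count_list_0_iff)
  ultimately show ?thesis using assms(1,2) by (auto simp: double_word_def)
qed

lemma double_word_handle:
  assumes "double_word (u @ [h, k, h, k])"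
  shows "h \<notin> set u" "k \<notin> set u" "double_word u"
proof -
  show "h \<notin> set u" using double_word_notin(1)[of u h "[k]" "[k]"] assms by simp
  show "k \<notin> set u" using double_word_notin(1)[of "u @ [h]" k "[h]" "[]"] assms by simp
  have "double_word (u @ [k] @ [] @ [k] @ [])" using double_word_removal(2)[of u h "[k]" "[k]"] assms by simp
  from double_word_removal(2)[OF this] show "double_word u" by simp
qed

lemma double_word_short:
  assumes "double_word (u @ [a, a] @ v)"
  shows "a \<notin> set u" "a \<notin> set v" "double_word (u @ v)"
  using double_word_removal[of u a "[]" v] assms by auto

lemma reach_append_handle:
  assumes "reach n u v" "double_word (u @ [h, k, h, k])" "h \<noteq> k"
  shows "reach n (u @ [h, k, h, k]) (v @ [h, k, h, k])"
proof (rule reach_append[OF assms(1) double_word_handle(3)[OF assms(2)], of _ 0])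
  fix u' assume u': "double_word u'" "set u' = set u"
  have "double_word [h, k, h, k]" using assms(3) by (simp add: double_word_def)
  then have "double_word (u' @ [h, k, h, k])"
    using double_word_append[OF u'(1)] u'(2) double_word_handle(1,2)[OF assms(2)] by simp
  then show "num_vertices (u' @ [h, k, h, k]) = num_vertices u' + 0"
    using num_vertices_handle[of u' h k "[]"] assms(3) by simp
qed

text \<open>
  The handle is used as a catalyst: one of its chords becomes a collar \<open>k'\<close> of the other, \<open>e\<close>, whose
  free end is moved across \<open>c\<close>; one exchange then passes the collar from \<open>e\<close> to the neighbour \<open>x\<close> of
  \<open>c\<close>, leaving \<open>e\<close> behind as a collar of \<open>c\<close>.
\<close>

lemma extract_next_handle:
  assumes w: "double_word (u @ [h, k, h, k])" and hk: "h \<noteq> k"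
    and V: "num_vertices u = 1" and ne: "u \<noteq> []"
  obtains u' y y' x x' where "y \<noteq> y'" "x \<noteq> x'"
    "reach (6 * length u) (u @ [h, k, h, k]) (u' @ [y, y', y, y'] @ [x, x', x, x'])"
proof -
  have u: "double_word u" by (rule double_word_handle(3)[OF w])
  define x where "x = u ! 0"
  define z where "z = removeAll x u"
  have u0: "0 < length u" using ne by simp
  from obtain_insert_pair[OF u u0, folded x_def, folded z_def]
  obtain s t where st: "s \<le> t" "t \<le> length u - 2" "u = insert_pair z x s t" "0 = s \<or> 0 = Suc t" .
  then have u_eq: "u = insert_pair z x 0 t" by simp
  have lz: "length u = length z + 2" using arg_cong[OF u_eq, of length] by simp
  have tz: "t \<le> length z" using st(2) lz by simp
  have dbl: "double_word (insert_pair z x a b)" if "a \<le> b" for a b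
    using double_word_insert_pair[OF le0 that, where t = t and z = z and x = x] u unfolding u_eq[symmetric] by (rule iffD1)
  have z0: "num_vertices z > 0" by (rule num_vertices_pos)
  note Vu = num_vertices_insert_pair[OF dbl[of 0 t] _ tz, folded u_eq, unfolded V]
  have n0t: "(0, t) \<notin> veq z"
  proof
    assume "(0, t) \<in> veq z"
    then have "Suc (num_vertices z) = 1" using Vu by simp
    then show False using z0 by simp
  qed
  then have z2: "num_vertices z = 2" using Vu by simp
  have "t \<noteq> 0" using n0t eqcl_refl[of 0 "gen z"] by metis
  then have "0 < t" by simp
  \<comment> \<open>The left end of \<open>x\<close> moves up to the first side of \<open>z\<close>
    that is no loop. Its letter is \<open>c\<close>, and deleting \<open>c\<close> from
    \<open>z\<close> as well leaves one vertex.\<close>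
  obtain j where j: "j < t" "(j, Suc j) \<notin> veq z" "\<And>i. i \<le> j \<Longrightarrow> (0, i) \<in> veq z"
    using first_change[OF n0t \<open>0 < t\<close>, of thesis] by simp
  have jt: "(i, t) \<notin> veq z" if "i \<le> j" for i using eqcl_trans[OF j(3)[OF that]] n0t by blast
  define A where "A = take j z"
  define c where "c = z ! j"
  define B where "B = drop (Suc j) (take t z) @ [x] @ drop t z"
  have U: "insert_pair z x j t = A @ [x, c] @ B"
    using insert_pair_Suc_left(1)[OF j(1) tz, of x] by (simp add: A_def B_def c_def)
  have "reach (j - 0) (insert_pair z x 0 t) (insert_pair z x j t)"
    by (rule move_left_end) (use j jt n0t tz dbl in auto)
  then have r1: "reach j u (A @ [x, c] @ B)" using U u_eq by simp
  have r2: "reach j (u @ [h, k, h, k]) ((A @ [x]) @ (c # B) @ [h, k, h, k] @ [])"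
    using reach_append_handle[OF r1 w hk] by simp
  have dU: "double_word (A @ [x, c] @ B)" using dbl[of j t] j(1) U by simp
  have remx: "removeAll x (A @ [x, c] @ B) = z"
    using removeAll_insert_pair[OF dbl, of j t] j(1) U by simp
  have "c \<in> set z" unfolding c_def by (rule nth_mem) (use j(1) tz in simp)
  then have xc: "x \<noteq> c" by (auto simp: z_def)
  have remx': "removeAll x A @ [c] @ removeAll x B = z" using remx xc by simp
  have Vc: "num_vertices (removeAll c z) = 1"
    using num_vertices_removeAll[OF double_word_removeAll[OF u, of x, folded z_def], of j] j(1,2) tz z2
    by (simp add: c_def)
  have d2: "double_word ((A @ [x]) @ (c # B) @ [h, k, h, k] @ [])"
    using reach_invariants(5)[OF r2] w by simp
  obtain k' e where ke: "k' \<noteq> e" "{k', e} = {h, k}"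
    and r3: "reach (length (c # B)) ((A @ [x]) @ (c # B) @ [h, k, h, k] @ []) ((A @ [x]) @ [k', e, k', e] @ (c # B) @ [])"
    using move_handle_left[OF d2 hk] by blast
  have d3: "double_word (A @ [x] @ [k', e, k', e] @ c # B)" using reach_invariants(5)[OF r3] d2 by simp
  have eA: "e \<notin> set A" "e \<notin> set B" "e \<noteq> c" "e \<noteq> x" 
    using double_word_notin[of "A @ [x, k']" e "[k']" "c # B"] d3 by auto
  have kA: "k' \<notin> set A" "k' \<notin> set B" "k' \<noteq> c" "k' \<noteq> x"
    using double_word_notin[of "A @ [x]" k' "[e]" "e # c # B"] d3 by auto
  \<comment> \<open>Locally the words read \<open>x k' e k' e c\<close>, then
    \<open>x k' e k' c e\<close>, then \<open>e k' x k' c e\<close>. In the last one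
    \<open>k'\<close> is a collar of \<open>x\<close>, and once both are deleted \<open>e\<close> is
    a collar of \<open>c\<close>. The word \<open>?w4'\<close> is \<open>?w4\<close> bracketed for
    the second exchange.\<close>
  let ?w3 = "(A @ [x, k', e, k']) @ [e] @ [] @ [c] @ B"
  let ?w4 = "(A @ [x, k', e, k']) @ [c] @ [] @ [e] @ B"
  let ?w4' = "A @ [x] @ [k'] @ [e] @ [k', c, e] @ B"
  let ?w5 = "A @ [e] @ [k'] @ [x] @ [k', c, e] @ B"
  have "mset ?w4 = mset (A @ [x] @ [k', e, k', e] @ c # B)" "mset ?w5 = mset (A @ [x] @ [k', e, k', e] @ c # B)"
    by simp_all
  then have d4: "double_word ?w4" and d5: "double_word ?w5" using d3 double_word_mset by blast+
  have V3: "num_vertices ?w3 = 1"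
    using reach_invariants(3)[OF r3] reach_invariants(3)[OF r2] num_vertices_handle[of u h k "[]"] w hk V by simp
  have "num_vertices ?w4 = num_vertices (removeAll e ((A @ [x]) @ [c, e] @ B))"
    using num_vertices_collar[of "A @ [x]" k' e "[c, e] @ B"] d4 ke(1) by simp
  also have "removeAll e ((A @ [x]) @ [c, e] @ B) = A @ [x, c] @ B" using eA by simp
  also have "num_vertices \<dots> = 1" using reach_invariants(3)[OF r1] V by simp
  finally have V4: "num_vertices ?w4 = 1" .
  have s4: "step ?w3 ?w4" by (rule step_swap) (simp only: V3 V4)
  have d5': "double_word ((A @ [e]) @ [k', x, k'] @ ([c, e] @ B))" using d5 by simp
  have "double_word (removeAll x ((A @ [e]) @ [k', x, k'] @ ([c, e] @ B)))" by (rule double_word_removeAll[OF d5'])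
  then have "double_word (removeAll x A @ [e] @ [k'] @ [] @ [k'] @ [c, e] @ removeAll x B)"
    using eA(4) kA(4) xc by simp
  then have "double_word ((removeAll x A @ [e]) @ [c, e] @ removeAll x B)"
    using double_word_removal(2)[of "removeAll x A @ [e]" k' "[]" "[c, e] @ removeAll x B"] by simp
  then have d6: "double_word (removeAll x A @ [e, c, e] @ removeAll x B)" by simp
  have rc: "removeAll c (removeAll x A @ removeAll x B) = removeAll c z" unfolding remx'[symmetric] by simp
  have "num_vertices ?w5 = num_vertices (removeAll x ((A @ [e]) @ [c, e] @ B))"
    using num_vertices_collar[OF d5'] kA(4) by simp
  also have "removeAll x ((A @ [e]) @ [c, e] @ B) = removeAll x A @ [e, c, e] @ removeAll x B"
    using eA(4) xc by simp
  also have "num_vertices \<dots> = 1"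
    using num_vertices_collar[OF d6] eA(3) rc Vc by simp
  finally have V5: "num_vertices ?w5 = 1" .
  have "num_vertices ?w4' = 1" using V4 by simp
  then have s5: "step ?w4' ?w5" by (intro step_swap) (simp only: V5)
  obtain y y' where yy: "y \<noteq> y'"
    "reach (length (A @ [e]) + 2 * length ([c, e] @ B)) ((A @ [e]) @ [k', x, k'] @ ([c, e] @ B))
       (removeAll x ((A @ [e]) @ ([c, e] @ B)) @ [y, y', y, y'])"
    using collar_to_handle[OF d5'] kA(4) by metis
  define v where "v = removeAll x A @ [e, c, e] @ removeAll x B"
  have eqv: "removeAll x ((A @ [e]) @ ([c, e] @ B)) = v" using eA(4) xc by (simp add: v_def)
  have eq5: "?w5 = (A @ [e]) @ [k', x, k'] @ ([c, e] @ B)" by simp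
  have r6: "reach (length A + 5 + 2 * length B) ?w5 (v @ [y, y', y, y'])"
    unfolding eq5 by (rule reach_mono[OF yy(2)[unfolded eqv]]) simp
  have d7: "double_word (v @ [y, y', y, y'])" using reach_invariants(5)[OF r6] d5 by simp
  obtain q q' where qq: "q \<noteq> q'"
    "reach (length (removeAll x A) + 2 * length (removeAll x B)) v (removeAll c (removeAll x A @ removeAll x B) @ [q, q', q, q'])"
    using collar_to_handle[OF d6] eA(3) unfolding v_def by metis
  have r7: "reach (length A + 2 * length B) v (removeAll c z @ [q, q', q, q'])"
    using qq(2) unfolding rc by (rule reach_mono) (simp add: add_mono length_removeAll_less_eq)
  note r8 = reach_append_handle[OF r7 d7 yy(1)]
  have "reach (j + (length (c # B)) + 1 + 1 + (length A + 5 + 2 * length B) + (length A + 2 * length B))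
    (u @ [h, k, h, k]) ((removeAll c z @ [q, q', q, q']) @ [y, y', y, y'])"
  proof -
    have "reach (length (c # B)) ((A @ [x]) @ (c # B) @ [h, k, h, k] @ []) ?w3" using r3 by simp
    note a = reach_trans[OF reach_trans[OF r2 this] reach_step[OF s4]]
    have "reach 1 ?w4 ?w5" using reach_step[OF s5] by simp
    from reach_trans[OF reach_trans[OF reach_trans[OF a this] r6] r8] show ?thesis .
  qed
  then have "reach (6 * length u) (u @ [h, k, h, k]) ((removeAll c z @ [q, q', q, q']) @ [y, y', y, y'])"
  proof (rule reach_mono)
    have "length A = j" using j(1) tz by (simp add: A_def)
    moreover have "length u = length A + 2 + length B" using reach_invariants(2)[OF r1] by simp
    ultimately show "j + (length (c # B)) + 1 + 1 + (length A + 5 + 2 * length B) + (length A + 2 * length B)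
      \<le> 6 * length u" by simp
  qed
  with that[OF qq(1) yy(1)] show ?thesis by simp
qed

section \<open>The normal form\<close>

text \<open>The flag records an initial short chord, the core of genus zero with two classes.
  Handles can be appended only while \<open>m = 0\<close>, so they precede all further short chords;
  this fixes the shape once the parameters are known.\<close>

inductive standard :: "bool \<Rightarrow> nat \<Rightarrow> nat \<Rightarrow> 'a list \<Rightarrow> bool" where
  nil: "standard False 0 0 []"
| one: "standard True 0 0 [a, a]"
| handle: "standard b g 0 w \<Longrightarrow> h \<noteq> k \<Longrightarrow> h \<notin> set w \<Longrightarrow> k \<notin> set w \<Longrightarrow> standard b (Suc g) 0 (w @ [h, k, h, k])"
| short: "standard b g m w \<Longrightarrow> a \<notin> set w \<Longrightarrow> standard b g (Suc m) (w @ [a, a])"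

lemma length_standard: "standard b g m w \<Longrightarrow> length w = (if b then 2 else 0) + 4 * g + 2 * m"
  by (induction rule: standard.induct) auto

definition same_shape :: "'a list \<Rightarrow> 'b list \<Rightarrow> bool" where
  "same_shape w w' \<longleftrightarrow> length w = length w' \<and>
     (\<forall>i < length w. \<forall>j < length w. w ! i = w ! j \<longleftrightarrow> w' ! i = w' ! j)"

lemma same_shape_append:
  assumes "same_shape u u'" "same_shape v v'" "set u \<inter> set v = {}" "set u' \<inter> set v' = {}"
  shows "same_shape (u @ v) (u' @ v')"
proof -
  have ne: "u ! i \<noteq> v ! j" "u' ! i \<noteq> v' ! j" if "i < length u" "j < length v" for i j
  proof -
    have len: "length u' = length u" "length v' = length v" using assms(1,2) by (simp_all add: same_shape_def)
    have "u ! i \<in> set u" "v ! j \<in> set v" "u' ! i \<in> set u'" "v' ! j \<in> set v'"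
      using that len by (simp_all del: in_set_conv_nth)
    then show "u ! i \<noteq> v ! j" "u' ! i \<noteq> v' ! j" using assms(3,4) by (metis disjoint_iff)+
  qed
  show ?thesis
    using assms(1,2) ne ne[symmetric] unfolding same_shape_def by (auto simp: nth_append)
qed

lemma standard_unique:
  "standard b g m w \<Longrightarrow> standard b g m w' \<Longrightarrow> same_shape w w'"
proof (induction arbitrary: w' rule: standard.induct)
  case nil
  then show ?case by cases (simp_all add: same_shape_def)
next
  case (one a)
  then show ?case by cases (auto simp: same_shape_def nth_Cons split: nat.split)
next
  case (handle b g w h k)
  from handle.prems obtain v x y where v: "w' = v @ [x, y, x, y]" "standard b g 0 v" "x \<noteq> y" "x \<notin> set v" "y \<notin> set v"
    by cases auto
  have "same_shape [h, k, h, k] [x, y, x, y]"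
    using handle.hyps v(3) by (auto simp: same_shape_def nth_Cons split: nat.split)
  then show ?case unfolding v(1) using handle v by (intro same_shape_append) auto
next
  case (short b g m w a)
  from short.prems obtain v x where v: "w' = v @ [x, x]" "standard b g m v" "x \<notin> set v"
    by cases auto
  have "same_shape [a, a] [x, x]" by (auto simp: same_shape_def nth_Cons split: nat.split)
  then show ?case unfolding v(1) using short v by (intro same_shape_append) auto
qed

text \<open>Each of the \<open>g\<close> handles costs four times the current length, which is at
  most \<open>4 * g + 2\<close>. Later handles are split off from the prefix, where those already
  placed do not interfere.\<close>

lemma standardize_two_vertices:
  "double_word w \<Longrightarrow> num_vertices w = 2 \<Longrightarrow> length w = 4 * g + 2 \<Longrightarrow>
    \<exists>w'. standard True g 0 w' \<and> reach (4 * (4 * g + 2) * g) w w'"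
proof (induction g arbitrary: w)
  case 0
  then obtain a b where ab: "w = [a, b]"
    by (metis One_nat_def Suc_1 add_0 length_0_conv length_Suc_conv mult_0_right)
  have "a = b" using 0(1) by (auto simp: ab double_word_def split: if_splits)
  then show ?case using standard.one[of a] by (intro exI[of _ w]) (simp add: ab)
next
  case (Suc g)
  have "length w \<ge> 4" using Suc.prems(3) by simp
  from extract_handle_two_vertices[OF Suc.prems(1,2) this]
  obtain u x y where xy: "x \<noteq> y" and r: "reach (4 * length w) w (u @ [x, y, x, y])" .
  have d: "double_word (u @ [x, y, x, y])" using reach_invariants(5)[OF r] Suc.prems(1) by simp
  have "num_vertices u = 2"
    using num_vertices_handle[of u x y "[]"] d xy reach_invariants(3)[OF r] Suc.prems(2) by simp
  moreover have "length u = 4 * g + 2" using reach_invariants(2)[OF r] Suc.prems(3) by simp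
  ultimately obtain v where v: "standard True g 0 v" "reach (4 * (4 * g + 2) * g) u v"
    using Suc.IH double_word_handle(3)[OF d] by blast
  have "set v = set u" by (rule reach_invariants(4)[OF v(2)])
  then have "standard True (Suc g) 0 (v @ [x, y, x, y])"
    using v(1) xy double_word_handle(1,2)[OF d] by (intro standard.handle) auto
  moreover from reach_trans[OF r reach_append_handle[OF v(2) d xy]]
  have "reach (4 * (4 * Suc g + 2) * Suc g) w (v @ [x, y, x, y])"
    by (rule reach_mono) (simp add: Suc.prems(3) algebra_simps)
  ultimately show ?case by blast
qed

text \<open>Of the two handles produced in a round, one is final and the other is the catalyst of
  the next round. The prefix loses four letters each time, so the linear costs add up to a quadratic
  one. The genus is left existential because the length determines it afterwards.\<close>

lemma standardize_one_vertex:
  "double_word (u @ [h, k, h, k]) \<Longrightarrow> h \<noteq> k \<Longrightarrow> num_vertices u = 1 \<Longrightarrow>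
    \<exists>w' g. standard False g 0 w' \<and> reach (6 * length u ^ 2) (u @ [h, k, h, k]) w'"
proof (induction "length u" arbitrary: u h k rule: less_induct)
  case less
  show ?case
  proof (cases "u = []")
    case True
    have "standard False (Suc 0) 0 ([] @ [h, k, h, k])"
      by (rule standard.handle[OF standard.nil]) (use less.prems in auto)
    then show ?thesis using True by (metis reach_refl)
  next
    case False
    obtain v y y' x x' where yx: "y \<noteq> y'" "x \<noteq> x'" and
      r: "reach (6 * length u) (u @ [h, k, h, k]) (v @ [y, y', y, y'] @ [x, x', x, x'])"
      using extract_next_handle[OF less.prems(1,2,3) False] .
    let ?v = "v @ [y, y', y, y']"
    have r: "reach (6 * length u) (u @ [h, k, h, k]) (?v @ [x, x', x, x'])" using r by simp
    have d: "double_word (?v @ [x, x', x, x'])" using reach_invariants(5)[OF r] less.prems(1) by blast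
    have dv: "double_word ?v" by (rule double_word_handle(3)[OF d])
    have "num_vertices (u @ [h, k, h, k]) = 1"
      using num_vertices_handle[of u h k "[]"] less.prems by simp
    then have "num_vertices (?v @ [x, x', x, x']) = 1" using reach_invariants(3)[OF r] by simp
    then have "num_vertices ?v = 1" using num_vertices_handle[of ?v x x' "[]"] d yx by simp
    then have V: "num_vertices v = 1" using num_vertices_handle[of v y y' "[]"] dv yx by simp
    have len: "length u = length v + 4" using reach_invariants(2)[OF r] by simp
    obtain w1 g where w1: "standard False g 0 w1" "reach (6 * length v ^ 2) ?v w1"
      using less.hyps[of v y y'] len dv yx V by auto
    have "set w1 = set ?v" by (rule reach_invariants(4)[OF w1(2)])
    then have "standard False (Suc g) 0 (w1 @ [x, x', x, x'])"
      using w1(1) yx double_word_handle(1,2)[OF d] by (intro standard.handle) auto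
    moreover from reach_trans[OF r reach_append_handle[OF w1(2) d yx(2)]]
    have "reach (6 * length u ^ 2) (u @ [h, k, h, k]) (w1 @ [x, x', x, x'])"
      by (rule reach_mono) (simp add: len power2_eq_square algebra_simps)
    ultimately show ?thesis by blast
  qed
qed

lemma standardize_unicellular:
  assumes w: "double_word w" and V: "num_vertices w = 1"
    and i: "Suc i < length w" "num_vertices (exchange w i (Suc i)) = 1"
  obtains w' g where "standard False g 0 w'" "reach (1 + 3 * length w + 6 * length w ^ 2) w w'"
proof -
  obtain u x y where xy: "x \<noteq> y" and r: "reach (1 + 3 * length w) w (u @ [x, y, x, y])"
    using extract_first_handle[OF assms] .
  have d: "double_word (u @ [x, y, x, y])" using reach_invariants(5)[OF r] w by simp
  have "num_vertices u = 1"
    using num_vertices_handle[of u x y "[]"] d xy reach_invariants(3)[OF r] V by simp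
  from standardize_one_vertex[OF d xy this] obtain w' g where
    w': "standard False g 0 w'" "reach (6 * length u ^ 2) (u @ [x, y, x, y]) w'" by blast
  have "length u \<le> length w" using reach_invariants(2)[OF r] by simp
  then have "length u ^ 2 \<le> length w ^ 2" by (rule power_mono) simp
  then have "1 + 3 * length w + 6 * length u ^ 2 \<le> 1 + 3 * length w + 6 * length w ^ 2" by simp
  from that[OF w'(1) reach_mono[OF reach_trans[OF r w'(2)] this]] show ?thesis .
qed

section \<open>Planar blocks: noncrossing matchings inserted into a core\<close>

inductive red :: "'a list \<Rightarrow> 'a list \<Rightarrow> bool" for c where
  red_refl: "red c c"
| red_insert: "red c (u @ v) \<Longrightarrow> a \<notin> set (u @ v) \<Longrightarrow> red c (u @ [a, a] @ v)"

text \<open>An inserted short chord adds one vertex wherever it lies. So planar insertions enter the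
  count only through their total length, which makes rearranged blocks easy to compare.\<close>

lemma red_num_vertices:
  "red c w \<Longrightarrow> double_word (p @ w @ s) \<Longrightarrow>
    double_word (p @ c @ s) \<and> (\<exists>m. length w = length c + 2 * m \<and> num_vertices (p @ w @ s) = num_vertices (p @ c @ s) + m)"
proof (induction rule: red.induct)
  case red_refl
  then show ?case by (auto intro: exI[of _ 0])
next
  case (red_insert u v a)
  have d: "double_word ((p @ u) @ [a, a] @ (v @ s))" using red_insert.prems by simp
  from num_vertices_short[OF d] double_word_short(3)[OF d] red_insert.IH
  obtain m where "double_word (p @ c @ s)" "length (u @ v) = length c + 2 * m"
    "num_vertices (p @ (u @ v) @ s) = num_vertices (p @ c @ s) + m"
    "num_vertices (p @ (u @ [a, a] @ v) @ s) = Suc (num_vertices (p @ (u @ v) @ s))" by auto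
  then show ?case by (intro conjI exI[of _ "Suc m"]) simp_all
qed

lemma red_append:
  "red [] G \<Longrightarrow> red c w \<Longrightarrow> set G \<inter> set w = {} \<Longrightarrow> red c (G @ w)"
proof (induction rule: red.induct)
  case (red_insert u v a)
  then have "red c (u @ (v @ w))" "a \<notin> set (u @ (v @ w))" by auto
  from red.red_insert[OF this] show ?case by simp
qed simp

lemma red_wrap: "red [] G \<Longrightarrow> e \<notin> set G \<Longrightarrow> red [] ([e] @ G @ [e])"
proof (induction rule: red.induct)
  case red_refl
  show ?case using red.red_insert[of "[]" "[]" "[]" e] by (simp add: red.red_refl)
next
  case (red_insert u v a)
  then have "red [] (([e] @ u) @ (v @ [e]))" "a \<notin> set (([e] @ u) @ (v @ [e]))" by auto
  from red.red_insert[OF this] show ?case by simp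
qed

text \<open>A noncrossing matching is split at the chord of its first side, as in the Catalan
  recursion.\<close>

lemma red_decomp:
  "red [] G \<Longrightarrow> G \<noteq> [] \<Longrightarrow> \<exists>e G1 G2. G = e # G1 @ e # G2 \<and> red [] G1 \<and> red [] G2"
proof (induction rule: red.induct)
  case (red_insert u v a)
  show ?case
  proof (cases u)
    case Nil
    then show ?thesis using red_insert.hyps(1) red.red_refl[of "[]"]
      by (intro exI[of _ a] exI[of _ "[]"] exI[of _ v]) simp
  next
    case (Cons e u')
    then obtain G1 G2 where G: "u' @ v = G1 @ e # G2" "red [] G1" "red [] G2"
      using red_insert.IH by auto
    from G(1) consider g where "G1 = u' @ g" "v = g @ e # G2" | us where "u' = G1 @ e # us" "G2 = us @ v"
      by (auto simp: append_eq_append_conv2 Cons_eq_append_conv append_eq_Cons_conv)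
    then show ?thesis
    proof cases
      case (1 g)
      have "red [] (u' @ [a, a] @ g)" using G(2) red_insert.hyps(2) 1 Cons by (intro red.red_insert) auto
      then show ?thesis using Cons 1 G(3) by (intro exI[of _ e] exI[of _ "u' @ [a, a] @ g"] exI[of _ G2]) simp
    next
      case (2 us)
      have "red [] (us @ [a, a] @ v)" using G(3) red_insert.hyps(2) 2 Cons by (intro red.red_insert) auto
      then show ?thesis using Cons 2 G(2) by (intro exI[of _ e] exI[of _ G1] exI[of _ "us @ [a, a] @ v"]) simp
    qed
  qed
qed simp

lemma red_Cons:
  "red (x # c) w \<Longrightarrow> \<exists>G w'. w = G @ x # w' \<and> red [] G \<and> red c w'"
proof (induction rule: red.induct)
  case red_refl
  show ?case by (intro exI[of _ "[]"] exI[of _ c]) (simp add: red.red_refl)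
next
  case (red_insert u v a)
  then obtain G w' where G: "u @ v = G @ x # w'" "red [] G" "red c w'" by blast
  from G(1) consider g where "G = u @ g" "v = g @ x # w'" | us where "u = G @ x # us" "w' = us @ v"
    by (auto simp: append_eq_append_conv2 Cons_eq_append_conv append_eq_Cons_conv)
  then show ?case
  proof cases
    case (1 g)
    have "red [] (u @ [a, a] @ g)" using G(2) red_insert.hyps(2) 1 by (intro red.red_insert) auto
    then show ?thesis using 1 G(3) by (intro exI[of _ "u @ [a, a] @ g"] exI[of _ w']) simp
  next
    case (2 us)
    have "red c (us @ [a, a] @ v)" using G(3) red_insert.hyps(2) 2 by (intro red.red_insert) auto
    then show ?thesis using 2 G(2) by (intro exI[of _ G] exI[of _ "us @ [a, a] @ v"]) simp
  qed
qed

lemma red_double_word: "red [] G \<Longrightarrow> double_word G"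
proof (induction rule: red.induct)
  case (red_insert u v a)
  have "double_word ((u @ v) @ [a, a])"
    using double_word_append[OF red_insert.IH, of "[a, a]"] red_insert.hyps(2)
    by (simp add: double_word_def[of "[a, a]"])
  moreover have "mset (u @ [a, a] @ v) = mset ((u @ v) @ [a, a])" by simp
  ultimately show ?case using double_word_mset by blast
qed (simp add: double_word_def)

lemma red_disjoint:
  assumes "red [] G" "double_word (p @ G @ q)"
  shows "set G \<inter> (set p \<union> set q) = {}"
proof -
  have "y \<notin> set p \<and> y \<notin> set q" if y: "y \<in> set G" for y
  proof -
    have "count_list G y = 2" using red_double_word[OF assms(1)] y by (simp add: double_word_def)
    moreover have "count_list (p @ G @ q) y = 2" using assms(2) y by (simp add: double_word_def)
    ultimately show ?thesis by (simp add: count_list_0_iff)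
  qed
  then show ?thesis by blast
qed

text \<open>
  A letter \<open>x\<close> passes a planar block \<open>e G1 e G2\<close> in a single exchange, becoming
  \<open>x G1 e G2 e\<close>; so gathering the core costs one exchange per letter of the core.
\<close>

lemma gather_core:
  "red c w \<Longrightarrow> double_word (p @ w) \<Longrightarrow> \<exists>G. red [] G \<and> reach (length c) (p @ w) (p @ c @ G)"
proof (induction c arbitrary: p w)
  case Nil
  then show ?case by auto
next
  case (Cons x c)
  obtain G w' where G: "w = G @ x # w'" "red [] G" "red c w'" using red_Cons[OF Cons.prems(1)] by blast
  show ?case
  proof (cases "G = []")
    case True
    then have "double_word ((p @ [x]) @ w')" using Cons.prems(2) G(1) by simp
    from Cons.IH[OF G(3) this] obtain H where "red [] H" "reach (length c) ((p @ [x]) @ w') ((p @ [x]) @ c @ H)" by blast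
    then show ?thesis using True G(1) reach_mono[of "length c" "p @ w" "p @ (x # c) @ H" "length (x # c)"]
      by (intro exI[of _ H]) simp
  next
    case False
    then obtain e G1 G2 where e: "G = e # G1 @ e # G2" "red [] G1" "red [] G2" using red_decomp[OF G(2)] by blast
    let ?w = "p @ [e] @ (G1 @ e # G2) @ [x] @ w'"
    let ?G' = "G1 @ [e] @ G2 @ [e]"
    let ?w' = "p @ [x] @ (G1 @ e # G2) @ [e] @ w'"
    have w: "p @ w = ?w" using G(1) e(1) by simp
    have d: "double_word ?w" using Cons.prems(2) w by simp
    have "mset ?w' = mset ?w" by simp
    then have d': "double_word ?w'" using d double_word_mset by blast
    have eG: "e \<notin> set p" "e \<notin> set G1" "e \<notin> set (G2 @ x # w')"
      using double_word_notin[of p e G1 "G2 @ x # w'"] d by simp_all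
    have dsj: "set G1 \<inter> set ([e] @ G2 @ [e]) = {}"  "set ?G' \<inter> set w' = {}"
    proof -
      show "set G1 \<inter> set ([e] @ G2 @ [e]) = {}"
        using red_disjoint[OF e(2), of "p @ [e]" "[e] @ G2 @ [x] @ w'"] d eG by auto
      show "set ?G' \<inter> set w' = {}"
        using red_disjoint[OF G(2), of p "x # w'"] d e(1) by auto
    qed
    have "red [] ([e] @ G2 @ [e])" using e(3) eG by (intro red_wrap) auto
    then have rG': "red [] ?G'" using red_append[OF e(2)] dsj(1) by blast
    then have rw: "red c (?G' @ w')" using red_append[OF _ G(3)] dsj(2) by blast
    \<comment> \<open>Both words arise from \<open>p @ x # w'\<close> by inserting planar blocks of
      equal length.\<close>
    have "num_vertices ?w' = num_vertices ?w"
    proof -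
      from red_num_vertices[OF G(2), of p "x # w'"] d e(1) obtain m where
        m: "length G = 2 * m" "num_vertices ?w = num_vertices (p @ x # w') + m" by auto
      from red_num_vertices[OF rG', of "p @ [x]" w'] d' obtain m' where
        m': "length ?G' = 2 * m'" "num_vertices ?w' = num_vertices (p @ x # w') + m'" by auto
      have "length ?G' = length G" using e(1) by simp
      then show ?thesis using m m' by simp
    qed
    then have s: "step ?w ?w'" by (rule step_swap)
    have w'_eq: "?w' = (p @ [x]) @ (?G' @ w')" by simp
    then have "double_word ((p @ [x]) @ (?G' @ w'))" using d' by simp
    from Cons.IH[OF rw this] obtain H where H: "red [] H"
      "reach (length c) ((p @ [x]) @ (?G' @ w')) ((p @ [x]) @ c @ H)" by blast
    from reach_Suc[OF s H(2)[folded w'_eq]] have "reach (length (x # c)) (p @ w) (p @ (x # c) @ H)"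
      unfolding w by simp
    with H(1) show ?thesis by blast
  qed
qed

lemma insert_block_update:
  assumes "k \<le> length v"
  shows "take k (v[i := x]) @ z @ drop k (v[i := x]) =
    (take k v @ z @ drop k v)[(if i < k then i else i + length z) := x]"
  using assms by (auto simp: list_update_append list_update_beyond take_update_swap drop_update_swap min_def)

lemma insert_block_nth:
  assumes "k \<le> length v" "i < length v"
  shows "(take k v @ z @ drop k v) ! (if i < k then i else i + length z) = v ! i"
  using assms by (auto simp: nth_append min_def)

text \<open>The short chord stays at gap \<open>k\<close> while letters around it are exchanged. It
  adds one vertex before and after, and it only shifts the positions behind the gap.\<close>

lemma step_insert_short:
  assumes "step v v'" "double_word v" "a \<notin> set v" "k \<le> length v"
  shows "step (take k v @ [a, a] @ drop k v) (take k v' @ [a, a] @ drop k v')"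
proof -
  have V: "num_vertices (take k u @ [a, a] @ drop k u) = Suc (num_vertices u)"
    if "double_word u" "a \<notin> set u" for u
  proof -
    have "double_word (u @ [a, a])" using that by (intro double_word_append) (auto simp: double_word_def)
    moreover have "mset (take k u) + mset (drop k u) = mset u" by (metis append_take_drop_id mset_append)
    then have "mset (take k u @ [a, a] @ drop k u) = mset (u @ [a, a])" by simp
    ultimately have "double_word (take k u @ [a, a] @ drop k u)" using double_word_mset by blast
    from num_vertices_short[OF this] show ?thesis by simp
  qed
  have v': "double_word v'" "a \<notin> set v'" "num_vertices v' = num_vertices v"
    using step_invariants[OF assms(1)] assms(2,3) by simp_all
  from assms(1) consider "v' = v" | i j where "i < length v" "j < length v" "v' = exchange v i j"
    by (auto simp: step_def)
  then show ?thesis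
  proof cases
    case (2 i j)
    let ?s = "\<lambda>i. if i < k then i else i + length [a, a]"
    let ?I = "\<lambda>v. take k v @ [a, a] @ drop k v"
    have "?I v' = (?I v)[?s i := v ! j, ?s j := v ! i]"
      unfolding 2(3) exchange_def using insert_block_update[of k _ _ _ "[a, a]"] assms(4) by simp
    also have "\<dots> = exchange (?I v) (?s i) (?s j)"
      unfolding exchange_def using insert_block_nth[OF assms(4), of _ "[a, a]"] 2(1,2) by simp
    finally have "?I v' = exchange (?I v) (?s i) (?s j)" .
    moreover have "?s i < length (?I v)" "?s j < length (?I v)" using 2(1,2) assms(4) by auto
    moreover have "num_vertices (?I v') = num_vertices (?I v)"
      using V[OF assms(2,3)] V[OF v'(1,2)] v'(3) by simp
    ultimately show ?thesis unfolding step_def by blast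
  qed simp
qed

lemma reach_insert_short:
  assumes "reach n v v'" "double_word v" "a \<notin> set v" "k \<le> length v"
  shows "reach n (take k v @ [a, a] @ drop k v) (take k v' @ [a, a] @ drop k v')"
  using assms(1)
proof (induction n arbitrary: v')
  case (Suc n)
  then obtain u where u: "reach n v u" "step u v'" by auto
  have "double_word u" "a \<notin> set u" "k \<le> length u"
    using reach_invariants[OF u(1)] assms(2-4) by simp_all
  from step_insert_short[OF u(2) this] Suc.IH[OF u(1)] show ?case by auto
qed simp

text \<open>If each vertex were equivalent to the one two places further on, the classes of
  \<open>0\<close> and \<open>1\<close> would be all there are.\<close>

lemma exists_pinchable:
  assumes "num_vertices w \<ge> 3"
  obtains i where "i + 2 \<le> length w" "(i, i + 2) \<notin> veq w"
proof -
  have "\<exists>i. i + 2 \<le> length w \<and> (i, i + 2) \<notin> veq w"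
  proof (rule ccontr)
    assume "\<not> ?thesis"
    then have all: "(i, i + 2) \<in> veq w" if "i + 2 \<le> length w" for i using that by blast
    have "i \<le> length w \<Longrightarrow> (0, i) \<in> veq w \<or> (1, i) \<in> veq w" for i
    proof (induction i rule: less_induct)
      case (less i)
      consider "i = 0" | "i = 1" | k where "i = k + 2" by (metis One_nat_def add_2_eq_Suc' not0_implies_Suc)
      then show ?case
      proof cases
        case (3 k)
        then have "(k, i) \<in> veq w" using all[of k] less.prems by simp
        moreover have "(0, k) \<in> veq w \<or> (1, k) \<in> veq w" using less.IH[of k] 3 less.prems by simp
        ultimately show ?thesis using eqcl_trans[of _ k "gen w" i] by blast
      qed auto
    qed
    then have "num_vertices w \<le> 2" unfolding num_vertices_def by (intro num_classes_le_2I[of _ 0 _ 1]) auto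
    with assms show False by simp
  qed
  then show ?thesis using that by blast
qed

text \<open>Each pinch costs one swap and sets aside a short chord, which takes two letters and one
  vertex with it; the recursion stops at two vertices. The chord is put back at its old gap after
  the rest has been rearranged.\<close>

lemma planarize:
  "double_word w \<Longrightarrow> num_vertices w \<ge> 2 \<Longrightarrow>
    \<exists>c w'. red c w' \<and> num_vertices c = 2 \<and> double_word c \<and> reach (length w) w w'"
proof (induction "length w" arbitrary: w rule: less_induct)
  case less
  show ?case
  proof (cases "num_vertices w = 2")
    case True
    then show ?thesis using less.prems by (intro exI[of _ w]) (simp add: red.red_refl)
  next
    case False
    then have "num_vertices w \<ge> 3" using less.prems(2) by simp
    then obtain i where i: "i + 2 \<le> length w" "(i, i + 2) \<notin> veq w" using exists_pinchable by blast
    define P b c Q where "P = take i w" and "b = w ! i" and "c = w ! Suc i" and "Q = drop (i + 2) w"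
    have w: "w = P @ [b, c] @ Q"
      using i(1) id_take_nth_drop[of i w] Cons_nth_drop_Suc[of "Suc i" w] by (simp add: P_def b_def c_def Q_def)
    have "length P = i" using i(1) by (simp add: P_def)
    then have "(length P, length P + 2) \<notin> veq (P @ [b, c] @ Q)" using i(2) w by simp
    from pinch[OF less.prems(1)[unfolded w] this]
    obtain P' Q' a where "step (P @ [b, c] @ Q) (P' @ [a, a] @ Q')" .
    then have s: "step w (P' @ [a, a] @ Q')" using w by simp
    have d: "double_word (P' @ [a, a] @ Q')" using step_invariants(5)[OF s] less.prems(1) by simp
    note d' = double_word_short[OF d]
    have len: "length w = length (P' @ Q') + 2" using step_invariants(2)[OF s] by simp
    have V: "num_vertices (P' @ Q') \<ge> 2"
      using num_vertices_short[OF d] step_invariants(3)[OF s] \<open>num_vertices w \<ge> 3\<close> by simp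
    obtain c v where c: "red c v" "num_vertices c = 2" "double_word c" "reach (length (P' @ Q')) (P' @ Q') v"
      using less.hyps[OF _ d'(3) V] len by auto
    let ?k = "length P'"
    have "reach (length (P' @ Q')) (take ?k (P' @ Q') @ [a, a] @ drop ?k (P' @ Q')) (take ?k v @ [a, a] @ drop ?k v)"
      by (rule reach_insert_short[OF c(4) d'(3)]) (use d'(1,2) in auto)
    then have r: "reach (length (P' @ Q')) (P' @ [a, a] @ Q') (take ?k v @ [a, a] @ drop ?k v)" by simp
    have "set v = set (P' @ Q')" by (rule reach_invariants(4)[OF c(4)])
    then have "red c (take ?k v @ [a, a] @ drop ?k v)"
      using c(1) d'(1,2) by (intro red.red_insert) auto
    moreover have "reach (length w) w (take ?k v @ [a, a] @ drop ?k v)"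
      by (rule reach_mono[OF reach_Suc[OF s r]]) (simp add: len)
    ultimately show ?thesis using c(2,3) by blast
  qed
qed

text \<open>If the chord \<open>e\<close> of the first side is not short, exchanging the letter
  \<open>f\<close> after the first \<open>e\<close> with the second \<open>e\<close> makes it so and
  leaves the rest planar. Thus at most one swap is spent per chord.\<close>

lemma planar_to_standard:
  "red [] G \<Longrightarrow> double_word (p @ G) \<Longrightarrow> standard b g m p \<Longrightarrow>
    \<exists>w' m'. standard b g m' w' \<and> reach (length G) (p @ G) w'"
proof (induction "length G" arbitrary: G p m rule: less_induct)
  case less
  show ?case
  proof (cases "G = []")
    case True
    then show ?thesis using less.prems(3) by (intro exI[of _ p] exI[of _ m]) simp
  next
    case False
    then obtain e G1 G2 where e: "G = e # G1 @ e # G2" "red [] G1" "red [] G2"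
      using red_decomp[OF less.prems(1)] by blast
    have ep: "e \<notin> set p" "e \<notin> set G1" "e \<notin> set G2"
      using double_word_notin[of p e G1 G2] less.prems(2) e(1) by simp_all
    have std: "standard b g (Suc m) (p @ [e, e])" by (rule standard.short[OF less.prems(3) ep(1)])
    show ?thesis
    proof (cases "G1 = []")
      case True
      have "double_word ((p @ [e, e]) @ G2)" using less.prems(2) e(1) True by simp
      from less.hyps[OF _ e(3) this std] e(1) True obtain w' m' where
        "standard b g m' w'" "reach (length G2) ((p @ [e, e]) @ G2) w'" by auto
      then show ?thesis using e(1) True reach_mono[of "length G2" "p @ G" w' "length G"]
        by (intro exI[of _ w'] exI[of _ m']) simp
    next
      case False
      then obtain f G3 G4 where f: "G1 = f # G3 @ f # G4" "red [] G3" "red [] G4" using red_decomp[OF e(2)] by blast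
      let ?w = "(p @ [e]) @ [f] @ (G3 @ f # G4) @ [e] @ G2"
      let ?w' = "(p @ [e]) @ [e] @ (G3 @ f # G4) @ [f] @ G2"
      let ?G' = "G3 @ ([f] @ G4 @ [f]) @ G2"
      have w: "p @ G = ?w" using e(1) f(1) by simp
      have d: "double_word ?w" using less.prems(2) w by simp
      have "mset ?w' = mset ?w" by simp
      then have d': "double_word ?w'" using d double_word_mset by blast
      have fn: "f \<notin> set G3" "f \<notin> set G4" "f \<notin> set G2"
        using double_word_notin[of "p @ [e]" f G3 "G4 @ [e] @ G2"] d by simp_all
      have "set G3 \<inter> set (([f] @ G4 @ [f]) @ G2) = {}" "set ([f] @ G4 @ [f]) \<inter> set G2 = {}"
        using red_disjoint[OF f(2), of "p @ [e, f]" "[f] @ G4 @ [e] @ G2"]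
          red_disjoint[OF f(3), of "p @ [e, f] @ G3 @ [f]" "[e] @ G2"] d fn by auto
      note disj = this
      have "red [] (([f] @ G4 @ [f]) @ G2)"
        by (rule red_append[OF red_wrap[OF f(3) fn(2)] e(3) disj(2)])
      from red_append[OF f(2) this disj(1)] have rG': "red [] ?G'" .
      have "num_vertices ?w' = num_vertices ?w"
      proof -
        have "double_word (p @ G @ [])" using d w by simp
        from red_num_vertices[OF less.prems(1) this] obtain m1 where
          m1: "length G = 2 * m1" "num_vertices ?w = num_vertices p + m1" using w by auto
        have "double_word ((p @ [e, e]) @ ?G' @ [])" using d' by simp
        from red_num_vertices[OF rG' this] obtain m2 where
          m2: "length ?G' = 2 * m2" "num_vertices ?w' = num_vertices (p @ [e, e]) + m2" "double_word (p @ [e, e])" by auto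
        have "num_vertices (p @ [e, e]) = Suc (num_vertices p)"
          using num_vertices_short[of p e "[]"] m2(3) by simp
        moreover have "length G = length ?G' + 2" using e(1) f(1) by simp
        ultimately show ?thesis using m1 m2 by simp
      qed
      then have s: "step ?w ?w'" by (rule step_swap)
      have w'_eq: "?w' = (p @ [e, e]) @ ?G'" by simp
      have "double_word ((p @ [e, e]) @ ?G')" using d' by simp
      from less.hyps[OF _ rG' this std] e(1) f(1) obtain w' m' where
        w': "standard b g m' w'" "reach (length ?G') ((p @ [e, e]) @ ?G') w'" by auto
      have "reach (length G) (p @ G) w'"
        unfolding w by (rule reach_mono[OF reach_Suc[OF s w'(2)[folded w'_eq]]]) (simp add: e(1) f(1))
      with w'(1) show ?thesis by blast
    qed
  qed
qed

text \<open>The equation for \<open>g\<close> is Euler's formula. The planar part takes up as many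
  chords as there are vertices beyond two, so the core is left with \<open>4 * g + 2\<close>
  letters, and the quadratic cost is confined to it.\<close>

lemma standardize_multicellular:
  assumes w: "double_word w" and V: "num_vertices w \<ge> 2" and g: "2 * num_vertices w + 4 * g = length w + 2"
  obtains w' m where "standard True g m w'" "reach (3 * length w + 16 * g\<^sup>2 + 8 * g) w w'"
proof -
  obtain c w1 where c: "red c w1" "num_vertices c = 2" "double_word c" "reach (length w) w w1"
    using planarize[OF w V] by blast
  have d1: "double_word ([] @ w1)" using reach_invariants(5)[OF c(4)] w by simp
  obtain G where G: "red [] G" "reach (length c) w1 (c @ G)" using gather_core[OF c(1) d1] by auto
  have dG: "double_word (c @ G)" using reach_invariants(5)[OF G(2)] d1 by simp
  obtain m where m: "length G = 2 * m" "num_vertices (c @ G) = num_vertices c + m"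
    using red_num_vertices[OF G(1), of c "[]"] dG by auto
  have len: "length w = length c + length G" using reach_invariants(2)[OF c(4)] reach_invariants(2)[OF G(2)] by simp
  have "num_vertices w = 2 + m" using reach_invariants(3)[OF c(4)] reach_invariants(3)[OF G(2)] m(2) c(2) by simp
  then have lc: "length c = 4 * g + 2" using g len m(1) by simp
  obtain v where v: "standard True g 0 v" "reach (4 * (4 * g + 2) * g) c v"
    using standardize_two_vertices[OF c(3,2) lc] by blast
  have "reach (4 * (4 * g + 2) * g) (c @ G) (v @ G)"
  proof (rule reach_append[OF v(2) c(3), of _ m])
    fix u assume u: "double_word u" "set u = set c"
    have "set c \<inter> set G = {}" using red_disjoint[OF G(1), of c "[]"] dG by auto
    moreover have "double_word G" using red_double_word[OF G(1)] .
    ultimately have "double_word (u @ G)" using u by (intro double_word_append) auto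
    then show "num_vertices (u @ G) = num_vertices u + m"
      using red_num_vertices[OF G(1), of u "[]"] m(1) by auto
  qed
  note r = reach_trans[OF reach_trans[OF c(4) G(2)] this]
  have "double_word (v @ G)" using reach_invariants(5)[OF r] w by simp
  from planar_to_standard[OF G(1) this v(1)] obtain w' m' where
    w': "standard True g m' w'" "reach (length G) (v @ G) w'" by blast
  \<comment> \<open>The summands pay, in this order, for planarizing, gathering the core, splitting
    off handles and flattening the planar part.\<close>
  have "length w + length c + 4 * (4 * g + 2) * g + length G \<le> 3 * length w + 16 * g\<^sup>2 + 8 * g"
    using len by (simp add: power2_eq_square algebra_simps)
  from that[OF w'(1) reach_mono[OF reach_trans[OF r w'(2)] this]] show ?thesis .
qed

lemma Suc_next_side: "x < length w \<Longrightarrow> (Suc x, next_side (length w) x) \<in> veq w"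
  using eqcl_sym[OF veq_ends[of w]] by (auto simp: next_side_eq)

section \<open>One vertex class: the Bolza diagram\<close>

locale unicellular =
  fixes w :: "'a list"
  assumes w: "double_word w" and V: "num_vertices w = 1" and ne: "w \<noteq> []"
begin

abbreviation "N \<equiv> length w"
abbreviation "\<alpha> \<equiv> partner w"
abbreviation "\<sigma> \<equiv> vertex_perm w"

text \<open>A clock running through the single cycle of \<open>\<sigma>\<close>. Time is unbounded,
  so that intervals may wrap around without case distinctions.\<close>

definition "f s = (\<sigma> ^^ s) 0"

lemma N_pos: "N > 0" using ne by simp

lemma \<sigma>_less: "x < N \<Longrightarrow> \<sigma> x < N"
  using permutes_in_image[OF vertex_perm_permutes[OF w], of x] by simp

lemma f_0 [simp]: "f 0 = 0" and f_Suc: "f (Suc s) = \<sigma> (f s)"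
  by (simp_all add: f_def)

lemma f_less: "f s < N"
  by (induction s) (simp_all add: f_Suc \<sigma>_less ne)

lemma f_add: "f s = f t \<Longrightarrow> f (s + k) = f (t + k)"
  by (induction k) (simp_all add: f_Suc)

lemma f_cancel: "f (s + k) = f (t + k) \<Longrightarrow> f s = f t"
  by (induction k) (auto simp: f_Suc dest: injD[OF permutes_inj[OF vertex_perm_permutes[OF w]]])

lemma f_surj:
  assumes "x < N"
  obtains s where "f s = x"
proof -
  let ?O = "range f"
  have fin: "finite ?O" by (rule finite_subset[of _ "{..<N}"]) (use f_less in auto)
  have sub: "\<sigma> ` ?O \<subseteq> ?O"
  proof safe
    fix s show "\<sigma> (f s) \<in> range f" using f_Suc[of s] by (metis rangeI)
  qed
  have inj: "inj \<sigma>" by (rule permutes_inj[OF vertex_perm_permutes[OF w]])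
  have O: "\<sigma> ` ?O = ?O" by (rule endo_inj_surj[OF fin sub]) (use inj in \<open>auto intro: inj_on_subset\<close>)
  have "num_classes {..<N} (graph_of {..<N} \<sigma>) = 1" using num_vertices_orbits[OF w ne] V by simp
  from num_classes_1D[OF _ this, of 0 x] assms N_pos have 1: "(0, x) \<in> eqcl (graph_of {..<N} \<sigma>)" by simp
  have "x \<in> ?O"
  proof (rule eqcl_closed[OF 1])
    show "0 \<in> ?O" using f_0 by (metis rangeI)
    fix u v assume "(u, v) \<in> graph_of {..<N} \<sigma>"
    then have v: "v = \<sigma> u" by (auto simp: graph_of_def)
    show "u \<in> ?O \<longleftrightarrow> v \<in> ?O"
    proof
      assume "v \<in> ?O"
      then obtain y where "y \<in> ?O" "\<sigma> y = v" using O by (metis imageE)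
      then show "u \<in> ?O" using v inj by (metis injD)
    qed (use v sub in blast)
  qed
  then show ?thesis using that by blast
qed

lemma f_mod: "f d = 0 \<Longrightarrow> f s = f (s mod d)"
proof (induction s rule: less_induct)
  case (less s)
  show ?case
  proof (cases "s < d \<or> d = 0")
    case False
    then have "f (s - d) = f ((s - d) mod d)" using less by simp
    moreover have "f (0 + (s - d)) = f (d + (s - d))" using f_add[of 0 d "s - d"] less.prems by simp
    ultimately show ?thesis using False by (simp add: le_mod_geq)
  qed auto
qed

lemma period_ge: "0 < d \<Longrightarrow> f d = 0 \<Longrightarrow> d \<ge> N"
proof -
  assume d: "0 < d" "f d = 0"
  have "{..<N} \<subseteq> f ` {..<d}"
  proof
    fix x assume "x \<in> {..<N}"
    then obtain s where "f s = x" using f_surj by auto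
    then show "x \<in> f ` {..<d}" using f_mod[OF d(2), of s] d(1) by (intro image_eqI[of _ _ "s mod d"]) auto
  qed
  from card_mono[OF _ this] show "d \<ge> N" using card_image_le[of "{..<d}" f] by simp
qed

lemma f_eqD: "f s = f t \<Longrightarrow> s < t \<Longrightarrow> N \<le> t - s"
proof -
  assume "f s = f t" "s < t"
  then have "f (t - s) = 0" using f_cancel[of 0 s "t - s"] by simp
  then show ?thesis using period_ge[of "t - s"] \<open>s < t\<close> by simp
qed

lemma f_N: "f N = 0"
proof -
  have "\<not> inj_on f {..N}"
  proof
    assume "inj_on f {..N}"
    then have "card (f ` {..N}) = Suc N" by (simp add: card_image)
    moreover have "card (f ` {..N}) \<le> card {..<N}" by (rule card_mono) (use f_less in auto)
    ultimately show False by simp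
  qed
  then obtain s t where "s \<le> N" "t \<le> N" "f s = f t" "s \<noteq> t" by (auto simp: inj_on_def)
  then obtain s t where st: "s \<le> N" "t \<le> N" "f s = f t" "s < t" by (metis nat_neq_iff)
  then have "s = 0" "t = N" using f_eqD[OF st(3,4)] by auto
  then show ?thesis using st(3) by simp
qed

lemma f_periodic [simp]: "f (s + N) = f s"
  using f_add[of N 0 s] f_N by (simp add: add.commute)

lemma f_inj: "f s = f t \<Longrightarrow> a \<le> s \<Longrightarrow> s < a + N \<Longrightarrow> a \<le> t \<Longrightarrow> t < a + N \<Longrightarrow> s = t"
  using f_eqD[of s t] f_eqD[of t s] by (cases s t rule: linorder_cases) auto

lemma f_window:
  assumes "x < N"
  obtains t where "a \<le> t" "t < a + N" "f t = x"
proof -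
  have inj: "inj_on f {a..<a + N}" by (rule inj_onI) (use f_inj[where a = a] in auto)
  have "f ` {a..<a + N} = {..<N}"
    by (rule card_subset_eq) (use f_less card_image[OF inj] in auto)
  then have "x \<in> f ` {a..<a + N}" using assms by simp
  then show ?thesis using that by auto
qed

lemma \<alpha>: "\<alpha> (f s) < N" "\<alpha> (f s) \<noteq> f s" "\<alpha> (\<alpha> x) = x"
  using partner[OF w f_less] partner_invol[OF w] by auto

text \<open>The length of a chord in the cyclic order of \<open>\<sigma>\<close>, measured forwards
  from its side at time \<open>s\<close>.\<close>

definition "L s = (SOME l. l < N \<and> f (s + l) = \<alpha> (f s))"

lemma L: "L s < N" "f (s + L s) = \<alpha> (f s)"
proof -
  obtain t where "s \<le> t" "t < s + N" "f t = \<alpha> (f s)" using f_window[OF \<alpha>(1)] .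
  then have "t - s < N \<and> f (s + (t - s)) = \<alpha> (f s)" by auto
  from someI[of "\<lambda>l. l < N \<and> f (s + l) = \<alpha> (f s)", OF this]
  show "L s < N" "f (s + L s) = \<alpha> (f s)" unfolding L_def by auto
qed

lemma L_unique: "l < N \<Longrightarrow> f (s + l) = \<alpha> (f s) \<Longrightarrow> l = L s"
  using f_inj[of "s + l" "s + L s" s] L[of s] by simp

lemma L_pos: "L s > 0"
  using L(2)[of s] \<alpha>(2)[of s] by (cases "L s") auto

lemma L_periodic: "L (s + N) = L s"
proof (rule L_unique)
  have "f (s + N + L (s + N)) = f (s + L (s + N) + N)" by (rule arg_cong[of _ _ f]) simp
  then show "f (s + L (s + N)) = \<alpha> (f s)" using L(2)[of "s + N"] by simp
qed (rule L(1))

text \<open>Going on from the partner, the remainder of the cycle leads back to the starting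
  side.\<close>

lemma L_partner: "L (s + L s) = N - L s"
proof -
  have "f (s + L s + (N - L s)) = f s" using L(1)[of s] f_periodic[of s] by (simp add: add.assoc)
  then have "f (s + L s + (N - L s)) = \<alpha> (f (s + L s))" using L(2)[of s] \<alpha>(3) by simp
  from L_unique[OF _ this] show ?thesis using L_pos[of s] L(1)[of s] by simp
qed

lemma f_Suc_next: "f (Suc s) = next_side N (\<alpha> (f s))"
  by (simp add: f_Suc vertex_perm_def)

text \<open>
  In the cyclic order of \<open>\<sigma>\<close>, the chord of \<open>s\<close> and that of \<open>s + 1\<close> have lengths \<open>L s\<close> and
  \<open>L (s + 1)\<close>.  If they do not cross, exchanging the corresponding adjacent sides again gives a
  single cycle.
\<close>

lemma exchange_unicellular:
  assumes lt: "L (Suc s) < L s" and i: "i = \<alpha> (f s)" "Suc i < N"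
  shows "num_vertices (exchange w i (Suc i)) = 1"
proof -
  let ?w = "exchange w i (Suc i)"
  let ?E = "veq ?w"
  define p q l where "p = f s" and "q = \<alpha> (f (Suc s))" and "l = L (Suc s)"
  have Si: "f (Suc s) = Suc i" using i f_Suc_next[of s] by (simp add: next_side_eq)
  have iL: "f (s + L s) = i" using L(2) i by simp
  have qL: "f (Suc s + l) = q" using L(2)[of "Suc s"] by (simp add: l_def q_def)
  have lN: "0 < l" "L s < N" using L_pos L(1) by (simp_all add: l_def)
  \<comment> \<open>Equality would give the sides at times \<open>s\<close> and \<open>Suc s\<close>
    the same partner. So the chord of \<open>Suc s\<close> lies strictly inside that of
    \<open>s\<close>.\<close>
  have "Suc l \<noteq> L s"
  proof
    assume "Suc l = L s"
    then have "s + L s = Suc s + l" by simp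
    then have "f (s + L s) = f (Suc s + l)" by (rule arg_cong)
    then have "\<alpha> (f s) = \<alpha> (f (Suc s))" using iL qL i q_def by simp
    then have "f s = f (Suc s)" using \<alpha>(3) by metis
    then show False using f_eqD[of s "Suc s"] i(2) by simp
  qed
  then have lL: "Suc l < L s" using lt by (simp add: l_def)
  have pN: "p < N" "q < N" "i < N" using f_less \<alpha>(1) i by (simp_all add: p_def q_def)
  have \<alpha>p: "\<alpha> p = i" "\<alpha> i = p" using i \<alpha>(3) by (simp_all add: p_def)
  have \<alpha>q: "\<alpha> q = Suc i" "\<alpha> (Suc i) = q" using Si \<alpha>(3) by (simp_all add: q_def)
  have dist: "p \<noteq> i" "q \<noteq> Suc i" using \<alpha>(2)[of s] \<alpha>(2)[of "Suc s"] Si i by (simp_all add: p_def q_def)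
  have "p \<noteq> Suc i"
  proof
    assume "p = Suc i"
    then have "f s = f (Suc s)" using Si by (simp add: p_def)
    then show False using f_eqD[of s "Suc s"] i(2) by simp
  qed
  moreover have "q \<noteq> i"
    using \<open>p \<noteq> Suc i\<close> \<alpha>p \<alpha>q by metis
  ultimately have pq: "p \<noteq> Suc i" "q \<noteq> i" by blast+
  have nth: "?w ! x = w ! x" if "x < N" "x \<noteq> i" "x \<noteq> Suc i" for x
    using that i(2) by (simp add: exchange_def)
  have nthi: "?w ! i = w ! Suc i" "?w ! Suc i = w ! i" using i(2) by (auto simp: exchange_def)
  have wp: "w ! p = w ! i" "w ! q = w ! Suc i"
    using partner(3)[OF w pN(1)] partner(3)[OF w pN(2)] \<alpha>p \<alpha>q by simp_all
  have nxt: "(Suc x, next_side N x) \<in> ?E" if "x < N" for x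
    using Suc_next_side[of x ?w] that by simp
  \<comment> \<open>Only two chords are affected by the exchange; away from the times of their four
    ends the old cycle is still followed.\<close>
  have edge: "(f t, f (Suc t)) \<in> ?E" if "s < t" "t < s + N" "t \<noteq> Suc s" "t \<noteq> Suc s + l" "t \<noteq> s + L s" for t
  proof -
    let ?x = "f t"
    have inj: "f t = f t' \<Longrightarrow> s \<le> t' \<Longrightarrow> t' < s + N \<Longrightarrow> t = t'" for t'
      using f_inj[of t t' s] that by simp
    have x: "?x \<noteq> p" "?x \<noteq> i" "?x \<noteq> Suc i" "?x \<noteq> q"
      using inj[of s] inj[of "s + L s"] inj[of "Suc s"] inj[of "Suc s + l"] that iL Si qL lN lL i(2) N_pos
      by (auto simp: p_def)
    then have "\<alpha> ?x \<noteq> i" "\<alpha> ?x \<noteq> Suc i" using \<alpha>p \<alpha>q \<alpha>(3) by metis+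
    then have "?w ! ?x = ?w ! \<alpha> ?x" using x nth f_less[of t] \<alpha>(1)[of t] partner(3)[OF w f_less[of t]] by simp
    then have "(?x, Suc (\<alpha> ?x)) \<in> ?E"
      using f_less[of t] \<alpha>(1,2)[of t] by (intro veq_genI) auto
    from eqcl_trans[OF this nxt[OF \<alpha>(1)]] show ?thesis by (simp add: f_Suc_next)
  qed
  have segment: "(f t, f u) \<in> ?E" if "s < a" "a \<le> t" "t \<le> b" "a \<le> u" "u \<le> b" "b \<le> s + N"
      "\<And>t. a \<le> t \<Longrightarrow> t < b \<Longrightarrow> t \<noteq> Suc s \<and> t \<noteq> Suc s + l \<and> t \<noteq> s + L s" for a b t u
  proof -
    have seg: "(f a, f t) \<in> ?E" if "a \<le> t" "t \<le> b" for t
      using that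
    proof (induction t rule: dec_induct)
      case (step t)
      have "(f t, f (Suc t)) \<in> ?E"
        by (rule edge) (use step.hyps step.prems \<open>s < a\<close> \<open>b \<le> s + N\<close> \<open>\<And>t. a \<le> t \<Longrightarrow> t < b \<Longrightarrow> _ t\<close> in auto)
      moreover have "(f a, f t) \<in> ?E" using step.IH step.prems by simp
      ultimately show ?case by (rule eqcl_trans[rotated])
    qed simp
    show ?thesis using eqcl_trans[OF eqcl_sym[OF seg] seg] that by blast
  qed
  \<comment> \<open>These rewired transitions reconnect the segments into which the four times cut
    the old cycle.\<close>
  have e1: "(i, f (s + 2)) \<in> ?E"
  proof -
    have "(i, Suc q) \<in> ?E" using nthi wp nth[OF pN(2)] pq dist pN by (intro veq_genI) auto
    from eqcl_trans[OF this nxt[OF pN(2)]] show ?thesis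
      using f_Suc_next[of "Suc s"] by (simp add: q_def)
  qed
  have e2: "(q, f (Suc s)) \<in> ?E"
    unfolding Si using nthi wp nth[OF pN(2)] pq dist pN by (intro veq_genI) auto
  have e3: "(f (Suc s), f (s + L s + 1)) \<in> ?E"
  proof -
    have "(Suc i, Suc p) \<in> ?E" using nthi wp nth[OF pN(1)] pq dist pN i(2) by (intro veq_genI) auto
    from eqcl_trans[OF this nxt[OF pN(1)]] show ?thesis
      using f_Suc_next[of "s + L s"] \<alpha>p iL Si by simp
  qed
  have s2: "(f (Suc s), f t) \<in> ?E" if "s + 2 \<le> t" "t \<le> Suc s + l" for t
  proof -
    have "(f (Suc s + l), f t) \<in> ?E"
      by (rule segment[of "s + 2" _ "Suc s + l"]) (use that lN lL in auto)
    then show ?thesis using eqcl_trans[OF eqcl_sym[OF e2]] qL by simp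
  qed
  have s3: "(f (Suc s), f t) \<in> ?E" if "s + l + 2 \<le> t" "t \<le> s + L s" for t
  proof -
    have "(f (s + L s), f t) \<in> ?E"
      by (rule segment[of "s + l + 2" _ "s + L s"]) (use that lN lL in auto)
    moreover have "(f (Suc s), f (s + L s)) \<in> ?E"
      using eqcl_trans[OF s2[of "s + 2"] eqcl_sym[OF e1]] lN iL by simp
    ultimately show ?thesis by (rule eqcl_trans[rotated])
  qed
  have s4: "(f (Suc s), f t) \<in> ?E" if "s + L s + 1 \<le> t" "t \<le> s + N" for t
  proof -
    have "(f (s + L s + 1), f t) \<in> ?E"
      by (rule segment[of "s + L s + 1" _ "s + N"]) (use that lN lL in auto)
    from eqcl_trans[OF e3 this] show ?thesis .
  qed
  have all: "(f (Suc s), x) \<in> ?E" if "x < N" for x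
  proof -
    obtain t where t: "Suc s \<le> t" "t < Suc s + N" "f t = x" using f_window[OF \<open>x < N\<close>] .
    then consider "t = Suc s" | "s + 2 \<le> t" "t \<le> Suc s + l" | "s + l + 2 \<le> t" "t \<le> s + L s" | "s + L s + 1 \<le> t" "t \<le> s + N"
      by linarith
    then show ?thesis using s2 s3 s4 t(3) by cases auto
  qed
  have "(f (Suc s), N) \<in> ?E" using eqcl_trans[OF all[OF N_pos]] veq_ends[of ?w] by simp
  then have "(f (Suc s), x) \<in> ?E" if "x \<le> N" for x using all[of x] that by (cases "x = N") auto
  then show ?thesis unfolding num_vertices_def
    by (intro num_classes_1I[of "f (Suc s)"]) (use f_less[of "Suc s"] in auto)
qed

text \<open>Without a legal exchange the chord lengths cannot decrease along the cycle, except at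
  one time. As the lengths seen from the two ends of a chord add up to \<open>N\<close>, all of them
  must be \<open>N div 2\<close>. To translate this into the order of the sides, note that passing
  to the next side then takes \<open>N div 2 + 1\<close> steps of the cycle.\<close>

lemma antipodal:
  assumes ill: "\<And>i. Suc i < N \<Longrightarrow> num_vertices (exchange w i (Suc i)) \<noteq> 1"
    and x: "x < N"
  shows "\<alpha> x = (x + N div 2) mod N"
proof -
  let ?n = "N div 2"
  have N2: "N = 2 * ?n" using double_word_even_length[OF w] by simp
  have "even ?n" using num_vertices_parity[OF w] V by simp
  \<comment> \<open>The neighbours \<open>N - 1\<close> and \<open>0\<close> are separated by the
    cut, where \<open>ill\<close> says nothing. Starting the window just after the corresponding
    time makes the lengths monotone throughout it.\<close>
  obtain t0 where t0: "f t0 = \<alpha> (N - 1)" using f_surj[of "\<alpha> (N - 1)"] partner(1)[OF w, of "N - 1"] N_pos by auto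
  define s0 where "s0 = Suc t0"
  have mono1: "L s \<le> L (Suc s)" if "s0 \<le> s" "s < s0 + N - 1" for s
  proof (rule ccontr)
    assume "\<not> L s \<le> L (Suc s)"
    then have "\<not> Suc (\<alpha> (f s)) < N" using exchange_unicellular[of s "\<alpha> (f s)"] ill by auto
    then have "\<alpha> (f s) = N - 1" using \<alpha>(1)[of s] by simp
    then have "f s = f t0" using t0 \<alpha>(3) by metis
    then have "N \<le> s - t0" using f_eqD[of t0 s] that by (simp add: s0_def)
    then show False using that by (simp add: s0_def)
  qed
  have mono: "L (s0 + a) \<le> L (s0 + b)" if "a \<le> b" "b < N" for a b
    using that
  proof (induction b rule: dec_induct)
    case (step b)
    have "L (s0 + b) \<le> L (Suc (s0 + b))" by (rule mono1) (use step.prems in auto)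
    with step show ?case by simp
  qed simp
  have L_in: "L (s0 + b) = N - L (s0 + a)" if "a + L (s0 + a) = b \<or> a + L (s0 + a) = b + N" for a b
    using L_partner[of "s0 + a"] L_periodic[of "s0 + b"] that by (auto simp: add.assoc)
  define m where "m = L s0"
  have m: "m < N" "0 < m" using L L_pos by (simp_all add: m_def)
  \<comment> \<open>The smallest length \<open>m\<close> occurs at the start of the window and the
    largest, \<open>M\<close>, at its end. If \<open>m\<close> were below half, the partner of the
    first side would force lengths of at least \<open>N - m\<close> from offset \<open>m\<close> on.
    Then \<open>M\<close> is so large that the partner of the last side lies in this range, although
    its length \<open>N - M\<close> is too small for it.\<close>
  have ge: "?n \<le> m"
  proof (rule ccontr)
    assume "\<not> ?n \<le> m"
    then have mn: "m < ?n" by simp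
    define M where "M = L (s0 + (N - 1))"
    have M: "M < N" "0 < M" using L L_pos by (simp_all add: M_def)
    have "L (s0 + m) = N - m" using L_in[of 0 m] by (simp add: m_def)
    then have big: "N - m \<le> L (s0 + b)" if "m \<le> b" "b < N" for b using mono[OF that] by simp
    have "N - 1 + M = M - 1 + N" using M N_pos by linarith
    then have "L (s0 + (M - 1)) = N - M" using L_in[of "N - 1" "M - 1"] unfolding M_def[symmetric] by blast
    moreover have "m \<le> L (s0 + (M - 1))" using mono[of 0 "M - 1"] M by (simp add: m_def)
    moreover have "N - m \<le> M" using big[of "N - 1"] m by (simp add: M_def)
    moreover have "N - m \<le> L (s0 + (M - 1))" using \<open>N - m \<le> M\<close> mn N2 M by (intro big) auto
    ultimately show False using mn N2 M by linarith
  qed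
  have L_ge: "?n \<le> L s" for s
  proof -
    obtain t where t: "s0 \<le> t" "t < s0 + N" "f t = f s" using f_window[OF f_less] .
    have "f (s + L t) = f (t + L t)" using f_add[OF t(3)] by simp
    then have "L t = L s" using L[of t] t(3) by (intro L_unique) auto
    moreover have "m \<le> L (s0 + (t - s0))" using mono[of 0 "t - s0"] t by (simp add: m_def)
    ultimately show ?thesis using ge t(1) by simp
  qed
  have L_eq: "L s = ?n" for s
    using L_ge[of s] L_ge[of "s + L s"] L_partner[of s] L(1)[of s] N2 by linarith
  have \<alpha>f: "\<alpha> (f s) = f (s + ?n)" for s using L(2)[of s] L_eq by simp
  have next_f: "next_side N (f s) = f (s + ?n + 1)" for s
  proof -
    have "next_side N (\<alpha> (f (s + ?n))) = f (s + ?n + 1)" using f_Suc_next[of "s + ?n"] by simp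
    moreover have "\<alpha> (f (s + ?n)) = f s" using \<alpha>f[of s] \<alpha>(3) by metis
    ultimately show ?thesis by simp
  qed
  have next_k: "(f s + k) mod N = f (s + k * (?n + 1))" for s k
  proof (induction k)
    case (Suc k)
    have "(f s + Suc k) mod N = next_side N ((f s + k) mod N)"
      using N_pos by (simp add: next_side_def mod_Suc_eq)
    also have "\<dots> = f (s + k * (?n + 1) + ?n + 1)" unfolding Suc.IH by (rule next_f)
    also have "s + k * (?n + 1) + ?n + 1 = s + Suc k * (?n + 1)" by simp
    finally show ?case .
  qed (simp add: f_less)
  obtain s where s: "f s = x" using f_surj[OF x] .
  obtain h where h: "?n = 2 * h" using \<open>even ?n\<close> by blast
  have per: "f (a + k * N) = f a" for a k
  proof (induction k)
    case (Suc k)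
    then show ?case using f_periodic[of "a + k * N"] by (simp add: algebra_simps)
  qed simp
  \<comment> \<open>Because \<open>?n\<close> is even, advancing by \<open>?n\<close> sides amounts
    to \<open>?n\<close> steps of the cycle up to full turns.\<close>
  have "s + ?n * (?n + 1) = s + ?n + h * N" using N2 h by (simp add: algebra_simps)
  then have "(x + ?n) mod N = f (s + ?n)" using next_k[of s ?n] per[of "s + ?n" h] s by metis
  then show ?thesis using \<alpha>f[of s] s by simp
qed

end

section \<open>Chord diagrams as words\<close>

definition diagram_of :: "'a list \<Rightarrow> nat set set" where
  "diagram_of w = {{i, j} | i j. i < length w \<and> j < length w \<and> i \<noteq> j \<and> w ! i = w ! j}"

lemma pair_in_diagram_of:
  "{x, y} \<in> diagram_of w \<longleftrightarrow> x < length w \<and> y < length w \<and> x \<noteq> y \<and> w ! x = w ! y"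
  by (auto simp: diagram_of_def doubleton_eq_iff)

lemma diagram_of_partner:
  assumes "double_word w"
  shows "diagram_of w = (\<lambda>x. {x, partner w x}) ` {..<length w}"
proof (intro subset_antisym subsetI)
  fix c assume "c \<in> diagram_of w"
  then obtain i j where "c = {i, j}" "i < length w" "j < length w" "i \<noteq> j" "w ! i = w ! j"
    by (auto simp: diagram_of_def)
  then show "c \<in> (\<lambda>x. {x, partner w x}) ` {..<length w}"
    using partner_unique[OF assms, of i j] by (intro image_eqI[of _ _ i]) auto
next
  fix c assume "c \<in> (\<lambda>x. {x, partner w x}) ` {..<length w}"
  then obtain i where i: "i < length w" "c = {i, partner w i}" by auto
  then show "c \<in> diagram_of w" using partner[OF assms i(1)] by (simp add: pair_in_diagram_of)
qed

lemma same_shape_diagram_of: "same_shape w w' \<Longrightarrow> diagram_of w = diagram_of w'"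
proof -
  assume "same_shape w w'"
  then have "i < length w \<and> j < length w \<and> i \<noteq> j \<and> w ! i = w ! j \<longleftrightarrow>
      i < length w' \<and> j < length w' \<and> i \<noteq> j \<and> w' ! i = w' ! j" for i j
    by (auto simp: same_shape_def)
  then show ?thesis unfolding diagram_of_def by simp
qed

lemma chord_diagram_diagram_of:
  assumes w: "double_word w" and len: "length w = 2 * n"
  shows "chord_diagram n (diagram_of w)"
  unfolding chord_diagram_def
proof (intro conjI ballI)
  show "diagram_of w \<subseteq> chords n"
  proof
    fix c assume "c \<in> diagram_of w"
    then obtain i j where "c = {i, j}" "i < length w" "j < length w" "i \<noteq> j" by (auto simp: diagram_of_def)
    then show "c \<in> chords n"
      unfolding chords_def sides_def by (intro CollectI exI[of _ i] exI[of _ j]) (simp add: len)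
  qed
  show "card (diagram_of w) = n"
    using card_partner_pairs[OF w] len by (simp add: diagram_of_partner[OF w])
  fix s assume "s \<in> sides n"
  then have s: "s < length w" using len by (simp add: sides_def)
  show "\<exists>!c. c \<in> diagram_of w \<and> s \<in> c"
  proof (rule ex1I[of _ "{s, partner w s}"])
    show "{s, partner w s} \<in> diagram_of w \<and> s \<in> {s, partner w s}"
      using s by (auto simp: diagram_of_partner[OF w])
    fix c assume "c \<in> diagram_of w \<and> s \<in> c"
    then obtain x where "c = {x, partner w x}" "s = x \<or> s = partner w x"
      by (auto simp: diagram_of_partner[OF w])
    then show "c = {s, partner w s}"
      using partner_invol[OF w, of x] by (elim disjE) (simp_all add: insert_commute)
  qed
qed

text \<open>The chords themselves serve as letters: each side is labelled by the chord that contains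
  it.\<close>

lemma chord_diagram_word:
  assumes "chord_diagram n X"
  obtains w :: "nat set list" where "double_word w" "length w = 2 * n" "diagram_of w = X"
proof -
  define chord where "chord s = (THE c. c \<in> X \<and> s \<in> c)" for s
  have ex1: "\<exists>!c. c \<in> X \<and> s \<in> c" if "s < 2 * n" for s
    using assms that by (auto simp: chord_diagram_def sides_def)
  have chord: "chord s \<in> X" "s \<in> chord s" if "s < 2 * n" for s
    using theI'[OF ex1[OF that]] by (simp_all add: chord_def)
  have chord_eq: "chord s = c" if "c \<in> X" "s \<in> c" "s < 2 * n" for s c
    using ex1[OF that(3)] chord[OF that(3)] that by blast
  have X: "\<exists>x y. c = {x, y} \<and> x < 2 * n \<and> y < 2 * n \<and> x \<noteq> y" if "c \<in> X" for c
    using assms that by (auto simp: chord_diagram_def chords_def sides_def)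
  define w where "w = map chord [0..<2 * n]"
  have len: "length w = 2 * n" by (simp add: w_def)
  have nth: "w ! s = chord s" if "s < 2 * n" for s using that by (simp add: w_def)
  have "double_word w"
    unfolding double_word_def
  proof
    fix c assume "c \<in> set w"
    then have c: "c \<in> X" using chord by (auto simp: w_def)
    have "{j. j < length w \<and> w ! j = c} = c"
      using chord_eq[OF c] chord(2) X[OF c] nth len by auto
    moreover have "card c = 2" using X[OF c] by (auto simp: card_insert_if)
    ultimately show "count_list w c = 2" using card_positions[of w c] by simp
  qed
  moreover have "diagram_of w = X"
  proof (intro subset_antisym subsetI)
    fix c assume "c \<in> diagram_of w"
    then obtain i j where ij: "c = {i, j}" "i < 2 * n" "j < 2 * n" "i \<noteq> j" "chord i = chord j"
      unfolding diagram_of_def len using nth by auto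
    obtain x y where "chord i = {x, y}" using X[OF chord(1)[OF ij(2)]] by blast
    then have "chord i = {i, j}" using chord(2)[OF ij(2)] chord(2)[OF ij(3)] ij(4,5) by auto
    then show "c \<in> X" using chord(1)[OF ij(2)] ij(1) by simp
  next
    fix c assume c: "c \<in> X"
    obtain x y where "c = {x, y}" "x < 2 * n" "y < 2 * n" "x \<noteq> y" using X[OF c] by blast
    then show "c \<in> diagram_of w"
      using chord_eq[OF c, of x] chord_eq[OF c, of y] nth by (simp add: pair_in_diagram_of len)
  qed
  ultimately show ?thesis using that len by blast
qed

lemma glue_diagram_of:
  assumes w: "double_word w" and len: "length w = 2 * n"
  shows "glue n (diagram_of w) = graph_of {..<length w} (vertex_perm w)"
proof -
  have "{x, y} \<in> diagram_of w \<longleftrightarrow> x < length w \<and> y = partner w x" for x y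
    using partner_unique[OF w, of x y] partner[OF w, of x] by (auto simp: pair_in_diagram_of)
  moreover have "next_vertex n (partner w x) = vertex_perm w x" if "x < length w" for x
    using partner(1)[OF w that] len by (simp add: next_vertex_def vertex_perm_def next_side_def)
  ultimately show ?thesis unfolding glue_def graph_of_def by auto
qed

lemma card_vertex_classes:
  assumes w: "double_word w" and len: "length w = 2 * n" and "n > 0"
  shows "card (vertex_classes n (diagram_of w)) = num_vertices w"
proof -
  have "w \<noteq> []" using assms by auto
  from num_vertices_orbits[OF w this] show ?thesis
    unfolding vertex_classes_def vertices_def glue_diagram_of[OF w len] num_classes_def eqcl_def
    by (simp add: len)
qed

lemma diagram_of_in_diagrams:
  assumes "double_word w" "length w = 2 * n" "n > 0"
  shows "diagram_of w \<in> diagrams n g \<longleftrightarrow> num_vertices w + 2 * g = n + 1"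
proof -
  have "genus n (diagram_of w) = real g \<longleftrightarrow> real (num_vertices w + 2 * g) = real (n + 1)"
    unfolding genus_def card_vertex_classes[OF assms] by (auto simp: field_simps)
  then show ?thesis
    unfolding diagrams_def using chord_diagram_diagram_of[OF assms(1,2)] by (simp only: mem_Collect_eq of_nat_eq_iff simp_thms)
qed

text \<open>Exchanging two letters gives each of the two sides the partner of the other and leaves
  all other chords alone.\<close>

lemma chord_swap_exchange:
  assumes w: "double_word w" and ij: "i < length w" "j < length w" "w ! i \<noteq> w ! j"
  shows "chord_swap (diagram_of w) (diagram_of (exchange w i j))"
proof -
  let ?w = "exchange w i j" and ?\<alpha> = "partner w"
  define p q where "p = ?\<alpha> i" and "q = ?\<alpha> j"
  have p: "p < length w" "p \<noteq> i" "w ! p = w ! i" and q: "q < length w" "q \<noteq> j" "w ! q = w ! j"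
    using partner[OF w ij(1)] partner[OF w ij(2)] by (simp_all add: p_def q_def)
  have ne: "i \<noteq> j" "p \<noteq> j" "q \<noteq> i" "p \<noteq> q" using ij(3) p(3) q(3) by auto
  have w': "double_word ?w" using w ij by simp
  have nth: "?w ! i = w ! j" "?w ! j = w ! i" using ij ne by (auto simp: exchange_def)
  have nth': "?w ! x = w ! x" if "x \<noteq> i" "x \<noteq> j" for x using that by (simp add: exchange_def)
  have \<beta>: "partner ?w i = q" "partner ?w q = i" "partner ?w j = p" "partner ?w p = j"
    using p q ne ij nth nth' by (auto intro!: partner_unique[OF w'])
  have \<alpha>: "?\<alpha> i = p" "?\<alpha> p = i" "?\<alpha> j = q" "?\<alpha> q = j"
    using partner_invol[OF w] by (simp_all add: p_def q_def)
  have rest: "partner ?w x = ?\<alpha> x" if x: "x < length w" "x \<notin> {i, j, p, q}" for x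
  proof -
    have "?\<alpha> x \<noteq> y" if "x \<noteq> ?\<alpha> y" for y using that partner_invol[OF w, of x] by auto
    then have "?\<alpha> x \<noteq> i" "?\<alpha> x \<noteq> j" using x(2) \<alpha> by simp_all
    then show ?thesis
      using x partner[OF w x(1)] nth' by (intro partner_unique[OF w']) auto
  qed
  have "diagram_of ?w = (diagram_of w - {{i, p}, {j, q}}) \<union> {{i, q}, {p, j}}"
  proof (intro subset_antisym subsetI)
    fix c assume "c \<in> diagram_of ?w"
    then obtain x where x: "x < length w" "c = {x, partner ?w x}" by (auto simp: diagram_of_partner[OF w'])
    consider "x = i \<or> x = q" | "x = j \<or> x = p" | "x \<notin> {i, j, p, q}" by blast
    then show "c \<in> (diagram_of w - {{i, p}, {j, q}}) \<union> {{i, q}, {p, j}}"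
    proof cases
      case 1
      then have "c = {i, q}" using x(2) \<beta> by (elim disjE) (simp_all add: insert_commute)
      then show ?thesis by simp
    next
      case 2
      then have "c = {p, j}" using x(2) \<beta> by (elim disjE) (simp_all add: insert_commute)
      then show ?thesis by simp
    next
      case 3
      then have "c = {x, ?\<alpha> x}" using x rest by simp
      moreover have "{x, ?\<alpha> x} \<noteq> {i, p}" "{x, ?\<alpha> x} \<noteq> {j, q}" using 3 by blast+
      ultimately show ?thesis using x(1) by (simp add: diagram_of_partner[OF w])
    qed
  next
    fix c assume "c \<in> (diagram_of w - {{i, p}, {j, q}}) \<union> {{i, q}, {p, j}}"
    then consider "c \<in> diagram_of w" "c \<noteq> {i, p}" "c \<noteq> {j, q}" | "c = {i, q}" | "c = {p, j}" by blast
    then show "c \<in> diagram_of ?w"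
    proof cases
      case 1
      then obtain x where x: "x < length w" "c = {x, ?\<alpha> x}" by (auto simp: diagram_of_partner[OF w])
      have "x \<notin> {i, j, p, q}"
      proof
        assume "x \<in> {i, j, p, q}"
        then consider "x = i" | "x = j" | "x = p" | "x = q" by blast
        then have "c = {i, p} \<or> c = {j, q}" by cases (simp_all add: x(2) \<alpha> insert_commute)
        then show False using 1 by blast
      qed
      then have "c = {x, partner ?w x}" using x rest by simp
      then show ?thesis using x(1) by (simp add: diagram_of_partner[OF w'])
    next
      case 2
      then have "c = {i, partner ?w i}" by (simp add: \<beta>)
      then show ?thesis using ij(1) by (simp add: diagram_of_partner[OF w'])
    next
      case 3
      then have "c = {p, partner ?w p}" by (simp add: \<beta>)
      then show ?thesis using p(1) by (simp add: diagram_of_partner[OF w'])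
    qed
  qed
  moreover have "{i, p} \<in> diagram_of w" "{j, q} \<in> diagram_of w"
    using p q ij by (auto simp: pair_in_diagram_of)
  moreover have "{i, p} \<noteq> {j, q}" using ne by blast
  ultimately show ?thesis unfolding chord_swap_def by blast
qed

lemma diagram_of_step:
  assumes "double_word w" "step w w'"
  shows "diagram_of w' = diagram_of w \<or> chord_swap (diagram_of w) (diagram_of w')"
proof -
  from assms(2) consider "w' = w" | i j where "i < length w" "j < length w" "w' = exchange w i j"
    by (auto simp: step_def)
  then show ?thesis
  proof cases
    case (2 i j)
    show ?thesis
    proof (cases "w ! i = w ! j")
      case True
      have "exchange w i j = w" unfolding exchange_def using True by (metis list_update_id)
      then show ?thesis using 2 by simp
    qed (use chord_swap_exchange[OF assms(1) 2(1,2)] 2(3) in simp)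
  qed simp
qed

section \<open>Walks in the swap graph\<close>

definition linked :: "nat \<Rightarrow> nat \<Rightarrow> nat \<Rightarrow> nat set set \<Rightarrow> nat set set \<Rightarrow> bool" where
  "linked n g k X Y \<longleftrightarrow> (\<exists>p. pre_digraph.awalk (with_proj (swap_graph n g)) X p Y \<and> length p \<le> k)"

lemma wf_digraph_swap_graph: "wf_digraph (with_proj (swap_graph n g))"
proof -
  interpret pair_graph "swap_graph n g" by (rule pair_graph_swap_graph)
  show ?thesis by (rule wf_digraph_axioms)
qed

lemma linked_trans:
  assumes "linked n g k X Y" "linked n g l Y Z"
  shows "linked n g (k + l) X Z"
proof -
  interpret wf_digraph "with_proj (swap_graph n g)" by (rule wf_digraph_swap_graph)
  from assms obtain p q where "awalk X p Y" "length p \<le> k" "awalk Y q Z" "length q \<le> l"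
    by (auto simp: linked_def)
  then have "awalk X (p @ q) Z" "length (p @ q) \<le> k + l" by (auto intro: awalk_appendI)
  then show ?thesis unfolding linked_def by blast
qed

lemma linked_refl: "X \<in> diagrams n g \<Longrightarrow> linked n g k X X"
proof -
  assume X: "X \<in> diagrams n g"
  interpret wf_digraph "with_proj (swap_graph n g)" by (rule wf_digraph_swap_graph)
  have "awalk X [] X" unfolding awalk_Nil_iff using X by (simp add: swap_graph_def)
  then show ?thesis unfolding linked_def by (intro exI[of _ "[]"]) simp
qed

lemma graph_dist_linked:
  assumes "linked n g k X Y"
  shows "graph_dist (swap_graph n g) X Y \<le> ereal (real k)"
proof -
  interpret wf_digraph "with_proj (swap_graph n g)" by (rule wf_digraph_swap_graph)
  from assms obtain p where p: "awalk X p Y" "length p \<le> k" by (auto simp: linked_def)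
  have "awalk_cost (\<lambda>_. 1) p = real (length p)" by (simp add: awalk_cost_def sum_list_triv)
  then have "awalk_cost (\<lambda>_. 1) p \<le> real k" using p(2) by simp
  with min_cost_le_walk_cost[OF p(1), of "\<lambda>_. 1"] show ?thesis
    unfolding graph_dist_def by (meson ereal_less_eq(3) order_trans)
qed

lemma linked_step:
  assumes w: "double_word w" "length w = 2 * n" "n > 0" "diagram_of w \<in> diagrams n g" and s: "step w w'"
  shows "linked n g 1 (diagram_of w) (diagram_of w')"
proof -
  interpret wf_digraph "with_proj (swap_graph n g)" by (rule wf_digraph_swap_graph)
  have w': "diagram_of w' \<in> diagrams n g"
    using w diagram_of_in_diagrams[of w n g] diagram_of_in_diagrams[of w' n g] step_invariants[OF s] by simp
  show ?thesis
  \<comment> \<open>A step may leave the diagram unchanged, and the graph has no loops; the empty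
    walk is used then.\<close>
  proof (cases "diagram_of w' = diagram_of w")
    case True
    then show ?thesis using linked_refl[OF w(4)] by simp
  next
    case False
    let ?e = "(diagram_of w, diagram_of w')"
    have "?e \<in> arcs (with_proj (swap_graph n g))"
      using False diagram_of_step[OF w(1) s] w(4) w' by (simp add: swap_graph_def)
    moreover have "diagram_of w' \<in> verts (with_proj (swap_graph n g))" using w' by (simp add: swap_graph_def)
    ultimately have "awalk (diagram_of w) [?e] (diagram_of w')"
      by (simp add: awalk_Cons_iff awalk_Nil_iff)
    then show ?thesis unfolding linked_def by (intro exI[of _ "[?e]"]) simp
  qed
qed

lemma linked_reach:
  assumes "double_word w" "length w = 2 * n" "n > 0" "diagram_of w \<in> diagrams n g"
  shows "reach k w w' \<Longrightarrow> linked n g k (diagram_of w) (diagram_of w')"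
proof (induction k arbitrary: w')
  case 0
  then show ?case using linked_refl[OF assms(4)] by simp
next
  case (Suc k)
  then obtain v where v: "reach k w v" "step v w'" by auto
  note inv = reach_invariants[OF v(1)]
  have "diagram_of v \<in> diagrams n g"
    using assms diagram_of_in_diagrams[of w n g] diagram_of_in_diagrams[of v n g] inv by simp
  from linked_step[OF _ _ assms(3) this v(2)] have "linked n g 1 (diagram_of v) (diagram_of w')"
    using inv assms(1,2) by simp
  from linked_trans[OF Suc.IH[OF v(1)] this] show ?case by simp
qed

text \<open>Both words are brought to normal forms, and the second path is reversed. Since the
  lengths agree, one parameter of the normal form determines the other: with several vertices the
  genus is known in advance, with one vertex there are no trailing short chords.\<close>

lemma linked_via_standard:
  assumes w: "double_word w" "length w = 2 * n" "diagram_of w \<in> diagrams n g"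
    and w': "double_word w'" "length w' = 2 * n" "diagram_of w' \<in> diagrams n g" and n: "n > 0"
    and r: "reach k w c" "reach k w' c'" and st: "standard b h m c" "standard b h' m' c'" "h = h' \<or> m = m'"
  shows "linked n g (2 * k) (diagram_of w) (diagram_of w')"
proof -
  have "length c = length c'" using reach_invariants(2)[OF r(1)] reach_invariants(2)[OF r(2)] w w' by simp
  then have "h = h'" "m = m'" using st length_standard[OF st(1)] length_standard[OF st(2)] by auto
  then have eq: "diagram_of c = diagram_of c'"
    using st by (intro same_shape_diagram_of standard_unique) auto
  note inv = reach_invariants[OF r(2)]
  have "diagram_of c' \<in> diagrams n g"
    using w' n diagram_of_in_diagrams[of w' n g] diagram_of_in_diagrams[of c' n g] inv by simp
  from linked_reach[OF _ _ n this reach_sym[OF r(2)]] have "linked n g k (diagram_of c) (diagram_of w')"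
    using inv w' eq by simp
  from linked_trans[OF linked_reach[OF w(1,2) n w(3) r(1)] this] show ?thesis by (simp add: mult_2)
qed

lemma linked_small_genus:
  assumes X: "X \<in> diagrams n g" and Y: "Y \<in> diagrams n g" and n: "n > 0" and g: "2 * g < n"
  shows "linked n g (2 * (10 * n + 16 * g\<^sup>2)) X Y"
proof -
  have word: "\<exists>(w :: nat set list) c m. double_word w \<and> length w = 2 * n \<and> diagram_of w = X \<and>
      standard True g m c \<and> reach (10 * n + 16 * g\<^sup>2) w c" if "X \<in> diagrams n g" for X
  proof -
    have "chord_diagram n X" using that by (simp add: diagrams_def)
    then obtain w :: "nat set list" where w: "double_word w" "length w = 2 * n" "diagram_of w = X"
      by (rule chord_diagram_word)
    have V: "num_vertices w + 2 * g = n + 1" using that diagram_of_in_diagrams[OF w(1,2) n] w(3) by simp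
    have "num_vertices w \<ge> 2" "2 * num_vertices w + 4 * g = length w + 2" using V g w(2) by simp_all
    from standardize_multicellular[OF w(1) this] obtain c m where
      c: "standard True g m c" "reach (3 * length w + 16 * g\<^sup>2 + 8 * g) w c" .
    \<comment> \<open>\<open>3 * length w\<close> is \<open>6 * n\<close>, and \<open>8 * g\<close>
      is less than \<open>4 * n\<close>.\<close>
    have "3 * length w + 16 * g\<^sup>2 + 8 * g \<le> 10 * n + 16 * g\<^sup>2" using g w(2) by simp
    with w c reach_mono show ?thesis by blast
  qed
  obtain w c m where w: "double_word (w :: nat set list)" "length w = 2 * n" "diagram_of w = X"
    "standard True g m c" "reach (10 * n + 16 * g\<^sup>2) w c" using word[OF X] by blast
  obtain w' c' m' where w': "double_word (w' :: nat set list)" "length w' = 2 * n" "diagram_of w' = Y"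
    "standard True g m' c'" "reach (10 * n + 16 * g\<^sup>2) w' c'" using word[OF Y] by blast
  from linked_via_standard[OF w(1,2) _ w'(1,2) _ n w(5) w'(5) w(4) w'(4)] X Y w(3) w'(3)
  show ?thesis by simp
qed

lemma antipodal_Bolza:
  assumes w: "double_word w" "length w = 2 * n" and x: "\<And>x. x < length w \<Longrightarrow> partner w x = (x + n) mod (2 * n)"
  shows "diagram_of w = Bolza n"
proof (intro subset_antisym subsetI)
  fix c assume "c \<in> diagram_of w"
  then obtain x where x': "x < 2 * n" "c = {x, (x + n) mod (2 * n)}"
    using x w by (auto simp: diagram_of_partner)
  show "c \<in> Bolza n"
  proof (cases "x < n")
    case True
    then show ?thesis using x' unfolding Bolza_def by auto
  next
    case False
    then have "(x + n) mod (2 * n) = x - n" using x' by (simp add: mod_if)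
    then have "c = {x - n, (x - n) + n}" using x' False by auto
    then show ?thesis using x' False unfolding Bolza_def by (intro CollectI exI[of _ "x - n"]) auto
  qed
next
  fix c assume "c \<in> Bolza n"
  then obtain y where y: "y < n" "c = {y, y + n}" by (auto simp: Bolza_def)
  then show "c \<in> diagram_of w"
    using x[of y] w by (auto simp: diagram_of_partner intro!: image_eqI[of _ _ y])
qed

lemma linked_max_genus:
  assumes X: "X \<in> diagrams n g" and Y: "Y \<in> diagrams n g" and n: "n > 0" and g: "n = 2 * g"
    and ne: "X \<noteq> Bolza n" "Y \<noteq> Bolza n"
  shows "linked n g (2 * (7 * n + 96 * g\<^sup>2)) X Y"
proof -
  have word: "\<exists>(w :: nat set list) c h. double_word w \<and> length w = 2 * n \<and> diagram_of w = X \<and>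
      standard False h 0 c \<and> reach (7 * n + 96 * g\<^sup>2) w c" if X: "X \<in> diagrams n g" and "X \<noteq> Bolza n" for X
  proof -
    have "chord_diagram n X" using X by (simp add: diagrams_def)
    then obtain w :: "nat set list" where u: "double_word w" "length w = 2 * n" "diagram_of w = X"
      by (rule chord_diagram_word)
    have V: "num_vertices w = 1" using X diagram_of_in_diagrams[OF u(1,2) n] u(3) g by simp
    have "w \<noteq> []" using u(2) n by auto
    interpret unicellular w by unfold_locales (fact u(1) V \<open>w \<noteq> []\<close>)+
    have "\<exists>i. Suc i < length w \<and> num_vertices (exchange w i (Suc i)) = 1"
    proof (rule ccontr)
      assume "\<not> ?thesis"
      then have "partner w x = (x + length w div 2) mod length w" if "x < length w" for x
        using antipodal that by blast
      then have "diagram_of w = Bolza n" using antipodal_Bolza[OF u(1,2)] u(2) by simp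
      with u(3) \<open>X \<noteq> Bolza n\<close> show False by simp
    qed
    then obtain i where i: "Suc i < length w" "num_vertices (exchange w i (Suc i)) = 1" by blast
    from standardize_unicellular[OF u(1) V i] obtain c h where
      c: "standard False h 0 c" "reach (1 + 3 * length w + 6 * (length w)\<^sup>2) w c" .
    \<comment> \<open>Here \<open>length w = 4 * g\<close>, which turns the quadratic term into
      \<open>96 * g^2\<close>.\<close>
    have "1 + 3 * length w + 6 * (length w)\<^sup>2 \<le> 7 * n + 96 * g\<^sup>2"
      using n g u(2) by (simp add: power2_eq_square)
    with u c reach_mono show ?thesis by blast
  qed
  obtain w c h where w: "double_word (w :: nat set list)" "length w = 2 * n" "diagram_of w = X"
    "standard False h 0 c" "reach (7 * n + 96 * g\<^sup>2) w c" using word[OF X ne(1)] by blast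
  obtain w' c' h' where w': "double_word (w' :: nat set list)" "length w' = 2 * n" "diagram_of w' = Y"
    "standard False h' 0 c'" "reach (7 * n + 96 * g\<^sup>2) w' c'" using word[OF Y ne(2)] by blast
  from linked_via_standard[OF w(1,2) _ w'(1,2) _ n w(5) w'(5) w(4) w'(4)] X Y w(3) w'(3)
  show ?thesis by simp
qed

theorem mainTheorem4:
  shows "\<exists>C::real. C > 0 \<and>
    (\<forall>n g :: nat. n \<ge> 2 \<longrightarrow> real g \<le> real n / 2 \<longrightarrow>
       (real g < real n / 2 \<longrightarrow>
          graph_diameter (swap_graph n g) \<le> ereal (C * (real n + real g ^ 2))) \<and>
       (real g = real n / 2 \<longrightarrow>
          (\<forall>X \<in> diagrams n g. \<forall>Y \<in> diagrams n g.
             X \<noteq> Bolza n \<longrightarrow> Y \<noteq> Bolza n \<longrightarrow>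
             graph_dist (swap_graph n g) X Y \<le> ereal (C * (real n + real g ^ 2)))))"
proof (intro exI[of _ 200] conjI allI impI ballI)
  \<comment> \<open>The two cases need \<open>20 * n + 32 * g^2\<close> and
    \<open>14 * n + 192 * g^2\<close>; \<open>200\<close> exceeds all four coefficients.\<close>
  fix n g :: nat
  assume n: "n \<ge> 2"
  {
    assume "real g < real n / 2"
    then have g: "2 * g < n" by linarith
    show "graph_diameter (swap_graph n g) \<le> ereal (200 * (real n + real g ^ 2))"
      unfolding graph_diameter_def
    proof (intro SUP_least)
      fix X Y assume "X \<in> pverts (swap_graph n g)" "Y \<in> pverts (swap_graph n g)"
      then have "linked n g (2 * (10 * n + 16 * g\<^sup>2)) X Y"
        using n g by (intro linked_small_genus) (auto simp: swap_graph_def)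
      from graph_dist_linked[OF this]
      show "graph_dist (swap_graph n g) X Y \<le> ereal (200 * (real n + real g ^ 2))"
        by (rule order_trans) simp
    qed
  next
    assume "real g = real n / 2"
    then have g: "n = 2 * g" by linarith
    fix X Y assume "X \<in> diagrams n g" "Y \<in> diagrams n g" "X \<noteq> Bolza n" "Y \<noteq> Bolza n"
    then have "linked n g (2 * (7 * n + 96 * g\<^sup>2)) X Y"
      using n g by (intro linked_max_genus) auto
    from graph_dist_linked[OF this]
    show "graph_dist (swap_graph n g) X Y \<le> ereal (200 * (real n + real g ^ 2))"
      by (rule order_trans) simp
  }
qed simp

end
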